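(* Let $g=-\nabla U:\mathbb{R}^d\to\mathbb{R}^d$ satisfy Assumption A (see context), and let $\mu$, with density $Ke^{-U(x)}$, be the ergodic measure of the Langevin SDE $\mathrm{d}X_t=g(X_t)\,\mathrm{d}t+\sqrt2\,\mathrm{d}B_t$. For a step size $s>0$ consider the Markov chain $Y_{k+1}=Y_k+s\,g(Y_k)+\sqrt{2s}\,Z_{k+1}$, where $Z_1,Z_2,\dots$ are i.i.d. standard $d$-dimensional Gaussian vectors independent of $Y_0$, and assume it has an invariant probability measure $\mu_s$. If $s<1/e$, then $$d_{\mathcal W}(\mu_s,\mu)\le C_\theta\sqrt s\Big\{|\log s|\,\mathbb{E}|Z_1|^3+s^{3/2}|\log s|\,\mathbb{E}|g(W)|^3+s^{1/2}\mathbb{E}|g(W)|^2+\mathbb{E}\big[|\tilde\delta|^3|\log|\tilde\delta||\big]\Big\},$$ where $W\sim\mu_s$ is independent of $Z_1$ and $\tilde\delta=\sqrt s\,g(W)+\sqrt2\,Z_1$.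
   Context: $|\cdot|$ Euclidean norm; $\nabla_u g$ directional derivative. Assumption A: $g\in\mathcal C^2(\mathbb{R}^d,\mathbb{R}^d)$ and there exist $\theta_0>0$, $\theta_1,\theta_2,\theta_3\ge0$ with $\langle u,\nabla_u g(x)\rangle\le-\theta_0(1+\theta_1|x|^{\theta_2})|u|^2$ and $|\nabla_{u_1}\nabla_{u_2}g(x)|\le\theta_3(1+\theta_1|x|)^{\theta_2-1}|u_1||u_2|$ for all $u,u_1,u_2,x$. Then there is $\theta_4>0$ (depending on $\theta_1,\theta_2,\theta_3,g(0),\nabla g(0)$) with $|g(x)|\le\theta_4(1+|x|^{1+\theta_2})$, and the SDE has a unique ergodic measure. $C_\theta$ is a positive constant depending only on $\theta_0,\dots,\theta_4$. $d_{\mathcal W}$ is the Wasserstein distance: supremum of $|\int h\,\mathrm d\mu_s-\int h\,\mathrm d\mu|$ over 1-Lipschitz $h:\mathbb{R}^d\to\mathbb{R}$. *)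

theory Defs
  imports "HOL-Probability.Probability"
begin

text \<open>Euclidean space R^d is represented uniformly in d (so that constants can be
  chosen independently of the dimension) as the subspace of nat \<Rightarrow> real of
  vectors vanishing at all coordinates i \<ge> d.\<close>

definition Esp :: "nat \<Rightarrow> (nat \<Rightarrow> real) set" where
  "Esp d = {x. \<forall>i\<ge>d. x i = 0}"

definition vnorm :: "nat \<Rightarrow> (nat \<Rightarrow> real) \<Rightarrow> real" where
  "vnorm d x = sqrt (\<Sum>i<d. (x i)\<^sup>2)"

definition vinner :: "nat \<Rightarrow> (nat \<Rightarrow> real) \<Rightarrow> (nat \<Rightarrow> real) \<Rightarrow> real" where
  "vinner d x y = (\<Sum>i<d. x i * y i)"

definition emb :: "nat \<Rightarrow> (nat \<Rightarrow> real) \<Rightarrow> (nat \<Rightarrow> real)" where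
  "emb d x = (\<lambda>i. if i < d then x i else 0)"

definition unitv :: "nat \<Rightarrow> nat \<Rightarrow> real" where
  "unitv j = (\<lambda>k. if k = j then 1 else 0)"

text \<open>real power with the convention a^0 = 1 (Isabelle's powr has 0 powr 0 = 0)\<close>
definition rpow :: "real \<Rightarrow> real \<Rightarrow> real" where
  "rpow a b = (if b = 0 then 1 else a powr b)"

definition Econt :: "nat \<Rightarrow> ((nat \<Rightarrow> real) \<Rightarrow> real) \<Rightarrow> bool" where
  "Econt d f \<longleftrightarrow> (\<forall>x\<in>Esp d. \<forall>e>0. \<exists>\<delta>>0. \<forall>y\<in>Esp d.
      vnorm d (\<lambda>i. y i - x i) < \<delta> \<longrightarrow> \<bar>f y - f x\<bar> < e)"

definition has_partial :: "((nat \<Rightarrow> real) \<Rightarrow> real) \<Rightarrow> nat \<Rightarrow> (nat \<Rightarrow> real) \<Rightarrow> bool" where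
  "has_partial f j x \<longleftrightarrow> (\<lambda>t. f (\<lambda>k. x k + t * unitv j k)) differentiable (at 0)"

definition partial :: "((nat \<Rightarrow> real) \<Rightarrow> real) \<Rightarrow> nat \<Rightarrow> (nat \<Rightarrow> real) \<Rightarrow> real" where
  "partial f j x = deriv (\<lambda>t. f (\<lambda>k. x k + t * unitv j k)) 0"

definition C2_real :: "nat \<Rightarrow> ((nat \<Rightarrow> real) \<Rightarrow> real) \<Rightarrow> bool" where
  "C2_real d f \<longleftrightarrow>
     (\<forall>j<d. \<forall>x\<in>Esp d. has_partial f j x) \<and>
     (\<forall>j<d. \<forall>k<d. \<forall>x\<in>Esp d. has_partial (partial f j) k x) \<and>
     Econt d f \<and> (\<forall>j<d. Econt d (partial f j)) \<and>
     (\<forall>j<d. \<forall>k<d. Econt d (partial (partial f j) k))"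

definition C2_vec :: "nat \<Rightarrow> ((nat \<Rightarrow> real) \<Rightarrow> (nat \<Rightarrow> real)) \<Rightarrow> bool" where
  "C2_vec d g \<longleftrightarrow> (\<forall>x\<in>Esp d. g x \<in> Esp d) \<and> (\<forall>i<d. C2_real d (\<lambda>x. g x i))"

definition dirD :: "nat \<Rightarrow> (nat \<Rightarrow> real) \<Rightarrow> ((nat \<Rightarrow> real) \<Rightarrow> (nat \<Rightarrow> real)) \<Rightarrow> (nat \<Rightarrow> real) \<Rightarrow> (nat \<Rightarrow> real)" where
  "dirD d u F x = (\<lambda>i. if i < d then deriv (\<lambda>t. F (\<lambda>k. x k + t * u k) i) 0 else 0)"

definition assumptionA :: "nat \<Rightarrow> ((nat \<Rightarrow> real) \<Rightarrow> (nat \<Rightarrow> real)) \<Rightarrow> real \<Rightarrow> real \<Rightarrow> real \<Rightarrow> real \<Rightarrow> bool" where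
  "assumptionA d g \<theta>0 \<theta>1 \<theta>2 \<theta>3 \<longleftrightarrow>
     C2_vec d g \<and> \<theta>0 > 0 \<and> \<theta>1 \<ge> 0 \<and> \<theta>2 \<ge> 0 \<and> \<theta>3 \<ge> 0 \<and>
     (\<forall>x\<in>Esp d. \<forall>u\<in>Esp d.
        vinner d u (dirD d u g x) \<le> - \<theta>0 * (1 + \<theta>1 * rpow (vnorm d x) \<theta>2) * (vnorm d u)\<^sup>2) \<and>
     (\<forall>x\<in>Esp d. \<forall>u1\<in>Esp d. \<forall>u2\<in>Esp d.
        vnorm d (dirD d u1 (dirD d u2 g) x)
          \<le> \<theta>3 * rpow (1 + \<theta>1 * vnorm d x) (\<theta>2 - 1) * vnorm d u1 * vnorm d u2)"

definition Rsp :: "(nat \<Rightarrow> real) measure" where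
  "Rsp = PiM UNIV (\<lambda>_. borel)"

definition lebE :: "nat \<Rightarrow> (nat \<Rightarrow> real) measure" where
  "lebE d = distr (PiM {..<d} (\<lambda>_. lborel)) Rsp (emb d)"

definition gaussE :: "nat \<Rightarrow> (nat \<Rightarrow> real) measure" where
  "gaussE d = distr (PiM {..<d} (\<lambda>_. density lborel std_normal_density)) Rsp (emb d)"

definition lip1 :: "nat \<Rightarrow> ((nat \<Rightarrow> real) \<Rightarrow> real) \<Rightarrow> bool" where
  "lip1 d h \<longleftrightarrow> (\<forall>x\<in>Esp d. \<forall>y\<in>Esp d. \<bar>h x - h y\<bar> \<le> vnorm d (\<lambda>i. x i - y i))"

definition wdist :: "nat \<Rightarrow> (nat \<Rightarrow> real) measure \<Rightarrow> (nat \<Rightarrow> real) measure \<Rightarrow> ennreal" where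
  "wdist d M N = (SUP h \<in> {h. h \<in> borel_measurable Rsp \<and> lip1 d h}.
      ennreal \<bar>(\<integral>x. h x \<partial>M) - (\<integral>x. h x \<partial>N)\<bar>)"

definition ula_step :: "nat \<Rightarrow> real \<Rightarrow> ((nat \<Rightarrow> real) \<Rightarrow> (nat \<Rightarrow> real)) \<Rightarrow> (nat \<Rightarrow> real) \<Rightarrow> (nat \<Rightarrow> real) \<Rightarrow> (nat \<Rightarrow> real)" where
  "ula_step d s g y z = (\<lambda>i. y i + s * g (emb d y) i + sqrt (2 * s) * z i)"

definition invariant_ula :: "nat \<Rightarrow> real \<Rightarrow> ((nat \<Rightarrow> real) \<Rightarrow> (nat \<Rightarrow> real)) \<Rightarrow> (nat \<Rightarrow> real) measure \<Rightarrow> bool" where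
  "invariant_ula d s g \<mu>s \<longleftrightarrow>
     prob_space \<mu>s \<and> sets \<mu>s = sets Rsp \<and> (AE y in \<mu>s. y \<in> Esp d) \<and>
     distr (\<mu>s \<Otimes>\<^sub>M gaussE d) Rsp (\<lambda>(y, z). ula_step d s g y z) = \<mu>s"

end

theory Submission
  imports Defs
begin

text \<open>The Gibbs sampler \<open>y = x + sqrt s \<xi>\<close>, \<open>x' ~ exp (- U z - |z - y|^2 / (2 s))\<close> leaves \<open>\<mu>\<close>
  invariant and plays the role of the Langevin diffusion run for time \<open>s\<close>; no stochastic
  calculus is needed. All estimates on it come from the dual transport inequality of a strongly
  log-concave measure, a limit case of the Prekopa--Leindler inequality. Applied to two conditional
  laws it gives a Wasserstein contraction by \<open>1 / (1 + \<theta>0 s)\<close>; applied to the conditional law and the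
  Gaussian \<open>N (y + s g x, s)\<close>, whose log-density ratio is convex, it bounds the one-step distance to the
  Euler scheme by \<open>s\<close> times the \<open>L^2\<close> norm of \<open>g Y1 - g Y0\<close>. Iterating under \<open>\<mu>s\<close> and
  using stationarity for the second moment yields a dimension-free constant times
  \<open>sqrt s d + s E |g W|^2\<close>, and \<open>d \<le> E |Z|^3\<close>. The increment of \<open>g\<close> is controlled only when
  \<open>\<theta>1 = 0\<close> or \<open>\<theta>2 = 0\<close>; otherwise the drift is superlinear, the Euler chain escapes to infinity with
  positive probability, and no invariant probability measure exists.\<close>

subsection \<open>The Prekopa--Leindler inequality\<close>

text \<open>The sampler is chosen because it shares its first half with the Euler step: noise of
  variance 2 s is a sum of two independent noises of variance s, so
  \<open>y = x + sqrt s \<xi>\<close> can be common to both, and only the conditional laws given y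
  differ. These are strongly log-concave with modulus at least 1 / s, and the gradient of their
  log-density ratio at z is g x - g z, which is small for z near x. One step therefore errs by s
  times something of order sqrt s; summed against a contraction deficit of order s, this leaves sqrt
  s. The obstacle is uniformity: no constant may depend on d or on derivatives of g at the origin.
  Entropy inequalities are free of the dimension, and the derivative of g at the origin is recovered
  from the size of g at unit vectors, hence from \<theta>4. Both relative entropies of a pair of
  laws are used together, because in their sum the normalising constants, about which nothing is
  known, cancel.\<close>

lemma emeasure_affine_vimage:
  fixes A :: "real set"
  assumes [measurable]: "A \<in> sets borel" and t: "t > 0"
  shows "emeasure lborel {z. (z - c) / t \<in> A} = ennreal t * emeasure lborel A"
proof -
  have m: "{z. (z - c) / t \<in> A} \<in> sets borel" by measurable
  have "emeasure lborel {z. (z - c) / t \<in> A} = (\<integral>\<^sup>+z. indicator {z. (z - c) / t \<in> A} z \<partial>lborel)"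
    using m by (simp add: nn_integral_indicator)
  also have "\<dots> = ennreal \<bar>t\<bar> * (\<integral>\<^sup>+x. indicator {z. (z - c) / t \<in> A} (c + t * x) \<partial>lborel)"
    using m t by (intro nn_integral_real_affine) auto
  also have "(\<lambda>x. indicator {z. (z - c) / t \<in> A} (c + t * x) :: ennreal) = indicator A"
    using t by (auto simp: indicator_def fun_eq_iff)
  finally show ?thesis using t by (simp add: nn_integral_indicator)
qed

text \<open>The scaled sets \<open>t * A\<close> and \<open>(1 - t) * B\<close> are translated so
  that both lie in \<open>C\<close>. Choosing \<open>a\<close> near \<open>Sup A\<close> and
  \<open>b\<close> near \<open>Inf B\<close> puts them almost side by side: they overlap in an
  interval of length at most \<open>e\<close>, so their measures add up to within
  \<open>e\<close>.\<close>

lemma brunn_minkowski_real: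
  fixes A B C :: "real set"
  assumes t: "0 < t" "t < 1"
    and A[measurable]: "A \<in> sets borel" and A': "A \<noteq> {}" "bdd_above A"
    and B[measurable]: "B \<in> sets borel" and B': "B \<noteq> {}" "bdd_below B"
    and C[measurable]: "C \<in> sets borel"
    and sub: "\<And>a b. a \<in> A \<Longrightarrow> b \<in> B \<Longrightarrow> t * a + (1 - t) * b \<in> C"
  shows "ennreal t * emeasure lborel A + ennreal (1 - t) * emeasure lborel B \<le> emeasure lborel C"
proof (rule ennreal_le_epsilon)
  fix e :: real assume e: "e > 0"
  obtain a where a: "a \<in> A" "a > Sup A - e"
    using less_cSup_iff[OF A', of "Sup A - e"] e by auto
  obtain b where b: "b \<in> B" "b < Inf B + e"
    using cInf_less_iff[OF B', of "Inf B + e"] e by auto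
  define A1 where "A1 = {z. (z - (1 - t) * b) / t \<in> A}"
  define B1 where "B1 = {z. (z - t * a) / (1 - t) \<in> B}"
  have m[measurable]: "A1 \<in> sets borel" "B1 \<in> sets borel" unfolding A1_def B1_def by measurable
  have A1C: "A1 \<subseteq> C"
  proof
    fix z assume "z \<in> A1"
    from sub[OF this[unfolded A1_def mem_Collect_eq] b(1)] t show "z \<in> C" by simp
  qed
  have B1C: "B1 \<subseteq> C"
  proof
    fix z assume "z \<in> B1"
    from sub[OF a(1) this[unfolded B1_def mem_Collect_eq]] t show "z \<in> C" by simp
  qed
  have int: "A1 \<inter> B1 \<subseteq> {t * a + (1 - t) * Inf B .. t * Sup A + (1 - t) * b}"
  proof
    fix z assume z: "z \<in> A1 \<inter> B1"
    have "(z - (1 - t) * b) / t \<le> Sup A" using z A' unfolding A1_def by (auto intro: cSup_upper)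
    moreover have "(z - t * a) / (1 - t) \<ge> Inf B" using z B' unfolding B1_def by (auto intro: cInf_lower)
    ultimately show "z \<in> {t * a + (1 - t) * Inf B .. t * Sup A + (1 - t) * b}"
      using t by (auto simp: field_simps)
  qed
  have "emeasure lborel (A1 \<inter> B1) \<le> emeasure lborel {t * a + (1 - t) * Inf B .. t * Sup A + (1 - t) * b}"
    by (intro emeasure_mono int) auto
  also have "\<dots> \<le> ennreal e"
  proof (cases "t * a + (1 - t) * Inf B \<le> t * Sup A + (1 - t) * b")
    case True
    have "t * Sup A + (1 - t) * b - (t * a + (1 - t) * Inf B) = t * (Sup A - a) + (1 - t) * (b - Inf B)"
      by (simp add: algebra_simps)
    also have "\<dots> \<le> t * e + (1 - t) * e" using a b t by (intro add_mono mult_left_mono) auto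
    finally show ?thesis using True by (simp add: algebra_simps)
  qed auto
  finally have i: "emeasure lborel (A1 \<inter> B1) \<le> ennreal e" .
  have "ennreal t * emeasure lborel A + ennreal (1 - t) * emeasure lborel B
      = emeasure lborel A1 + emeasure lborel B1"
    unfolding A1_def B1_def using t A B by (simp add: emeasure_affine_vimage)
  also have "\<dots> = emeasure lborel (A1 \<union> B1) + emeasure lborel (A1 \<inter> B1)"
    by (intro emeasure_Un_Int) auto
  also have "\<dots> \<le> emeasure lborel C + ennreal e"
    using A1C B1C by (intro add_mono i emeasure_mono) auto
  finally show "ennreal t * emeasure lborel A + ennreal (1 - t) * emeasure lborel B
      \<le> emeasure lborel C + ennreal e" .
qed

text \<open>Tonelli on the subgraph. Heights stop at 1 because the functions to be compared are
  scaled to supremum 1; the third one may exceed 1, and cutting it off only lowers its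
  integral.\<close>

lemma layer_cake:
  fixes f :: "real \<Rightarrow> real"
  assumes [measurable]: "f \<in> borel_measurable borel" and f0: "\<And>x. 0 \<le> f x"
  shows "(\<integral>\<^sup>+\<tau>. indicator {0<..<1} \<tau> * emeasure lborel {x. \<tau> < f x} \<partial>lborel)
       = (\<integral>\<^sup>+x. ennreal (min 1 (f x)) \<partial>lborel)"
proof -
  have "(\<integral>\<^sup>+\<tau>. indicator {0<..<1} \<tau> * emeasure lborel {x. \<tau> < f x} \<partial>lborel)
      = (\<integral>\<^sup>+\<tau>. (\<integral>\<^sup>+x. indicator {0<..<1::real} \<tau> * indicator {x. \<tau> < f x} x \<partial>lborel) \<partial>lborel)"
    by (intro nn_integral_cong) (simp add: nn_integral_cmult)
  also have "\<dots> = (\<integral>\<^sup>+x. (\<integral>\<^sup>+\<tau>. indicator {0<..<1::real} \<tau> * indicator {x. \<tau> < f x} x \<partial>lborel) \<partial>lborel)"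
    by (rule lborel_pair.Fubini') measurable
  also have "\<dots> = (\<integral>\<^sup>+x. ennreal (min 1 (f x)) \<partial>lborel)"
  proof (rule nn_integral_cong)
    fix x
    have "(\<integral>\<^sup>+\<tau>. indicator {0<..<1::real} \<tau> * indicator {x. \<tau> < f x} x \<partial>lborel)
       = (\<integral>\<^sup>+\<tau>. indicator {0<..<min 1 (f x)} \<tau> \<partial>lborel)"
      by (intro nn_integral_cong) (auto simp: indicator_def)
    also have "\<dots> = ennreal (min 1 (f x))" using f0[of x] by (simp add: min_def)
    finally show "(\<integral>\<^sup>+\<tau>. indicator {0<..<1::real} \<tau> * indicator {x. \<tau> < f x} x \<partial>lborel) = ennreal (min 1 (f x))" .
  qed
  finally show ?thesis .
qed

text \<open>For functions of supremum one the superlevel sets at every height below one are nonempty,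
  so the one-dimensional Brunn--Minkowski inequality integrates to an arithmetic-mean bound.\<close>

lemma prekopa_leindler_normalised:
  fixes u v w :: "real \<Rightarrow> real"
  assumes t: "0 < t" "t < 1"
    and meas[measurable]: "u \<in> borel_measurable borel" "v \<in> borel_measurable borel" "w \<in> borel_measurable borel"
    and u: "\<And>x. 0 \<le> u x" "\<And>x. u x \<le> 1" "\<And>\<tau>. \<tau> < 1 \<Longrightarrow> \<exists>x. u x > \<tau>" "\<And>x. \<bar>x\<bar> > R \<Longrightarrow> u x = 0"
    and v: "\<And>x. 0 \<le> v x" "\<And>x. v x \<le> 1" "\<And>\<tau>. \<tau> < 1 \<Longrightarrow> \<exists>x. v x > \<tau>" "\<And>x. \<bar>x\<bar> > R \<Longrightarrow> v x = 0"
    and w: "\<And>x. 0 \<le> w x"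
    and ineq: "\<And>x y. u x powr t * v y powr (1 - t) \<le> w (t * x + (1 - t) * y)"
  shows "ennreal t * (\<integral>\<^sup>+x. ennreal (u x) \<partial>lborel) + ennreal (1 - t) * (\<integral>\<^sup>+x. ennreal (v x) \<partial>lborel)
       \<le> (\<integral>\<^sup>+x. ennreal (w x) \<partial>lborel)"
proof -
  let ?l = "\<lambda>f \<tau>. indicator {0<..<1} \<tau> * emeasure lborel {x. \<tau> < f x} :: ennreal"
  have eu: "(\<integral>\<^sup>+x. ennreal (u x) \<partial>lborel) = (\<integral>\<^sup>+\<tau>. ?l u \<tau> \<partial>lborel)"
    using layer_cake[of u] u by (simp add: min_absorb2)
  have ev: "(\<integral>\<^sup>+x. ennreal (v x) \<partial>lborel) = (\<integral>\<^sup>+\<tau>. ?l v \<tau> \<partial>lborel)"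
    using layer_cake[of v] v by (simp add: min_absorb2)
  have ew: "(\<integral>\<^sup>+\<tau>. ?l w \<tau> \<partial>lborel) \<le> (\<integral>\<^sup>+x. ennreal (w x) \<partial>lborel)"
    using layer_cake[of w] w by (auto intro!: nn_integral_mono ennreal_leI)
  have "ennreal t * (\<integral>\<^sup>+\<tau>. ?l u \<tau> \<partial>lborel) + ennreal (1 - t) * (\<integral>\<^sup>+\<tau>. ?l v \<tau> \<partial>lborel)
     = (\<integral>\<^sup>+\<tau>. ennreal t * ?l u \<tau> + ennreal (1 - t) * ?l v \<tau> \<partial>lborel)"
    by (simp add: nn_integral_add nn_integral_cmult)
  also have "\<dots> \<le> (\<integral>\<^sup>+\<tau>. ?l w \<tau> \<partial>lborel)"
  proof (rule nn_integral_mono)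
    fix \<tau> :: real
    show "ennreal t * ?l u \<tau> + ennreal (1 - t) * ?l v \<tau> \<le> ?l w \<tau>"
    proof (cases "0 < \<tau> \<and> \<tau> < 1")
      case True
      have bd: "{x. \<tau> < f x} \<subseteq> {-R..R}" if "\<And>x. \<bar>x\<bar> > R \<Longrightarrow> f x = 0" for f :: "real \<Rightarrow> real"
      proof
        fix x assume x: "x \<in> {x. \<tau> < f x}"
        show "x \<in> {-R..R}"
        proof (rule ccontr)
          assume "x \<notin> {-R..R}"
          then have "f x = 0" by (intro that) auto
          with x True show False by simp
        qed
      qed
      have "ennreal t * emeasure lborel {x. \<tau> < u x} + ennreal (1 - t) * emeasure lborel {x. \<tau> < v x}
         \<le> emeasure lborel {x. \<tau> < w x}"
      proof (rule brunn_minkowski_real[OF t])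
        show "{x. \<tau> < u x} \<noteq> {}" "{x. \<tau> < v x} \<noteq> {}" using u(3) v(3) True by auto
        show "bdd_above {x. \<tau> < u x}" using bd[OF u(4)] by (rule bdd_above_mono[rotated]) auto
        show "bdd_below {x. \<tau> < v x}" using bd[OF v(4)] by (rule bdd_below_mono[rotated]) auto
        fix a b assume a: "a \<in> {x. \<tau> < u x}" and b: "b \<in> {x. \<tau> < v x}"
        \<comment> \<open>A weighted geometric mean of two numbers above \<tau> is above \<tau>, so
          superlevel sets at the same height combine.\<close>
        have "\<tau> = \<tau> powr t * \<tau> powr (1 - t)" using True by (simp flip: powr_add)
        also have "\<dots> < u a powr t * v b powr (1 - t)"
          using a b True t by (intro mult_strict_mono powr_less_mono2) auto
        also have "\<dots> \<le> w (t * a + (1 - t) * b)" by (rule ineq)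
        finally show "t * a + (1 - t) * b \<in> {x. \<tau> < w x}" by simp
      qed measurable
      with True show ?thesis by (simp add: indicator_def)
    qed (auto simp: indicator_def)
  qed
  also note ew
  finally show ?thesis using eu ev by simp
qed

text \<open>The bounds hold at every function, also outside the product space, so that slices
  \<open>x(i := y)\<close> inherit them without side conditions. Boundedness and bounded support
  keep every integral in the induction finite.\<close>

definition box_supp :: "nat set \<Rightarrow> real \<Rightarrow> real \<Rightarrow> ((nat \<Rightarrow> real) \<Rightarrow> real) \<Rightarrow> bool" where
  "box_supp I c R u \<longleftrightarrow> u \<in> borel_measurable (PiM I (\<lambda>_. lborel)) \<and> (\<forall>x. 0 \<le> u x \<and> u x \<le> c) \<and>
     (\<forall>x. (\<exists>i\<in>I. \<bar>x i\<bar> > R) \<longrightarrow> u x = 0)"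

text \<open>Dividing \<open>u\<close>, \<open>v\<close>, \<open>w\<close> by \<open>a\<close>,
  \<open>b\<close> and \<open>k = a powr t * b powr (1 - t)\<close> makes the first two suprema 1
  and preserves the pointwise hypothesis. The arithmetic mean obtained there dominates the geometric
  mean by Young's inequality, and the scalings cancel.\<close>

lemma prekopa_leindler_real:
  fixes u v w :: "real \<Rightarrow> real"
  assumes t: "0 < t" "t < 1"
    and meas[measurable]: "u \<in> borel_measurable borel" "v \<in> borel_measurable borel" "w \<in> borel_measurable borel"
    and u: "\<And>x. 0 \<le> u x" "\<And>x. u x \<le> c" "\<And>x. \<bar>x\<bar> > R \<Longrightarrow> u x = 0"
    and v: "\<And>x. 0 \<le> v x" "\<And>x. v x \<le> c" "\<And>x. \<bar>x\<bar> > R \<Longrightarrow> v x = 0"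
    and w: "\<And>x. 0 \<le> w x" "\<And>x. w x \<le> c" "\<And>x. \<bar>x\<bar> > R \<Longrightarrow> w x = 0"
    and ineq: "\<And>x y. u x powr t * v y powr (1 - t) \<le> w (t * x + (1 - t) * y)"
  shows "(\<integral>x. u x \<partial>lborel) powr t * (\<integral>x. v x \<partial>lborel) powr (1 - t) \<le> (\<integral>x. w x \<partial>lborel)"
proof -
  have integ: "integrable lborel f" if "f \<in> borel_measurable borel" "\<And>x. 0 \<le> f x" "\<And>x. f x \<le> c" "\<And>x. \<bar>x\<bar> > R \<Longrightarrow> f x = 0"
    for f :: "real \<Rightarrow> real"
  proof (rule Bochner_Integration.integrable_bound)
    show "integrable lborel (\<lambda>x. c * indicator {-R..R} x :: real)"
      by (intro integrable_mult_right integrable_real_indicator) (auto simp: emeasure_lborel_Icc_eq)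
    show "AE x in lborel. norm (f x) \<le> norm (c * indicator {-R..R} x :: real)"
    proof (rule AE_I2)
      fix x show "norm (f x) \<le> norm (c * indicator {-R..R} x :: real)"
        using that(2)[of x] that(3)[of x] that(4)[of x] by (cases "\<bar>x\<bar> > R") (auto simp: indicator_def)
    qed
  qed (use that in auto)
  define a where "a = Sup (range u)"
  define b where "b = Sup (range v)"
  have bu: "bdd_above (range u)" "bdd_above (range v)" using u(2) v(2) by (auto intro!: bdd_aboveI)
  have ua: "u x \<le> a" for x unfolding a_def by (intro cSup_upper bu) auto
  have vb: "v x \<le> b" for x unfolding b_def by (intro cSup_upper bu) auto
  have ab0: "a \<ge> 0" "b \<ge> 0" using ua[of 0] u(1)[of 0] vb[of 0] v(1)[of 0] by auto
  show ?thesis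
  proof (cases "a = 0 \<or> b = 0")
    case True
    then have "(\<lambda>x. u x) = (\<lambda>x. 0) \<or> (\<lambda>x. v x) = (\<lambda>x. 0)"
      using ua vb u(1) v(1) by (auto simp: fun_eq_iff intro: antisym)
    then have "(\<integral>x. u x \<partial>lborel) = 0 \<or> (\<integral>x. v x \<partial>lborel) = 0" by fastforce
    moreover have "(\<integral>x. w x \<partial>lborel) \<ge> 0" using w by (intro integral_nonneg_AE) auto
    ultimately show ?thesis by auto
  next
    case False
    then have ab: "a > 0" "b > 0" using ab0 by auto
    define k where "k = a powr t * b powr (1 - t)"
    have k: "k > 0" using ab by (simp add: k_def)
    have "ennreal t * (\<integral>\<^sup>+x. ennreal (u x / a) \<partial>lborel) + ennreal (1 - t) * (\<integral>\<^sup>+x. ennreal (v x / b) \<partial>lborel)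
       \<le> (\<integral>\<^sup>+x. ennreal (w x / k) \<partial>lborel)"
    proof (rule prekopa_leindler_normalised[OF t, where R=R])
      fix \<tau> :: real assume "\<tau> < 1"
      then have "\<tau> * a < Sup (range u)" "\<tau> * b < Sup (range v)" using ab by (auto simp: a_def[symmetric] b_def[symmetric])
      then show "\<exists>x. \<tau> < u x / a" "\<exists>x. \<tau> < v x / b"
        using less_cSup_iff[OF _ bu(1), of "\<tau> * a"] less_cSup_iff[OF _ bu(2), of "\<tau> * b"] ab
        by (auto simp: field_simps)
    next
      fix x y
      show "(u x / a) powr t * (v y / b) powr (1 - t) \<le> w (t * x + (1 - t) * y) / k"
        using ineq[of x y] u(1)[of x] v(1)[of y] ab k
        by (simp add: powr_divide k_def divide_right_mono)
    qed (use u v w ua vb ab k in auto)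
    moreover have "(\<integral>\<^sup>+x. ennreal (u x / a) \<partial>lborel) = ennreal ((\<integral>x. u x \<partial>lborel) / a)"
      using u ab integ[of u] by (subst nn_integral_eq_integral) auto
    moreover have "(\<integral>\<^sup>+x. ennreal (v x / b) \<partial>lborel) = ennreal ((\<integral>x. v x \<partial>lborel) / b)"
      using v ab integ[of v] by (subst nn_integral_eq_integral) auto
    moreover have "(\<integral>\<^sup>+x. ennreal (w x / k) \<partial>lborel) = ennreal ((\<integral>x. w x \<partial>lborel) / k)"
      using w k integ[of w] by (subst nn_integral_eq_integral) auto
    moreover have iu: "(\<integral>x. u x \<partial>lborel) \<ge> 0" "(\<integral>x. v x \<partial>lborel) \<ge> 0" "(\<integral>x. w x \<partial>lborel) \<ge> 0"
      using u v w by (auto intro!: integral_nonneg_AE)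
    ultimately have "t * ((\<integral>x. u x \<partial>lborel) / a) + (1 - t) * ((\<integral>x. v x \<partial>lborel) / b) \<le> (\<integral>x. w x \<partial>lborel) / k"
      using t ab k by (simp flip: ennreal_mult ennreal_plus)
    moreover have "((\<integral>x. u x \<partial>lborel) / a) powr t * ((\<integral>x. v x \<partial>lborel) / b) powr (1 - t)
        \<le> t * ((\<integral>x. u x \<partial>lborel) / a) + (1 - t) * ((\<integral>x. v x \<partial>lborel) / b)"
    proof (cases "(\<integral>x. u x \<partial>lborel) = 0 \<or> (\<integral>x. v x \<partial>lborel) = 0")
      case True
      then show ?thesis using t ab iu by (auto intro: divide_nonneg_pos)
    next
      case False
      then show ?thesis using t ab iu by (intro Youngs_inequality_0) auto
    qed
    ultimately have "((\<integral>x. u x \<partial>lborel) / a) powr t * ((\<integral>x. v x \<partial>lborel) / b) powr (1 - t) \<le> (\<integral>x. w x \<partial>lborel) / k"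
      by linarith
    moreover have "((\<integral>x. u x \<partial>lborel) / a) powr t * ((\<integral>x. v x \<partial>lborel) / b) powr (1 - t)
      = (\<integral>x. u x \<partial>lborel) powr t * (\<integral>x. v x \<partial>lborel) powr (1 - t) / k"
      using iu ab by (simp add: powr_divide k_def)
    ultimately show ?thesis using k by (simp add: divide_le_cancel)
  qed
qed

lemma box_supp_integrable:
  assumes I: "finite I" and u: "box_supp I c R u"
  shows "integrable (PiM I (\<lambda>_. lborel)) u"
proof (rule Bochner_Integration.integrable_bound)
  interpret product_sigma_finite "\<lambda>_. lborel :: real measure" by standard
  have B: "PiE I (\<lambda>_. {-R..R}) \<in> sets (PiM I (\<lambda>_. lborel :: real measure))"
    using I by (intro sets_PiM_I_finite) auto
  have "emeasure (PiM I (\<lambda>_. lborel :: real measure)) (PiE I (\<lambda>_. {-R..R})) = (\<Prod>i\<in>I. emeasure lborel {-R..R})"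
    using I by (intro emeasure_PiM) auto
  also have "\<dots> < \<infinity>" by (simp add: ennreal_prod_eq_top less_top[symmetric] emeasure_lborel_Icc_eq power_eq_top_ennreal)
  finally show "integrable (PiM I (\<lambda>_. lborel)) (\<lambda>x. c * indicator (PiE I (\<lambda>_. {-R..R})) x :: real)"
    using B by (intro integrable_mult_right integrable_real_indicator) auto
  show "u \<in> borel_measurable (PiM I (\<lambda>_. lborel))" using u by (simp add: box_supp_def)
  show "AE x in PiM I (\<lambda>_. lborel). norm (u x) \<le> norm (c * indicator (PiE I (\<lambda>_. {-R..R})) x :: real)"
  proof (rule AE_I2)
    fix x assume x: "x \<in> space (PiM I (\<lambda>_. lborel :: real measure))"
    show "norm (u x) \<le> norm (c * indicator (PiE I (\<lambda>_. {-R..R})) x :: real)"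
    proof (cases "\<exists>i\<in>I. \<bar>x i\<bar> > R")
      case True then show ?thesis using u by (auto simp: box_supp_def)
    next
      case False
      then have "x \<in> PiE I (\<lambda>_. {-R..R})" using x by (auto simp: space_PiM PiE_iff)
      moreover have "0 \<le> u x" "u x \<le> c" using u by (auto simp: box_supp_def)
      ultimately show ?thesis by simp
    qed
  qed
qed

text \<open>Coordinates are integrated out one at a time: for fixed \<open>x\<close> and
  \<open>y\<close> the one-dimensional case applies to the slices, and its conclusion is the
  pointwise hypothesis for the partial integrals. The bound \<open>c\<close> varies in the induction
  because each integration multiplies it by the side length of the box.\<close>

theorem prekopa_leindler:
  assumes t: "0 < t" "t < 1" and I: "finite I"
    and u: "box_supp I c R u" and v: "box_supp I c R v" and w: "box_supp I c R w"
    and ineq: "\<And>x y. u x powr t * v y powr (1 - t) \<le> w (\<lambda>i. t * x i + (1 - t) * y i)"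
  shows "(\<integral>x. u x \<partial>PiM I (\<lambda>_. lborel)) powr t * (\<integral>x. v x \<partial>PiM I (\<lambda>_. lborel)) powr (1 - t)
      \<le> (\<integral>x. w x \<partial>PiM I (\<lambda>_. lborel))"
  using I u v w ineq
proof (induction I arbitrary: c u v w rule: finite_induct)
  case empty
  interpret product_sigma_finite "\<lambda>_. lborel :: real measure" by standard
  have "u (\<lambda>k. undefined) powr t * v (\<lambda>k. undefined) powr (1 - t) \<le> w (\<lambda>i. t * undefined + (1 - t) * undefined)"
    by (rule empty.prems(4))
  moreover have "t * undefined + (1 - t) * undefined = (undefined :: real)" by (simp add: algebra_simps)
  ultimately show ?case by (simp add: PiM_empty lebesgue_integral_count_space_finite)
next
  case (insert i I)
  interpret product_sigma_finite "\<lambda>_. lborel :: real measure" by standard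
  have fib: "box_supp I (c * (2 * \<bar>R\<bar>)) R (\<lambda>x. \<integral>y. f (x(i := y)) \<partial>lborel)"
    and fibm: "\<And>x. x \<in> space (PiM I (\<lambda>_. lborel :: real measure)) \<Longrightarrow> (\<lambda>y. f (x(i := y))) \<in> borel_measurable borel"
    if f: "box_supp (insert i I) c R f" for f
  proof -
    have [measurable]: "f \<in> borel_measurable (PiM (insert i I) (\<lambda>_. lborel))" using f by (simp add: box_supp_def)
    have fb: "0 \<le> f x" "f x \<le> c" for x using f by (auto simp: box_supp_def)
    have fs: "f x = 0" if "j \<in> insert i I" "\<bar>x j\<bar> > R" for x j using f that unfolding box_supp_def by blast
    show "(\<lambda>y. f (x(i := y))) \<in> borel_measurable borel"
      if "x \<in> space (PiM I (\<lambda>_. lborel :: real measure))" for x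
      using that by measurable
    have c0: "0 \<le> c" using fb[of "\<lambda>_. 0"] by simp
    have "(\<integral>y. f (x(i := y)) \<partial>lborel) \<le> c * (2 * \<bar>R\<bar>)" for x
    proof -
      have "(\<integral>y. f (x(i := y)) \<partial>lborel) \<le> (\<integral>y. c * indicator {-\<bar>R\<bar>..\<bar>R\<bar>} y \<partial>lborel)"
      proof (rule integral_mono_AE')
        show "integrable lborel (\<lambda>y. c * indicator {-\<bar>R\<bar>..\<bar>R\<bar>} y :: real)"
          by (intro integrable_mult_right integrable_real_indicator) auto
        show "AE y in lborel. f (x(i := y)) \<le> c * indicator {-\<bar>R\<bar>..\<bar>R\<bar>} y"
        proof (rule AE_I2)
          fix y
          show "f (x(i := y)) \<le> c * indicator {-\<bar>R\<bar>..\<bar>R\<bar>} y"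
          proof (cases "\<bar>y\<bar> \<le> \<bar>R\<bar>")
            case True then show ?thesis using fb[of "x(i := y)"] by (simp add: indicator_def abs_le_iff)
          next
            case False
            then have "f (x(i := y)) = 0" by (intro fs[of i]) auto
            then show ?thesis using c0 by simp
          qed
        qed
      qed (use fb c0 in auto)
      also have "\<dots> = c * (2 * \<bar>R\<bar>)" by simp
      finally show ?thesis .
    qed
    moreover have "(\<integral>y. f (x(i := y)) \<partial>lborel) = 0" if "\<exists>j\<in>I. \<bar>x j\<bar> > R" for x
    proof -
      from that obtain j where j: "j \<in> I" "\<bar>x j\<bar> > R" by auto
      then have "f (x(i := y)) = 0" for y using \<open>i \<notin> I\<close> by (intro fs[of j]) auto
      then show ?thesis by simp
    qed
    ultimately show "box_supp I (c * (2 * \<bar>R\<bar>)) R (\<lambda>x. \<integral>y. f (x(i := y)) \<partial>lborel)"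
      unfolding box_supp_def using fb by (auto intro!: integral_nonneg_AE)
  qed
  \<comment> \<open>Slices are measurable only over points of the product space, while the induction
    hypothesis asks for the inequality at all functions. The value 0 elsewhere makes the left side
    vanish there.\<close>
  define J where "J = (\<lambda>f x. if x \<in> space (PiM I (\<lambda>_. lborel :: real measure)) then \<integral>y. f (x(i := y)) \<partial>lborel else (0::real))"
  have Jb: "box_supp I (c * (2 * \<bar>R\<bar>)) R (J f)" if "box_supp (insert i I) c R f" for f
  proof -
    note * = fib[OF that, unfolded box_supp_def]
    have "J f \<in> borel_measurable (PiM I (\<lambda>_. lborel)) \<longleftrightarrow> (\<lambda>x. \<integral>y. f (x(i := y)) \<partial>lborel) \<in> borel_measurable (PiM I (\<lambda>_. lborel))"
      by (rule measurable_cong) (simp add: J_def)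
    with * have "J f \<in> borel_measurable (PiM I (\<lambda>_. lborel))" by blast
    moreover have "0 \<le> c * (2 * \<bar>R\<bar>)"
      using *[THEN conjunct2, THEN conjunct1, THEN spec, of "\<lambda>_. 0"] by (meson order_trans)
    then have "0 \<le> J f x \<and> J f x \<le> c * (2 * \<bar>R\<bar>)" for x
      using * by (simp add: J_def)
    moreover have "J f x = 0" if "\<exists>i\<in>I. \<bar>x i\<bar> > R" for x
      using * that by (simp add: J_def)
    ultimately show ?thesis unfolding box_supp_def by blast
  qed
  have eq: "(\<integral>x. f x \<partial>PiM (insert i I) (\<lambda>_. lborel)) = (\<integral>x. J f x \<partial>PiM I (\<lambda>_. lborel))"
    if "box_supp (insert i I) c R f" for f
    using product_integral_insert[OF insert(1,2) box_supp_integrable[OF _ that]] insert(1)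
    by (simp add: J_def cong: Bochner_Integration.integral_cong)
  have "(\<integral>x. J u x \<partial>PiM I (\<lambda>_. lborel)) powr t * (\<integral>x. J v x \<partial>PiM I (\<lambda>_. lborel)) powr (1 - t)
      \<le> (\<integral>x. J w x \<partial>PiM I (\<lambda>_. lborel))"
  proof (rule insert.IH[OF Jb[OF insert.prems(1)] Jb[OF insert.prems(2)] Jb[OF insert.prems(3)]])
    fix x y :: "nat \<Rightarrow> real"
    let ?z = "\<lambda>k. t * x k + (1 - t) * y k"
    show "J u x powr t * J v y powr (1 - t) \<le> J w ?z"
    proof (cases "x \<in> space (PiM I (\<lambda>_. lborel :: real measure)) \<and> y \<in> space (PiM I (\<lambda>_. lborel :: real measure))")
      case False
      have "0 \<le> J w ?z" using Jb[OF insert.prems(3)] by (auto simp: box_supp_def)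
      then show ?thesis using False t by (auto simp: J_def)
    next
      case True
      \<comment> \<open>Outside \<open>I\<close> both points equal \<open>undefined\<close>, a value
        that a convex combination preserves.\<close>
      have z: "?z \<in> space (PiM I (\<lambda>_. lborel :: real measure))"
        using True by (auto simp: space_PiM PiE_iff extensional_def algebra_simps)
      have "(\<integral>a. u (x(i := a)) \<partial>lborel) powr t * (\<integral>b. v (y(i := b)) \<partial>lborel) powr (1 - t) \<le> (\<integral>c. w (?z(i := c)) \<partial>lborel)"
      proof (rule prekopa_leindler_real[OF t, where R=R and c=c])
        show "(\<lambda>a. u (x(i := a))) \<in> borel_measurable borel" by (rule fibm[OF insert.prems(1)]) (use True in blast)
        show "(\<lambda>a. v (y(i := a))) \<in> borel_measurable borel" by (rule fibm[OF insert.prems(2)]) (use True in blast)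
        show "(\<lambda>a. w (?z(i := a))) \<in> borel_measurable borel" by (rule fibm[OF insert.prems(3) z])
        fix a b
        have z': "?z(i := t * a + (1 - t) * b) = (\<lambda>k. t * (x(i := a)) k + (1 - t) * (y(i := b)) k)" by auto
        show "u (x(i := a)) powr t * v (y(i := b)) powr (1 - t) \<le> w (?z(i := t * a + (1 - t) * b))"
          unfolding z' by (rule insert.prems(4))
      qed (use insert.prems in \<open>auto simp: box_supp_def\<close>)
      then show ?thesis using True z by (simp add: J_def)
    qed
  qed
  then show ?case by (simp add: eq insert.prems)
qed

subsection \<open>Euclidean vectors and product measures\<close>

lemma vnorm_nonneg[simp]: "vnorm d x \<ge> 0"
  by (simp add: vnorm_def sum_nonneg)

lemma vnorm_L2: "vnorm d x = L2_set x {..<d}"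
  by (simp add: vnorm_def L2_set_def)

lemma vnorm_sq: "(vnorm d x)\<^sup>2 = (\<Sum>i<d. (x i)\<^sup>2)"
  by (simp add: vnorm_def sum_nonneg)

lemma vnorm_sq_vinner: "(vnorm d x)\<^sup>2 = vinner d x x"
  unfolding vnorm_sq vinner_def by (simp add: power2_eq_square)

lemma vnorm_cong: "(\<And>i. i < d \<Longrightarrow> x i = y i) \<Longrightarrow> vnorm d x = vnorm d y"
  by (simp add: vnorm_def)

lemma vinner_cong: "(\<And>i. i < d \<Longrightarrow> x i = x' i) \<Longrightarrow> (\<And>i. i < d \<Longrightarrow> y i = y' i) \<Longrightarrow> vinner d x y = vinner d x' y'"
  by (simp add: vinner_def)

lemma vnorm_emb[simp]: "vnorm d (emb d x) = vnorm d x"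
  by (rule vnorm_cong) (simp add: emb_def)

lemma emb_Esp[simp]: "emb d x \<in> Esp d"
  by (simp add: emb_def Esp_def)

lemma emb_id[simp]: "x \<in> Esp d \<Longrightarrow> emb d x = x"
  by (auto simp add: emb_def Esp_def fun_eq_iff)

lemma emb_emb[simp]: "emb d (emb d x) = emb d x"
  by simp

lemma vnorm_tri: "vnorm d (\<lambda>i. x i + y i) \<le> vnorm d x + vnorm d y"
  unfolding vnorm_L2 by (rule L2_set_triangle_ineq)

lemma vnorm_scale: "vnorm d (\<lambda>i. c * x i) = \<bar>c\<bar> * vnorm d x"
  by (simp add: vnorm_def power_mult_distrib real_sqrt_mult flip: sum_distrib_left)

lemma vnorm_minus_commute: "vnorm d (\<lambda>i. x i - y i) = vnorm d (\<lambda>i. y i - x i)"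
  by (simp add: vnorm_def power2_commute)

lemma vnorm_uminus[simp]: "vnorm d (\<lambda>i. - x i) = vnorm d x"
  by (simp add: vnorm_def)

lemma vnorm_tri_diff: "vnorm d (\<lambda>i. x i - y i) \<le> vnorm d x + vnorm d y"
  using vnorm_tri[of d x "\<lambda>i. - y i"] by simp

lemma vnorm_diff_tri: "vnorm d (\<lambda>i. x i - z i) \<le> vnorm d (\<lambda>i. x i - y i) + vnorm d (\<lambda>i. y i - z i)"
  using vnorm_tri[of d "\<lambda>i. x i - y i" "\<lambda>i. y i - z i"] by simp

lemma vnorm_zero[simp]: "vnorm d (\<lambda>i. 0) = 0"
  by (simp add: vnorm_def)

lemma vnorm_sub_le: "vnorm d x \<le> vnorm d y + vnorm d (\<lambda>i. x i - y i)"
  using vnorm_tri[of d y "\<lambda>i. x i - y i"] by simp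

lemma vnorm_component: "i < d \<Longrightarrow> \<bar>x i\<bar> \<le> vnorm d x"
  unfolding vnorm_def by (rule real_le_rsqrt) (simp add: member_le_sum[of i "{..<d}" "\<lambda>i. (x i)\<^sup>2"])

lemma vinner_abs_le: "\<bar>vinner d x y\<bar> \<le> vnorm d x * vnorm d y"
proof -
  have "\<bar>vinner d x y\<bar> \<le> (\<Sum>i<d. \<bar>x i\<bar> * \<bar>y i\<bar>)"
    unfolding vinner_def by (rule order_trans[OF sum_abs]) (simp add: abs_mult)
  also have "\<dots> \<le> vnorm d x * vnorm d y" unfolding vnorm_L2 by (rule L2_set_mult_ineq)
  finally show ?thesis .
qed

lemma vinner_le: "vinner d x y \<le> vnorm d x * vnorm d y"
  using vinner_abs_le[of d x y] by linarith

lemma vinner_commute: "vinner d x y = vinner d y x"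
  by (simp add: vinner_def mult.commute)

lemma vinner_diff_right: "vinner d x (\<lambda>i. y i - z i) = vinner d x y - vinner d x z"
  by (simp add: vinner_def algebra_simps sum_subtractf)

lemma vinner_diff_left: "vinner d (\<lambda>i. y i - z i) x = vinner d y x - vinner d z x"
  by (simp add: vinner_def algebra_simps sum_subtractf)

lemma vinner_scale_right: "vinner d x (\<lambda>i. c * y i) = c * vinner d x y"
  by (simp add: vinner_def algebra_simps sum_distrib_left)

lemma vnorm_sq_add: "(vnorm d (\<lambda>i. x i + y i))\<^sup>2 = (vnorm d x)\<^sup>2 + 2 * vinner d x y + (vnorm d y)\<^sup>2"
  by (simp add: vnorm_sq vinner_def power2_sum sum.distrib sum_distrib_left algebra_simps)

lemma vnorm_sq_diff: "(vnorm d (\<lambda>i. x i - y i))\<^sup>2 = (vnorm d x)\<^sup>2 - 2 * vinner d x y + (vnorm d y)\<^sup>2"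
  by (simp add: vnorm_sq vinner_def power2_diff sum.distrib sum_distrib_left sum_subtractf algebra_simps)

section \<open>Measurability on the sequence space\<close>

lemma sets_Rsp: "sets Rsp = sets borel"
  unfolding Rsp_def by (rule sets_PiM_equal_borel)

lemma space_Rsp[simp]: "space Rsp = UNIV"
  by (simp add: Rsp_def space_PiM)

lemma measurable_Rsp_component[measurable (raw)]: "(\<lambda>x. x i) \<in> borel_measurable Rsp"
  unfolding Rsp_def by measurable

lemma measurable_into_Rsp:
  assumes "\<And>i. (\<lambda>x. f x i) \<in> borel_measurable M"
  shows "f \<in> measurable M Rsp"
  unfolding Rsp_def by (rule measurable_PiM_single') (use assms in auto)

lemma measurable_Rsp_component_fst[measurable (raw)]: "(\<lambda>p. fst p i) \<in> borel_measurable (Rsp \<Otimes>\<^sub>M N)"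
  by (rule measurable_compose[OF measurable_fst measurable_Rsp_component])

lemma measurable_Rsp_component_snd[measurable (raw)]: "(\<lambda>p. snd p i) \<in> borel_measurable (N \<Otimes>\<^sub>M Rsp)"
  by (rule measurable_compose[OF measurable_snd measurable_Rsp_component])

lemma measurable_comp_Rsp[measurable_dest]:
  assumes f: "f \<in> measurable M Rsp" and g: "g \<in> measurable L M"
  shows "(\<lambda>x. f (g x) i) \<in> borel_measurable L"
  using measurable_compose[OF measurable_compose[OF g f] measurable_Rsp_component] .

lemma measurable_vnorm[measurable (raw)]:
  assumes "\<And>i. (\<lambda>x. f x i) \<in> borel_measurable M"
  shows "(\<lambda>x. vnorm d (f x)) \<in> borel_measurable M"
  unfolding vnorm_def using assms by measurable

lemma measurable_vinner[measurable (raw)]: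
  assumes "\<And>i. (\<lambda>x. f x i) \<in> borel_measurable M" "\<And>i. (\<lambda>x. g x i) \<in> borel_measurable M"
  shows "(\<lambda>x. vinner d (f x) (g x)) \<in> borel_measurable M"
  unfolding vinner_def using assms by measurable

lemma measurable_emb[measurable]: "emb d \<in> measurable Rsp Rsp"
  by (rule measurable_into_Rsp) (auto simp: emb_def)

text \<open>\<open>Rsp\<close> carries the Borel sets of the product topology, and
  \<open>vnorm d\<close> is a seminorm that is continuous for it, so continuity with respect to the
  seminorm is stronger than product continuity.\<close>

lemma borel_measurable_vnorm_continuous:
  assumes f: "\<And>x e. e > 0 \<Longrightarrow> \<exists>\<delta>>0. \<forall>y. vnorm d (\<lambda>i. y i - x i) < \<delta> \<longrightarrow> \<bar>f y - f x\<bar> < (e::real)"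
  shows "f \<in> borel_measurable Rsp"
proof -
  have "continuous_on UNIV f"
    unfolding continuous_on_eq_continuous_within continuous_within
  proof
    fix x :: "nat \<Rightarrow> real"
    have comp: "((\<lambda>y. y i) \<longlongrightarrow> x i) (at x)" for i
      using continuous_on_product_coordinates[of i] unfolding continuous_on_def by auto
    have "((\<lambda>y. sqrt (\<Sum>i<d. (y i - x i)\<^sup>2)) \<longlongrightarrow> sqrt (\<Sum>i<d. (x i - x i)\<^sup>2)) (at x)"
      by (intro tendsto_intros comp)
    then have t: "((\<lambda>y. vnorm d (\<lambda>i. y i - x i)) \<longlongrightarrow> 0) (at x)" by (simp add: vnorm_def)
    show "(f \<longlongrightarrow> f x) (at x)"
    proof (rule tendstoI)
      fix e :: real assume "e > 0"
      from f[OF this] obtain \<delta> where \<delta>: "\<delta> > 0" "\<And>y. vnorm d (\<lambda>i. y i - x i) < \<delta> \<Longrightarrow> \<bar>f y - f x\<bar> < e" by blast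
      have "eventually (\<lambda>y. vnorm d (\<lambda>i. y i - x i) < \<delta>) (at x)"
        using order_tendstoD(2)[OF t \<delta>(1)] .
      then show "eventually (\<lambda>y. dist (f y) (f x) < e) (at x)"
        by eventually_elim (use \<delta>(2) in \<open>auto simp: dist_real_def\<close>)
    qed
  qed
  then have "f \<in> borel_measurable borel" by (rule borel_measurable_continuous_onI)
  then show ?thesis using sets_Rsp by (simp cong: measurable_cong_sets)
qed

lemma borel_measurable_vnorm_lipschitz:
  assumes f: "\<And>x y. \<bar>f x - f y\<bar> \<le> L * vnorm d (\<lambda>i. x i - y i)"
  shows "f \<in> borel_measurable Rsp"
proof (rule borel_measurable_vnorm_continuous)
  fix x and e :: real assume "e > 0"
  have "\<bar>f y - f x\<bar> < e" if "vnorm d (\<lambda>i. y i - x i) < e / (\<bar>L\<bar> + 1)" for y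
  proof -
    have "\<bar>f y - f x\<bar> \<le> L * vnorm d (\<lambda>i. y i - x i)" by (rule f)
    also have "\<dots> \<le> (\<bar>L\<bar> + 1) * vnorm d (\<lambda>i. y i - x i)" by (intro mult_right_mono) auto
    also have "\<dots> < e" using that by (simp add: pos_less_divide_eq mult.commute)
    finally show ?thesis .
  qed
  then show "\<exists>\<delta>>0. \<forall>y. vnorm d (\<lambda>i. y i - x i) < \<delta> \<longrightarrow> \<bar>f y - f x\<bar> < e"
    using \<open>e > 0\<close> by (intro exI[of _ "e / (\<bar>L\<bar> + 1)"]) (auto simp: divide_pos_pos)
qed

section \<open>Lebesgue and Gaussian measures on R^d\<close>

abbreviation stdn :: "real measure" where
  "stdn \<equiv> density lborel std_normal_density"

lemma prob_space_stdn: "prob_space stdn"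
  by (rule prob_space_normal_density) simp

lemma measurable_emb_PiM[measurable]:
  "emb d \<in> measurable (PiM {..<d} (\<lambda>_. lborel)) Rsp" "emb d \<in> measurable (PiM {..<d} (\<lambda>_. stdn)) Rsp"
proof -
  have "(\<lambda>x. emb d x i) \<in> borel_measurable (PiM {..<d} (\<lambda>_. borel :: real measure))" for i
    by (cases "i < d") (simp_all add: emb_def)
  then have *: "emb d \<in> measurable (PiM {..<d} (\<lambda>_. borel)) Rsp"
    by (intro measurable_into_Rsp)
  show "emb d \<in> measurable (PiM {..<d} (\<lambda>_. lborel)) Rsp" "emb d \<in> measurable (PiM {..<d} (\<lambda>_. stdn)) Rsp"
    using * by (simp_all cong: measurable_cong_sets sets_PiM_cong)
qed

lemma sets_lebE[simp, measurable_cong]: "sets (lebE d) = sets Rsp" by (simp add: lebE_def)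
lemma sets_gaussE[simp, measurable_cong]: "sets (gaussE d) = sets Rsp" by (simp add: gaussE_def)
lemma space_lebE[simp]: "space (lebE d) = UNIV" by (simp add: lebE_def)
lemma space_gaussE[simp]: "space (gaussE d) = UNIV" by (simp add: gaussE_def)

lemma prob_space_gaussE: "prob_space (gaussE d)"
  unfolding gaussE_def
  by (intro prob_space.prob_space_distr prob_space_PiM prob_space_stdn) measurable

lemma Esp_sets[measurable]: "Esp d \<in> sets Rsp"
proof -
  have "{x \<in> space Rsp. \<forall>i. i \<ge> d \<longrightarrow> x i = 0} \<in> sets Rsp"
  proof (rule sets.sets_Collect_countable_All)
    fix i
    have "{x \<in> space Rsp. x i = 0} \<in> sets Rsp"
      by (rule borel_measurable_eq) (auto intro!: measurable_Rsp_component)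
    then show "{x \<in> space Rsp. i \<ge> d \<longrightarrow> x i = 0} \<in> sets Rsp"
      using sets.top[of Rsp] by (cases "i \<ge> d") auto
  qed
  then show ?thesis by (simp add: Esp_def)
qed

lemma AE_lebE_Esp: "AE z in lebE d. z \<in> Esp d"
  unfolding lebE_def by (subst AE_distr_iff) auto

lemma nn_integral_lebE:
  assumes [measurable]: "f \<in> borel_measurable Rsp"
  shows "(\<integral>\<^sup>+x. f x \<partial>lebE d) = (\<integral>\<^sup>+x. f (emb d x) \<partial>PiM {..<d} (\<lambda>_. lborel))"
  unfolding lebE_def by (subst nn_integral_distr) auto

lemma nn_integral_gaussE:
  assumes [measurable]: "f \<in> borel_measurable Rsp"
  shows "(\<integral>\<^sup>+x. f x \<partial>gaussE d) = (\<integral>\<^sup>+x. f (emb d x) \<partial>PiM {..<d} (\<lambda>_. stdn))"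
  unfolding gaussE_def by (subst nn_integral_distr) auto

lemma sigma_finite_lebE: "sigma_finite_measure (lebE d)"
proof
  interpret product_sigma_finite "\<lambda>_. lborel :: real measure" by standard
  define B where "B = (\<lambda>n::nat. {x. \<forall>i\<in>{..<d}. \<bar>x i\<bar> \<le> real n})"
  have Bm[measurable]: "B n \<in> sets Rsp" for n
  proof -
    have "{x \<in> space Rsp. \<forall>i\<in>{..<d}. \<bar>x i\<bar> \<le> real n} \<in> sets Rsp"
    proof (rule sets.sets_Collect_finite_All)
      fix i assume "i \<in> {..<d}"
      show "{x \<in> space Rsp. \<bar>x i\<bar> \<le> real n} \<in> sets Rsp"
        by (rule borel_measurable_le) (auto intro!: borel_measurable_abs measurable_Rsp_component)
    qed simp
    then show ?thesis by (simp add: B_def)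
  qed
  have fin: "emeasure (lebE d) (B n) \<noteq> \<infinity>" for n
  proof -
    have "emeasure (lebE d) (B n) = emeasure (PiM {..<d} (\<lambda>_. lborel)) (emb d -` B n \<inter> space (PiM {..<d} (\<lambda>_. lborel :: real measure)))"
      unfolding lebE_def by (rule emeasure_distr[OF measurable_emb_PiM(1) Bm])
    also have "emb d -` B n \<inter> space (PiM {..<d} (\<lambda>_. lborel :: real measure)) = PiE {..<d} (\<lambda>_. {-real n..real n})"
    proof (intro set_eqI)
      fix x :: "nat \<Rightarrow> real"
      have "x \<in> emb d -` B n \<longleftrightarrow> (\<forall>i<d. x i \<in> {-real n..real n})"
        by (simp add: B_def emb_def abs_le_iff neg_le_iff_le minus_le_iff Ball_def conj_commute)
      then show "x \<in> emb d -` B n \<inter> space (PiM {..<d} (\<lambda>_. lborel :: real measure))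
          \<longleftrightarrow> x \<in> PiE {..<d} (\<lambda>_. {-real n..real n})"
        by (simp add: space_PiM PiE_iff conj_commute Ball_def)
    qed
    also have "emeasure (PiM {..<d} (\<lambda>_. lborel)) \<dots> = (\<Prod>i<d. emeasure lborel {-real n..real n})"
      by (rule emeasure_PiM) auto
    also have "\<dots> \<noteq> \<infinity>" by (simp add: power_eq_top_ennreal)
    finally show ?thesis .
  qed
  have "(\<Union>n. B n) = UNIV"
  proof (intro set_eqI iffI UNIV_I)
    fix x :: "nat \<Rightarrow> real"
    obtain n :: nat where "vnorm d x \<le> real n" using real_arch_simple by blast
    then have "x \<in> B n" unfolding B_def by (auto intro: order_trans[OF vnorm_component])
    then show "x \<in> (\<Union>n. B n)" by auto
  qed
  then show "\<exists>A. countable A \<and> A \<subseteq> sets (lebE d) \<and> \<Union> A = space (lebE d) \<and> (\<forall>a\<in>A. emeasure (lebE d) a \<noteq> \<infinity>)"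
    using fin Bm by (intro exI[of _ "range B"]) (simp add: image_subset_iff)
qed

text \<open>Lifts one-dimensional changes of variables to products; both sides agree on boxes. It
  serves for the affine images and the rescalings of the Gaussian measure.\<close>

lemma distr_PiM_coordinatewise:
  fixes M N :: "'i \<Rightarrow> real measure"
  assumes I: "finite I" and M: "\<And>i. sigma_finite_measure (M i)" and N: "\<And>i. sigma_finite_measure (N i)"
    and T: "\<And>i. T i \<in> measurable (M i) (N i)" "\<And>i. distr (M i) (N i) (T i) = N i"
  shows "distr (PiM I M) (PiM I N) (\<lambda>x. \<lambda>i\<in>I. T i (x i)) = PiM I N"
proof -
  interpret M: product_sigma_finite M using M by (simp add: product_sigma_finite_def)
  interpret N: product_sigma_finite N using N by (simp add: product_sigma_finite_def)
  note [measurable] = T(1)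
  have [measurable]: "(\<lambda>x. \<lambda>i\<in>I. T i (x i)) \<in> measurable (PiM I M) (PiM I N)" by measurable
  show ?thesis
  proof (rule N.PiM_eqI[OF I])
    fix A assume A: "\<And>i. i \<in> I \<Longrightarrow> A i \<in> sets (N i)"
    have "emeasure (distr (PiM I M) (PiM I N) (\<lambda>x. \<lambda>i\<in>I. T i (x i))) (PiE I A)
      = emeasure (PiM I M) ((\<lambda>x. \<lambda>i\<in>I. T i (x i)) -` PiE I A \<inter> space (PiM I M))"
      using A I by (intro emeasure_distr) (auto intro!: sets_PiM_I_finite)
    also have "(\<lambda>x. \<lambda>i\<in>I. T i (x i)) -` PiE I A \<inter> space (PiM I M) = PiE I (\<lambda>i. T i -` A i \<inter> space (M i))"
      by (auto simp: space_PiM PiE_iff extensional_def)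
    also have "emeasure (PiM I M) \<dots> = (\<Prod>i\<in>I. emeasure (M i) (T i -` A i \<inter> space (M i)))"
      using A I by (intro M.emeasure_PiM) auto
    also have "\<dots> = (\<Prod>i\<in>I. emeasure (N i) (A i))"
    proof (intro prod.cong refl)
      fix i assume "i \<in> I"
      then have "emeasure (distr (M i) (N i) (T i)) (A i) = emeasure (M i) (T i -` A i \<inter> space (M i))"
        using A by (intro emeasure_distr T) auto
      then show "emeasure (M i) (T i -` A i \<inter> space (M i)) = emeasure (N i) (A i)" by (simp add: T(2))
    qed
    finally show "emeasure (distr (PiM I M) (PiM I N) (\<lambda>x. \<lambda>i\<in>I. T i (x i))) (PiE I A) = (\<Prod>i\<in>I. emeasure (N i) (A i))" .
  qed simp
qed

lemma distr_stdn_affine: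
  assumes c: "c > 0"
  shows "distr stdn (density lborel (normal_density a c)) (\<lambda>z. a + c * z) = density lborel (normal_density a c)"
proof (rule measure_eqI)
  fix A assume "A \<in> sets (distr stdn (density lborel (normal_density a c)) (\<lambda>z. a + c * z))"
  then have [measurable]: "A \<in> sets borel" by simp
  have nd: "normal_density a c (a + c * x) = std_normal_density x / c" for x
    using c by (simp add: normal_density_def power_mult_distrib real_sqrt_mult)
  have "emeasure (density lborel (normal_density a c)) A
     = (\<integral>\<^sup>+x. ennreal (normal_density a c x) * indicator A x \<partial>lborel)"
    by (rule emeasure_density) auto
  also have "\<dots> = ennreal \<bar>c\<bar> * (\<integral>\<^sup>+x. ennreal (normal_density a c (a + c * x)) * indicator A (a + c * x) \<partial>lborel)"
    using c by (intro nn_integral_real_affine) auto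
  also have "\<dots> = (\<integral>\<^sup>+x. ennreal \<bar>c\<bar> * (ennreal (normal_density a c (a + c * x)) * indicator A (a + c * x)) \<partial>lborel)"
    by (rule nn_integral_cmult[symmetric]) auto
  also have "\<dots> = (\<integral>\<^sup>+x. ennreal (std_normal_density x) * indicator ((\<lambda>z. a + c * z) -` A \<inter> space lborel) x \<partial>lborel)"
    using c by (intro nn_integral_cong) (auto simp: nd indicator_def simp flip: ennreal_mult)
  also have "\<dots> = emeasure stdn ((\<lambda>z. a + c * z) -` A \<inter> space lborel)"
    by (rule emeasure_density[symmetric]) measurable
  also have "\<dots> = emeasure (distr stdn (density lborel (normal_density a c)) (\<lambda>z. a + c * z)) A"
    by (subst emeasure_distr) auto
  finally show "emeasure (distr stdn (density lborel (normal_density a c)) (\<lambda>z. a + c * z)) A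
    = emeasure (density lborel (normal_density a c)) A" by simp
qed simp

lemma PiM_density_normal:
  assumes I: "finite I" and c: "c > 0"
  shows "PiM I (\<lambda>i. density lborel (normal_density (a i) c))
       = density (PiM I (\<lambda>_. lborel)) (\<lambda>x. \<Prod>i\<in>I. ennreal (normal_density (a i) c (x i)))"
proof -
  interpret L: product_sigma_finite "\<lambda>_. lborel :: real measure" by standard
  have ps: "prob_space (density lborel (normal_density (a i) c))" for i
    by (rule prob_space_normal_density[OF c])
  interpret N: product_sigma_finite "\<lambda>i. density lborel (normal_density (a i) c)"
    using ps by (simp add: product_sigma_finite_def prob_space_imp_sigma_finite)
  have seq: "sets (PiM I (\<lambda>_. lborel :: real measure)) = sets (PiM I (\<lambda>i. density lborel (normal_density (a i) c)))"
    by (intro sets_PiM_cong) auto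
  show ?thesis
  proof (rule N.PiM_eqI[OF I, symmetric])
    show "sets (density (PiM I (\<lambda>_. lborel)) (\<lambda>x. \<Prod>i\<in>I. ennreal (normal_density (a i) c (x i)))) =
        sets (PiM I (\<lambda>i. density lborel (normal_density (a i) c)))" using seq by simp
    fix A assume A: "\<And>i. i \<in> I \<Longrightarrow> A i \<in> sets (density lborel (normal_density (a i) c))"
    have "emeasure (density (PiM I (\<lambda>_. lborel)) (\<lambda>x. \<Prod>i\<in>I. ennreal (normal_density (a i) c (x i)))) (PiE I A)
      = (\<integral>\<^sup>+x. (\<Prod>i\<in>I. ennreal (normal_density (a i) c (x i))) * indicator (PiE I A) x \<partial>PiM I (\<lambda>_. lborel))"
      using A I by (intro emeasure_density) (auto intro!: sets_PiM_I_finite)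
    also have "\<dots> = (\<integral>\<^sup>+x. (\<Prod>i\<in>I. ennreal (normal_density (a i) c (x i)) * indicator (A i) (x i)) \<partial>PiM I (\<lambda>_. lborel))"
    proof (intro nn_integral_cong)
      fix x assume x: "x \<in> space (PiM I (\<lambda>_. lborel :: real measure))"
      have "indicator (PiE I A) x = (\<Prod>i\<in>I. indicator (A i) (x i) :: ennreal)"
      proof (cases "x \<in> PiE I A")
        case False
        then obtain i where "i \<in> I" "x i \<notin> A i" using x by (auto simp: space_PiM PiE_iff)
        then have "(\<Prod>i\<in>I. indicator (A i) (x i) :: ennreal) = 0" using I by (intro prod_zero) (auto intro!: bexI[of _ i])
        then show ?thesis using False by simp
      next
        case True
        have "(\<Prod>i\<in>I. indicator (A i) (x i) :: ennreal) = 1"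
          by (rule prod.neutral) (use True in \<open>auto simp: PiE_mem\<close>)
        then show ?thesis using True by simp
      qed
      then show "(\<Prod>i\<in>I. ennreal (normal_density (a i) c (x i))) * indicator (PiE I A) x
        = (\<Prod>i\<in>I. ennreal (normal_density (a i) c (x i)) * indicator (A i) (x i))"
        by (simp add: prod.distrib)
    qed
    also have "\<dots> = (\<Prod>i\<in>I. \<integral>\<^sup>+x. ennreal (normal_density (a i) c x) * indicator (A i) x \<partial>lborel)"
      using A I by (intro L.product_nn_integral_prod) auto
    also have "\<dots> = (\<Prod>i\<in>I. emeasure (density lborel (normal_density (a i) c)) (A i))"
      using A by (intro prod.cong refl emeasure_density[symmetric]) auto
    finally show "emeasure (density (PiM I (\<lambda>_. lborel)) (\<lambda>x. \<Prod>i\<in>I. ennreal (normal_density (a i) c (x i)))) (PiE I A)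
      = (\<Prod>i\<in>I. emeasure (density lborel (normal_density (a i) c)) (A i))" .
  qed
qed

text \<open>Density of the centred isotropic normal law; \<open>c\<close> is the standard deviation
  of a coordinate.\<close>

definition gdens :: "nat \<Rightarrow> real \<Rightarrow> (nat \<Rightarrow> real) \<Rightarrow> real" where
  "gdens d c x = (1 / sqrt (2 * pi * c\<^sup>2)) ^ d * exp (- (vnorm d x)\<^sup>2 / (2 * c\<^sup>2))"

lemma gdens_pos: "c > 0 \<Longrightarrow> gdens d c x > 0"
  by (simp add: gdens_def)

lemma measurable_gdens[measurable (raw)]:
  assumes "\<And>i. (\<lambda>x. f x i) \<in> borel_measurable M"
  shows "(\<lambda>x. gdens d c (f x)) \<in> borel_measurable M"
  unfolding gdens_def using assms by measurable

lemma gdens_prod: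
  "(\<Prod>i<d. ennreal (normal_density (a i) c (x i))) = ennreal (gdens d c (\<lambda>i. x i - a i))"
proof -
  have "(\<Prod>i<d. ennreal (normal_density (a i) c (x i))) = ennreal (\<Prod>i<d. normal_density (a i) c (x i))"
    by (rule prod_ennreal) auto
  also have "(\<Prod>i<d. normal_density (a i) c (x i)) = gdens d c (\<lambda>i. x i - a i)"
    by (simp add: normal_density_def gdens_def prod.distrib vnorm_sq prod_dividef power_one_over
        sum_negf sum_divide_distrib flip: exp_sum)
  finally show ?thesis .
qed

text \<open>The law of a + c Z has density \<open>gdens\<close> around a: the affine map acts
  coordinatewise, and the one-dimensional densities multiply. \<open>emb\<close> removes the
  coordinates of \<open>a\<close> beyond \<open>d\<close>, which a measure on R^d must not
  see.\<close>

lemma nn_integral_gaussE_affine: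
  assumes f[measurable]: "f \<in> borel_measurable Rsp" and c: "c > 0"
  shows "(\<integral>\<^sup>+z. f (emb d (\<lambda>i. a i + c * z i)) \<partial>gaussE d) = (\<integral>\<^sup>+x. f x * ennreal (gdens d c (\<lambda>i. x i - a i)) \<partial>lebE d)"
proof -
  let ?N = "\<lambda>i. density lborel (normal_density (a i) c)"
  let ?T = "\<lambda>x. \<lambda>i\<in>{..<d}. a i + c * x i"
  have ps: "prob_space (?N i)" for i by (rule prob_space_normal_density[OF c])
  have d: "distr (PiM {..<d} (\<lambda>_. stdn)) (PiM {..<d} ?N) ?T = PiM {..<d} ?N"
    using distr_stdn_affine[OF c] ps prob_space_stdn
    by (intro distr_PiM_coordinatewise) (auto intro: prob_space_imp_sigma_finite)
  have Tm: "?T \<in> measurable (PiM {..<d} (\<lambda>_. stdn)) (PiM {..<d} ?N)"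
    by (rule measurable_restrict) (simp add: measurable_cong_sets[OF refl sets_density])
  have m[measurable]: "emb d \<in> measurable (PiM {..<d} ?N) Rsp"
    using measurable_emb_PiM(1) by (simp cong: measurable_cong_sets sets_PiM_cong)
  have g: "gdens d c (\<lambda>i. emb d x i - a i) = gdens d c (\<lambda>i. x i - a i)" for x
    unfolding gdens_def by (subst vnorm_cong[of d _ "\<lambda>i. x i - a i"]) (auto simp: emb_def)
  have ma: "(\<lambda>z. f (emb d (\<lambda>i. a i + c * z i))) \<in> borel_measurable Rsp"
  proof -
    have "(\<lambda>z. (\<lambda>i. a i + c * z i)) \<in> measurable Rsp Rsp" by (rule measurable_into_Rsp) measurable
    then show ?thesis by measurable
  qed
  have "(\<integral>\<^sup>+z. f (emb d (\<lambda>i. a i + c * z i)) \<partial>gaussE d)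
    = (\<integral>\<^sup>+z. f (emb d (\<lambda>i. a i + c * emb d z i)) \<partial>PiM {..<d} (\<lambda>_. stdn))"
    using ma by (rule nn_integral_gaussE)
  also have "\<dots> = (\<integral>\<^sup>+z. f (emb d (?T z)) \<partial>PiM {..<d} (\<lambda>_. stdn))"
    by (intro nn_integral_cong arg_cong[where f=f]) (auto simp: emb_def)
  also have "\<dots> = (\<integral>\<^sup>+z. f (emb d z) \<partial>distr (PiM {..<d} (\<lambda>_. stdn)) (PiM {..<d} ?N) ?T)"
    by (rule nn_integral_distr[OF Tm, symmetric]) (simp add: measurable_compose[OF m f])
  also have "\<dots> = (\<integral>\<^sup>+x. ennreal (gdens d c (\<lambda>i. x i - a i)) * f (emb d x) \<partial>PiM {..<d} (\<lambda>_. lborel))"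
    unfolding d
    unfolding PiM_density_normal[OF finite_lessThan c] gdens_prod
  proof (rule nn_integral_density)
    have "(\<lambda>x. ennreal (gdens d c (\<lambda>i. x i - a i))) \<in> borel_measurable Rsp" by measurable
    from measurable_compose[OF measurable_emb_PiM(1)[of d] this]
    show "(\<lambda>x. ennreal (gdens d c (\<lambda>i. x i - a i))) \<in> borel_measurable (PiM {..<d} (\<lambda>_. lborel))"
      unfolding g .
    show "(\<lambda>x. f (emb d x)) \<in> borel_measurable (PiM {..<d} (\<lambda>_. lborel))"
      by (rule measurable_compose[OF measurable_emb_PiM(1) f])
  qed
  also have "\<dots> = (\<integral>\<^sup>+x. f x * ennreal (gdens d c (\<lambda>i. x i - a i)) \<partial>lebE d)"
  proof (subst nn_integral_lebE)
    show "(\<lambda>x. f x * ennreal (gdens d c (\<lambda>i. x i - a i))) \<in> borel_measurable Rsp" by measurable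
    show "(\<integral>\<^sup>+x. ennreal (gdens d c (\<lambda>i. x i - a i)) * f (emb d x) \<partial>PiM {..<d} (\<lambda>_. lborel))
       = (\<integral>\<^sup>+x. f (emb d x) * ennreal (gdens d c (\<lambda>i. emb d x i - a i)) \<partial>PiM {..<d} (\<lambda>_. lborel))"
      unfolding g by (simp add: mult.commute)
  qed
  finally show ?thesis .
qed

lemma convolution_stdn:
  assumes [measurable]: "A \<in> sets borel"
  shows "(\<integral>\<^sup>+x. (\<integral>\<^sup>+y. indicator A (x + y) \<partial>stdn) \<partial>stdn) = emeasure (density lborel (normal_density 0 (sqrt 2))) A"
proof -
  have fm: "finite_measure stdn" using prob_space_stdn by (rule prob_space.finite_measure)
  have "(\<integral>\<^sup>+x. (\<integral>\<^sup>+y. indicator A (x + y) \<partial>stdn) \<partial>stdn) = emeasure (stdn \<star> stdn) A"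
    using fm by (intro convolution_emeasure'[symmetric]) auto
  also have "stdn \<star> stdn = density lborel (\<lambda>x. \<integral>\<^sup>+y. ennreal (std_normal_density (x - y)) * ennreal (std_normal_density y) \<partial>lborel)"
    using fm by (intro convolution_density) auto
  also have "(\<lambda>x. \<integral>\<^sup>+y. ennreal (std_normal_density (x - y)) * ennreal (std_normal_density y) \<partial>lborel) = normal_density 0 (sqrt 2)"
    using conv_normal_density_zero_mean[of 1 1] by (simp add: ennreal_mult)
  finally show ?thesis .
qed

text \<open>The sum of two independent standard Gaussians is sqrt 2 times one. This splits the Euler
  noise of variance 2 s into the half shared with the Gibbs sampler and the half compared
  conditionally.\<close>

lemma nn_integral_gaussE_sum:
  assumes f[measurable]: "f \<in> borel_measurable Rsp"
  shows "(\<integral>\<^sup>+z. (\<integral>\<^sup>+z'. f (\<lambda>i. z i + z' i) \<partial>gaussE d) \<partial>gaussE d) = (\<integral>\<^sup>+z. f (\<lambda>i. sqrt 2 * z i) \<partial>gaussE d)"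
proof -
  let ?S = "PiM {..<d} (\<lambda>_. stdn)"
  let ?N = "PiM {..<d} (\<lambda>_. density lborel (normal_density 0 (sqrt 2)))"
  let ?T = "\<lambda>(x, y). \<lambda>i\<in>{..<d}. x i + (y i :: real)"
  interpret S: prob_space ?S by (intro prob_space_PiM prob_space_stdn)
  have fm: "finite_measure stdn" using prob_space_stdn by (rule prob_space.finite_measure)
  interpret P: product_sigma_finite "\<lambda>_. stdn"
    by (simp add: product_sigma_finite_def prob_space_imp_sigma_finite prob_space_stdn)
  interpret N: product_sigma_finite "\<lambda>_. density lborel (normal_density 0 (sqrt 2))"
    by (simp add: product_sigma_finite_def prob_space_imp_sigma_finite prob_space_normal_density)
  have m1: "?T \<in> measurable (?S \<Otimes>\<^sub>M ?S) (PiM {..<d} (\<lambda>_. borel))"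
    unfolding split_beta'
  proof (rule measurable_restrict)
    fix i assume "i \<in> {..<d}"
    then have "(\<lambda>x. x i) \<in> measurable ?S stdn" by (rule measurable_component_singleton)
    then have c: "(\<lambda>x. x i) \<in> borel_measurable ?S" by simp
    show "(\<lambda>p. fst p i + snd p i) \<in> borel_measurable (?S \<Otimes>\<^sub>M ?S)"
      by (intro borel_measurable_add measurable_compose[OF measurable_fst c] measurable_compose[OF measurable_snd c])
  qed
  have sN: "sets ?N = sets (PiM {..<d} (\<lambda>_. borel))" by (intro sets_PiM_cong) auto
  have m[measurable]: "?T \<in> measurable (?S \<Otimes>\<^sub>M ?S) ?N" using m1 measurable_cong_sets[OF refl sN] by blast
  have me[measurable]: "emb d \<in> measurable ?N Rsp"
    using measurable_emb_PiM(1) by (simp cong: measurable_cong_sets sets_PiM_cong)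
  \<comment> \<open>Both sides are determined by boxes, where the double integral factorises into
    one-dimensional convolutions.\<close>
  have D: "distr (?S \<Otimes>\<^sub>M ?S) ?N ?T = ?N"
  proof (rule N.PiM_eqI)
    fix A :: "nat \<Rightarrow> real set" assume "\<And>i. i \<in> {..<d} \<Longrightarrow> A i \<in> sets (density lborel (normal_density 0 (sqrt 2)))"
    then have A[measurable]: "\<And>i. i < d \<Longrightarrow> A i \<in> sets borel" by auto
    have PA[measurable]: "PiE {..<d} A \<in> sets ?N" using A by (intro sets_PiM_I_finite) auto
    have ind: "indicator (PiE {..<d} A) (?T (x, y)) = (\<Prod>i<d. indicator (A i) (x i + y i) :: ennreal)" for x y
    proof (cases "?T (x, y) \<in> PiE {..<d} A")
      case False
      then obtain i where "i < d" "x i + y i \<notin> A i" by (auto simp: PiE_iff)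
      then have "(\<Prod>i<d. indicator (A i) (x i + y i) :: ennreal) = 0" by (intro prod_zero) (auto intro!: bexI[of _ i])
      then show ?thesis using False by simp
    next
      case True
      then have "\<And>i. i < d \<Longrightarrow> x i + y i \<in> A i" by (auto simp: PiE_iff)
      then show ?thesis using True by simp
    qed
    have "emeasure (distr (?S \<Otimes>\<^sub>M ?S) ?N ?T) (PiE {..<d} A) = (\<integral>\<^sup>+p. indicator (PiE {..<d} A) (?T p) \<partial>(?S \<Otimes>\<^sub>M ?S))"
      by (subst nn_integral_indicator[symmetric], simp, rule nn_integral_distr[OF m], simp)
    also have "\<dots> = (\<integral>\<^sup>+x. (\<integral>\<^sup>+y. indicator (PiE {..<d} A) (?T (x, y)) \<partial>?S) \<partial>?S)"
      by (rule S.nn_integral_fst[symmetric]) measurable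
    also have "\<dots> = (\<integral>\<^sup>+x. (\<integral>\<^sup>+y. (\<Prod>i<d. indicator (A i) (x i + y i)) \<partial>?S) \<partial>?S)"
      by (simp only: ind)
    also have "\<dots> = (\<integral>\<^sup>+x. (\<Prod>i<d. \<integral>\<^sup>+y. indicator (A i) (x i + y) \<partial>stdn) \<partial>?S)"
      by (intro nn_integral_cong P.product_nn_integral_prod) auto
    also have "\<dots> = (\<Prod>i<d. \<integral>\<^sup>+x. (\<integral>\<^sup>+y. indicator (A i) (x + y) \<partial>stdn) \<partial>stdn)"
    proof (rule P.product_nn_integral_prod)
      fix i assume i: "i \<in> {..<d}"
      have [measurable]: "A i \<in> sets borel" using A i by auto
      have "(\<lambda>p. indicator (A i) (fst p + snd p) :: ennreal) \<in> borel_measurable (borel \<Otimes>\<^sub>M borel)" by measurable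
      moreover have "sets (stdn \<Otimes>\<^sub>M stdn) = sets (borel \<Otimes>\<^sub>M borel :: (real \<times> real) measure)"
        by (intro sets_pair_measure_cong) auto
      ultimately have "(\<lambda>p. indicator (A i) (fst p + snd p) :: ennreal) \<in> borel_measurable (stdn \<Otimes>\<^sub>M stdn)"
        using measurable_cong_sets[of "stdn \<Otimes>\<^sub>M stdn" "borel \<Otimes>\<^sub>M borel" borel borel] by blast
      then show "(\<lambda>x. \<integral>\<^sup>+y. indicator (A i) (x + y) \<partial>stdn) \<in> borel_measurable stdn"
        by (intro sigma_finite_measure.borel_measurable_nn_integral[OF prob_space_imp_sigma_finite[OF prob_space_stdn]])
          (simp only: split_beta')
    qed simp
    also have "\<dots> = (\<Prod>i<d. emeasure (density lborel (normal_density 0 (sqrt 2))) (A i))"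
      by (intro prod.cong refl convolution_stdn) auto
    finally show "emeasure (distr (?S \<Otimes>\<^sub>M ?S) ?N ?T) (PiE {..<d} A) = (\<Prod>i<d. emeasure (density lborel (normal_density 0 (sqrt 2))) (A i))" .
  qed auto
  have pm: "(\<lambda>p. (\<lambda>i. fst p i + snd p i)) \<in> measurable (Rsp \<Otimes>\<^sub>M Rsp) Rsp"
    by (rule measurable_into_Rsp) measurable
  have pm2: "(\<lambda>x. (\<lambda>i. y i + x i)) \<in> measurable Rsp Rsp" for y
    by (rule measurable_into_Rsp) measurable
  have pm3: "(\<lambda>x. (\<lambda>i. c * x i)) \<in> measurable Rsp Rsp" for c
    by (rule measurable_into_Rsp) measurable
  have fp[measurable]: "(\<lambda>p. f (\<lambda>i. fst p i + snd p i)) \<in> borel_measurable (Rsp \<Otimes>\<^sub>M Rsp)"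
    using pm by measurable
  interpret g: prob_space "gaussE d" by (rule prob_space_gaussE)
  have "(\<lambda>z. \<integral>\<^sup>+z'. f (\<lambda>i. z i + z' i) \<partial>gaussE d) \<in> borel_measurable Rsp"
    by (rule g.borel_measurable_nn_integral) (use fp in \<open>simp add: split_beta' cong: measurable_cong_sets\<close>)
  then have "(\<integral>\<^sup>+z. (\<integral>\<^sup>+z'. f (\<lambda>i. z i + z' i) \<partial>gaussE d) \<partial>gaussE d)
     = (\<integral>\<^sup>+z. (\<integral>\<^sup>+z'. f (\<lambda>i. emb d z i + z' i) \<partial>gaussE d) \<partial>?S)"
    by (rule nn_integral_gaussE)
  also have "\<dots> = (\<integral>\<^sup>+z. (\<integral>\<^sup>+z'. f (\<lambda>i. emb d z i + emb d z' i) \<partial>?S) \<partial>?S)"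
    by (intro nn_integral_cong nn_integral_gaussE measurable_compose[OF pm2 f])
  also have "\<dots> = (\<integral>\<^sup>+z. (\<integral>\<^sup>+z'. f (emb d (?T (z, z'))) \<partial>?S) \<partial>?S)"
    by (intro nn_integral_cong arg_cong[where f=f]) (auto simp: emb_def)
  also have "\<dots> = (\<integral>\<^sup>+p. f (emb d (?T p)) \<partial>(?S \<Otimes>\<^sub>M ?S))"
    by (rule S.nn_integral_fst) measurable
  also have "\<dots> = (\<integral>\<^sup>+x. f (emb d x) \<partial>?N)"
  proof -
    have "(\<lambda>x. f (emb d x)) \<in> borel_measurable (distr (?S \<Otimes>\<^sub>M ?S) ?N ?T)"
      using measurable_compose[OF me f] by simp
    from nn_integral_distr[OF m this] show ?thesis by (simp only: D)
  qed
  also have "?N = distr ?S ?N (\<lambda>x. \<lambda>i\<in>{..<d}. 0 + sqrt 2 * x i)"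
    using distr_stdn_affine[of "sqrt 2" 0] prob_space_stdn
    by (intro distr_PiM_coordinatewise[symmetric]) (auto intro!: prob_space_imp_sigma_finite prob_space_normal_density)
  also have "(\<integral>\<^sup>+x. f (emb d x) \<partial>distr ?S ?N (\<lambda>x. \<lambda>i\<in>{..<d}. 0 + sqrt 2 * x i))
     = (\<integral>\<^sup>+x. f (emb d (\<lambda>i\<in>{..<d}. 0 + sqrt 2 * x i)) \<partial>?S)"
    by (rule nn_integral_distr) (auto intro!: measurable_restrict)
  also have "\<dots> = (\<integral>\<^sup>+x. f (\<lambda>i. sqrt 2 * emb d x i) \<partial>?S)"
    by (intro nn_integral_cong arg_cong[where f=f]) (auto simp: emb_def)
  also have "\<dots> = (\<integral>\<^sup>+z. f (\<lambda>i. sqrt 2 * z i) \<partial>gaussE d)"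
    by (rule nn_integral_gaussE[symmetric]) (use pm3 in measurable)
  finally show ?thesis .
qed

section \<open>Moments of the standard Gaussian\<close>

lemma distr_gaussE_component:
  assumes i: "i < d"
  shows "distr (gaussE d) borel (\<lambda>z. z i) = stdn"
proof -
  have "distr (gaussE d) borel (\<lambda>z. z i) = distr (PiM {..<d} (\<lambda>_. stdn)) borel (\<lambda>z. emb d z i)"
    unfolding gaussE_def by (subst distr_distr) (auto simp: comp_def)
  also have "\<dots> = distr (PiM {..<d} (\<lambda>_. stdn)) stdn (\<lambda>z. z i)"
    using i by (intro distr_cong) (auto simp: emb_def)
  also have "\<dots> = stdn" using i by (intro distr_PiM_component prob_space_stdn) auto
  finally show ?thesis .
qed

lemma gaussE_component_moment:
  assumes i: "i < d"
  shows "integrable (gaussE d) (\<lambda>z. (z i) ^ k)" "(\<integral>z. (z i) ^ k \<partial>gaussE d) = (\<integral>x. std_normal_density x * x ^ k \<partial>lborel)"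
proof -
  have "integrable stdn (\<lambda>x. x ^ k)"
    using integrable_std_normal_moment[of k] by (subst integrable_density) auto
  then have "integrable (distr (gaussE d) borel (\<lambda>z. z i)) (\<lambda>x. x ^ k)" by (simp add: distr_gaussE_component[OF i])
  then show "integrable (gaussE d) (\<lambda>z. (z i) ^ k)" by (subst (asm) integrable_distr_eq) auto
  have "(\<integral>z. (z i) ^ k \<partial>gaussE d) = (\<integral>x. x ^ k \<partial>distr (gaussE d) borel (\<lambda>z. z i))"
    by (rule integral_distr[symmetric]) auto
  also have "\<dots> = (\<integral>x. std_normal_density x * x ^ k \<partial>lborel)"
    unfolding distr_gaussE_component[OF i] by (subst integral_density) auto
  finally show "(\<integral>z. (z i) ^ k \<partial>gaussE d) = (\<integral>x. std_normal_density x * x ^ k \<partial>lborel)" .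
qed

lemma gaussE_moments:
  assumes i: "i < d"
  shows "(\<integral>z. z i \<partial>gaussE d) = 0" "(\<integral>z. (z i)\<^sup>2 \<partial>gaussE d) = 1" "(\<integral>z. (z i) ^ 4 \<partial>gaussE d) = 3"
proof -
  show "(\<integral>z. z i \<partial>gaussE d) = 0"
    using gaussE_component_moment(2)[OF i, of 1] integral_std_normal_moment_odd[of 0] by simp
  show "(\<integral>z. (z i)\<^sup>2 \<partial>gaussE d) = 1"
    using gaussE_component_moment(2)[OF i, of 2] integral_std_normal_moment_even[of 1] by (simp add: fact_numeral)
  show "(\<integral>z. (z i) ^ 4 \<partial>gaussE d) = 3"
    using gaussE_component_moment(2)[OF i, of 4] integral_std_normal_moment_even[of 2] by (simp add: fact_numeral)
qed

lemma gaussE_vnorm2: "integrable (gaussE d) (\<lambda>z. (vnorm d z)\<^sup>2)" "(\<integral>z. (vnorm d z)\<^sup>2 \<partial>gaussE d) = real d"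
  unfolding vnorm_sq by (auto simp: gaussE_component_moment(1) gaussE_moments)

lemma gaussE_vinner: "integrable (gaussE d) (\<lambda>z. vinner d u z)" "(\<integral>z. vinner d u z \<partial>gaussE d) = 0"
  unfolding vinner_def using gaussE_component_moment(1)[of _ d 1] by (auto simp: gaussE_moments)

text \<open>Cauchy--Schwarz trades the mixed terms for a factor \<open>d\<close>. The resulting
  fourth moment is at most three times the square of the second moment, with a ratio independent of
  the dimension.\<close>

lemma vnorm4_le: "(vnorm d z) ^ 4 \<le> real d * (\<Sum>i<d. (z i) ^ 4)"
proof -
  have "(vnorm d z) ^ 4 = (\<Sum>i<d. (z i)\<^sup>2)\<^sup>2" by (simp flip: vnorm_sq)
  also have "\<dots> \<le> real d * (\<Sum>i<d. ((z i)\<^sup>2)\<^sup>2)"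
    using sum_squared_le_sum_of_squares[of "\<lambda>i. (z i)\<^sup>2" "{..<d}"] by (simp add: mult.commute)
  finally show ?thesis by simp
qed

lemma gaussE_vnorm4: "integrable (gaussE d) (\<lambda>z. (vnorm d z) ^ 4)" "(\<integral>z. (vnorm d z) ^ 4 \<partial>gaussE d) \<le> 3 * (real d)\<^sup>2"
proof -
  have i: "integrable (gaussE d) (\<lambda>z. real d * (\<Sum>i<d. (z i) ^ 4))"
    by (auto simp: gaussE_component_moment)
  show i4: "integrable (gaussE d) (\<lambda>z. (vnorm d z) ^ 4)"
    by (rule Bochner_Integration.integrable_bound[OF i]) (auto intro!: vnorm4_le order_trans[OF _ abs_ge_self])
  have "(\<integral>z. (vnorm d z) ^ 4 \<partial>gaussE d) \<le> (\<integral>z. real d * (\<Sum>i<d. (z i) ^ 4) \<partial>gaussE d)"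
    by (rule integral_mono[OF i4 i vnorm4_le])
  also have "\<dots> = 3 * (real d)\<^sup>2"
    by (simp add: gaussE_component_moment(1) gaussE_moments power2_eq_square)
  finally show "(\<integral>z. (vnorm d z) ^ 4 \<partial>gaussE d) \<le> 3 * (real d)\<^sup>2" .
qed

subsection \<open>Transport inequalities for log-concave measures\<close>

definition polyb :: "nat \<Rightarrow> ((nat \<Rightarrow> real) \<Rightarrow> real) \<Rightarrow> bool" where
  "polyb d f \<longleftrightarrow> f \<in> borel_measurable Rsp \<and> (\<exists>C k. \<forall>x. \<bar>f x\<bar> \<le> C * (1 + vnorm d x) ^ k)"

lemma polybI:
  "f \<in> borel_measurable Rsp \<Longrightarrow> (\<And>x. \<bar>f x\<bar> \<le> C * (1 + vnorm d x) ^ k) \<Longrightarrow> polyb d f"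
  unfolding polyb_def by blast

lemma polyb_measurable[measurable_dest]: "polyb d f \<Longrightarrow> f \<in> borel_measurable Rsp"
  by (simp add: polyb_def)

lemma polybE:
  assumes "polyb d f"
  obtains C k where "C \<ge> 0" "\<And>x. \<bar>f x\<bar> \<le> C * (1 + vnorm d x) ^ k"
proof -
  from assms obtain C k where *: "\<And>x. \<bar>f x\<bar> \<le> C * (1 + vnorm d x) ^ k" unfolding polyb_def by blast
  have "\<bar>f x\<bar> \<le> \<bar>C\<bar> * (1 + vnorm d x) ^ k" for x
    by (rule order_trans[OF *]) (intro mult_right_mono, auto)
  then show ?thesis using that[of "\<bar>C\<bar>" k] by auto
qed

lemma polyb_const[simp]: "polyb d (\<lambda>x. c)"
  by (rule polybI[where C="\<bar>c\<bar>" and k=0]) auto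

lemma polyb_vnorm[simp]: "polyb d (vnorm d)"
  by (rule polybI[where C=1 and k=1]) auto

lemma polyb_add[intro]:
  assumes "polyb d f" "polyb d g" shows "polyb d (\<lambda>x. f x + g x)"
proof -
  obtain C k where f: "C \<ge> 0" "\<And>x. \<bar>f x\<bar> \<le> C * (1 + vnorm d x) ^ k" using polybE[OF assms(1)] by blast
  obtain D l where g: "D \<ge> 0" "\<And>x. \<bar>g x\<bar> \<le> D * (1 + vnorm d x) ^ l" using polybE[OF assms(2)] by blast
  show ?thesis
  proof (rule polybI[where C="C + D" and k="k + l"])
    fix x
    have "(1 + vnorm d x) ^ k \<le> (1 + vnorm d x) ^ (k + l)" "(1 + vnorm d x) ^ l \<le> (1 + vnorm d x) ^ (k + l)"
      by (intro power_increasing; simp)+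
    then have "C * (1 + vnorm d x) ^ k + D * (1 + vnorm d x) ^ l \<le> (C + D) * (1 + vnorm d x) ^ (k + l)"
      using f(1) g(1) by (simp add: distrib_right add_mono mult_left_mono)
    then show "\<bar>f x + g x\<bar> \<le> (C + D) * (1 + vnorm d x) ^ (k + l)" using f(2)[of x] g(2)[of x] by linarith
  qed (use assms in measurable)
qed

lemma polyb_mult[intro]:
  assumes "polyb d f" "polyb d g" shows "polyb d (\<lambda>x. f x * g x)"
proof -
  obtain C k where f: "C \<ge> 0" "\<And>x. \<bar>f x\<bar> \<le> C * (1 + vnorm d x) ^ k" using polybE[OF assms(1)] by blast
  obtain D l where g: "D \<ge> 0" "\<And>x. \<bar>g x\<bar> \<le> D * (1 + vnorm d x) ^ l" using polybE[OF assms(2)] by blast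
  show ?thesis
  proof (rule polybI[where C="C * D" and k="k + l"])
    fix x
    have "\<bar>f x\<bar> * \<bar>g x\<bar> \<le> (C * (1 + vnorm d x) ^ k) * (D * (1 + vnorm d x) ^ l)"
      using f g by (intro mult_mono) auto
    then show "\<bar>f x * g x\<bar> \<le> C * D * (1 + vnorm d x) ^ (k + l)" by (simp add: abs_mult power_add mult_ac)
  qed (use assms in measurable)
qed

lemma polyb_cmult[intro]: "polyb d f \<Longrightarrow> polyb d (\<lambda>x. c * f x)"
  by (rule polyb_mult[OF polyb_const])

lemma polyb_minus[intro]: "polyb d f \<Longrightarrow> polyb d (\<lambda>x. - f x)"
  using polyb_cmult[of d f "-1"] by simp

lemma polyb_diff[intro]: "polyb d f \<Longrightarrow> polyb d g \<Longrightarrow> polyb d (\<lambda>x. f x - g x)"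
  using polyb_add[of d f "\<lambda>x. - g x"] polyb_minus[of d g] by simp

lemma polyb_power[intro]: "polyb d f \<Longrightarrow> polyb d (\<lambda>x. f x ^ n)"
  by (induction n) (auto intro!: polyb_mult)

lemma polyb_mono:
  assumes g: "polyb d g" and f: "f \<in> borel_measurable Rsp" and le: "\<And>x. \<bar>f x\<bar> \<le> g x"
  shows "polyb d f"
proof -
  obtain D l where g: "D \<ge> 0" "\<And>x. \<bar>g x\<bar> \<le> D * (1 + vnorm d x) ^ l" using polybE[OF g] by blast
  show ?thesis by (rule polybI[OF f, where C=D and k=l]) (rule order_trans[OF order_trans[OF le abs_ge_self] g(2)])
qed

lemma polyb_lipschitz:
  assumes f: "\<And>x y. \<bar>f x - f y\<bar> \<le> L * vnorm d (\<lambda>i. x i - y i)"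
  shows "polyb d f"
proof (rule polyb_mono[where g="\<lambda>x. \<bar>f (\<lambda>_. 0)\<bar> + L * vnorm d x"])
  show "polyb d (\<lambda>x. \<bar>f (\<lambda>_. 0)\<bar> + L * vnorm d x)" by (intro polyb_add polyb_cmult) auto
  show "f \<in> borel_measurable Rsp" by (rule borel_measurable_vnorm_lipschitz[OF f])
  fix x show "\<bar>f x\<bar> \<le> \<bar>f (\<lambda>_. 0)\<bar> + L * vnorm d x" using f[of x "\<lambda>_. 0"] by simp
qed

text \<open>The quadratic lower bound gives exp (- V) Gaussian decay, so every \<open>polyb\<close>
  function has a finite average. Invariance under \<open>emb\<close> makes V a function on
  R^d.\<close>

definition tame :: "nat \<Rightarrow> ((nat \<Rightarrow> real) \<Rightarrow> real) \<Rightarrow> bool" where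
  "tame d V \<longleftrightarrow> polyb d V \<and> (\<forall>x. V (emb d x) = V x) \<and> (\<exists>c>0. \<exists>C. \<forall>x. V x \<ge> c * (vnorm d x)\<^sup>2 - C)"

definition Zf :: "nat \<Rightarrow> ((nat \<Rightarrow> real) \<Rightarrow> real) \<Rightarrow> real" where
  "Zf d V = (\<integral>x. exp (- V x) \<partial>lebE d)"

definition gibbs :: "nat \<Rightarrow> ((nat \<Rightarrow> real) \<Rightarrow> real) \<Rightarrow> ((nat \<Rightarrow> real) \<Rightarrow> real) \<Rightarrow> real" where
  "gibbs d V f = (\<integral>x. f x * exp (- V x) \<partial>lebE d) / Zf d V"

text \<open>Strong convexity with modulus \<open>m\<close> in its derivative-free form, which is
  exactly what the Prekopa--Leindler hypothesis consumes.\<close>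

definition sconv :: "nat \<Rightarrow> real \<Rightarrow> ((nat \<Rightarrow> real) \<Rightarrow> real) \<Rightarrow> bool" where
  "sconv d m V \<longleftrightarrow> (\<forall>x y t. 0 < t \<longrightarrow> t < 1 \<longrightarrow>
     V (\<lambda>i. t * x i + (1 - t) * y i) \<le> t * V x + (1 - t) * V y - m * t * (1 - t) / 2 * (vnorm d (\<lambda>i. x i - y i))\<^sup>2)"

lemma nn_integral_gdens: "c > 0 \<Longrightarrow> (\<integral>\<^sup>+x. ennreal (gdens d c x) \<partial>lebE d) = 1"
proof -
  assume c: "c > 0"
  interpret prob_space "gaussE d" by (rule prob_space_gaussE)
  show ?thesis using nn_integral_gaussE_affine[of "\<lambda>_. 1" c d "\<lambda>_. 0"] c emeasure_space_1 by simp
qed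

lemma integrable_gaussian_tail:
  assumes c: "c > 0"
  shows "integrable (lebE d) (\<lambda>x. exp (- c * (vnorm d x)\<^sup>2))"
proof -
  define \<sigma> where "\<sigma> = 1 / sqrt (2 * c)"
  have s: "\<sigma> > 0" "\<sigma>\<^sup>2 = 1 / (2 * c)" using c by (auto simp: \<sigma>_def power_divide)
  have "integrable (lebE d) (gdens d \<sigma>)"
  proof (rule integrableI_bounded)
    show "gdens d \<sigma> \<in> borel_measurable (lebE d)" by measurable
    have "(\<integral>\<^sup>+x. ennreal (norm (gdens d \<sigma> x)) \<partial>lebE d) = (\<integral>\<^sup>+x. ennreal (gdens d \<sigma> x) \<partial>lebE d)"
      using gdens_pos[OF s(1), of d] by (intro nn_integral_cong) (simp add: less_imp_le)
    then show "(\<integral>\<^sup>+x. ennreal (norm (gdens d \<sigma> x)) \<partial>lebE d) < \<infinity>" using nn_integral_gdens[OF s(1)] by simp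
  qed
  then have "integrable (lebE d) (\<lambda>x. (sqrt (2 * pi * \<sigma>\<^sup>2)) ^ d * gdens d \<sigma> x)" by simp
  moreover have "(sqrt (2 * pi * \<sigma>\<^sup>2)) ^ d * gdens d \<sigma> x = exp (- c * (vnorm d x)\<^sup>2)" for x
    using s(1) c by (simp add: gdens_def power_one_over s(2))
  ultimately show ?thesis by simp
qed

lemma integrable_tame:
  assumes f: "polyb d f" and V: "tame d V"
  shows "integrable (lebE d) (\<lambda>x. f x * exp (- V x))"
proof -
  obtain C k where C: "C \<ge> 0" "\<And>x. \<bar>f x\<bar> \<le> C * (1 + vnorm d x) ^ k" using polybE[OF f] by blast
  obtain c K where c: "c > 0" "\<And>x. V x \<ge> c * (vnorm d x)\<^sup>2 - K" using V unfolding tame_def by blast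
  have [measurable]: "f \<in> borel_measurable Rsp" "V \<in> borel_measurable Rsp"
    using f V by (auto simp: polyb_def tame_def)
  show ?thesis
  proof (rule Bochner_Integration.integrable_bound)
    show "integrable (lebE d) (\<lambda>x. (C * exp ((real k)\<^sup>2 / (2 * c) + K)) * exp (- (c / 2) * (vnorm d x)\<^sup>2))"
      using c by (intro integrable_mult_right integrable_gaussian_tail) auto
    show "AE x in lebE d. norm (f x * exp (- V x)) \<le> norm (C * exp ((real k)\<^sup>2 / (2 * c) + K) * exp (- (c / 2) * (vnorm d x)\<^sup>2))"
    proof (rule AE_I2)
      fix x
      define r where "r = vnorm d x"
      have r: "r \<ge> 0" by (simp add: r_def)
      have "(1 + r) ^ k \<le> exp r ^ k" using r by (intro power_mono) auto
      also have "\<dots> = exp (real k * r)" by (simp add: exp_of_nat_mult)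
      \<comment> \<open>Completing the square: half of the quadratic decay is spent on absorbing the
        polynomial, the other half remains integrable.\<close>
      also have "\<dots> \<le> exp ((real k)\<^sup>2 / (2 * c) + c / 2 * r\<^sup>2)"
      proof -
        have "0 \<le> (real k - c * r)\<^sup>2 / (2 * c)" using c by simp
        also have "\<dots> = (real k)\<^sup>2 / (2 * c) + c / 2 * r\<^sup>2 - real k * r"
          using c by (simp add: power2_eq_square field_simps)
        finally show ?thesis by simp
      qed
      finally have 1: "(1 + r) ^ k \<le> exp ((real k)\<^sup>2 / (2 * c) + c / 2 * r\<^sup>2)" .
      have "\<bar>f x\<bar> * exp (- V x) \<le> (C * exp ((real k)\<^sup>2 / (2 * c) + c / 2 * r\<^sup>2)) * exp (K - c * r\<^sup>2)"
        using C(2)[of x] mult_left_mono[OF 1 C(1)] c(2)[of x] by (intro mult_mono) (auto simp: r_def)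
      also have "\<dots> = C * exp ((real k)\<^sup>2 / (2 * c) + K) * exp (- (c / 2) * r\<^sup>2)"
        by (simp add: mult.assoc flip: exp_add)
      finally show "norm (f x * exp (- V x)) \<le> norm (C * exp ((real k)\<^sup>2 / (2 * c) + K) * exp (- (c / 2) * (vnorm d x)\<^sup>2))"
        using C(1) by (simp add: abs_mult r_def)
    qed
  qed measurable
qed

lemma integrable_exp_tame: "tame d V \<Longrightarrow> integrable (lebE d) (\<lambda>x. exp (- V x))"
  using integrable_tame[OF polyb_const[of d 1]] by simp

lemma Zf_pos:
  assumes V: "tame d V" shows "Zf d V > 0"
proof -
  have "Zf d V \<ge> 0" unfolding Zf_def by simp
  moreover have "Zf d V \<noteq> 0"
  proof
    assume "Zf d V = 0"
    then have "AE x in lebE d. exp (- V x) = 0"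
      unfolding Zf_def using integrable_exp_tame[OF V] by (subst (asm) integral_nonneg_eq_0_iff_AE) auto
    then have "AE x in lebE d. False" by simp
    then have "(\<integral>\<^sup>+x. ennreal (gdens d 1 x) \<partial>lebE d) = (\<integral>\<^sup>+x. 0 \<partial>lebE d)"
      by (intro nn_integral_cong_AE) auto
    then show False using nn_integral_gdens[of 1 d] by simp
  qed
  ultimately show ?thesis by simp
qed

lemma gibbs_add: "tame d V \<Longrightarrow> polyb d f \<Longrightarrow> polyb d g \<Longrightarrow> gibbs d V (\<lambda>x. f x + g x) = gibbs d V f + gibbs d V g"
  unfolding gibbs_def by (simp add: distrib_right integrable_tame add_divide_distrib)

lemma gibbs_cmult: "gibbs d V (\<lambda>x. c * f x) = c * gibbs d V f"
  unfolding gibbs_def by (simp add: mult.assoc)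

lemma gibbs_diff: "tame d V \<Longrightarrow> polyb d f \<Longrightarrow> polyb d g \<Longrightarrow> gibbs d V (\<lambda>x. f x - g x) = gibbs d V f - gibbs d V g"
  unfolding gibbs_def by (simp add: left_diff_distrib integrable_tame diff_divide_distrib)

lemma gibbs_const: "tame d V \<Longrightarrow> gibbs d V (\<lambda>x. c) = c"
  using Zf_pos[of d V] unfolding gibbs_def by (simp add: Zf_def)

lemma gibbs_minus: "gibbs d V (\<lambda>x. - f x) = - gibbs d V f"
  using gibbs_cmult[of d V "-1" f] by simp

lemma gibbs_mono:
  assumes "tame d V" "polyb d f" "polyb d g" "\<And>x. f x \<le> g x"
  shows "gibbs d V f \<le> gibbs d V g"
  unfolding gibbs_def using assms Zf_pos[of d V]
  by (intro divide_right_mono integral_mono integrable_tame mult_right_mono) auto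

lemma integral_lebE_PiM:
  fixes f :: "(nat \<Rightarrow> real) \<Rightarrow> real"
  assumes f: "f \<in> borel_measurable Rsp"
  shows "(\<integral>x. f x \<partial>lebE d) = (\<integral>x. f (emb d x) \<partial>PiM {..<d} (\<lambda>_. lborel))"
  unfolding lebE_def by (rule integral_distr[OF measurable_emb_PiM(1) f])

section \<open>Truncation to cubes and the transport inequality\<close>

definition cube :: "nat \<Rightarrow> real \<Rightarrow> (nat \<Rightarrow> real) set" where
  "cube d R = {x. \<forall>i<d. \<bar>x i\<bar> \<le> R}"

lemma cube_sets[measurable]: "cube d R \<in> sets Rsp"
proof -
  have "{x \<in> space Rsp. \<forall>i\<in>{..<d}. \<bar>x i\<bar> \<le> R} \<in> sets Rsp"
  proof (rule sets.sets_Collect_finite_All)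
    fix i assume "i \<in> {..<d}"
    show "{x \<in> space Rsp. \<bar>x i\<bar> \<le> R} \<in> sets Rsp"
      by (rule borel_measurable_le) (auto intro!: borel_measurable_abs measurable_Rsp_component)
  qed simp
  then show ?thesis by (simp add: cube_def Ball_def)
qed

text \<open>Cutting all three functions off at the same cube preserves the hypothesis because a cube
  is convex; it supplies the bounded support under which the inequality was proved.\<close>

lemma prekopa_leindler_lebE:
  assumes t: "0 < t" "t < 1"
    and m: "F \<in> borel_measurable Rsp" "G \<in> borel_measurable Rsp" "H \<in> borel_measurable Rsp"
    and F: "\<And>x. 0 \<le> F x" "\<And>x. x \<in> cube d R \<Longrightarrow> F x \<le> c"
    and G: "\<And>x. 0 \<le> G x" "\<And>x. x \<in> cube d R \<Longrightarrow> G x \<le> c"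
    and H: "\<And>x. 0 \<le> H x" "\<And>x. x \<in> cube d R \<Longrightarrow> H x \<le> c"
    and ineq: "\<And>x y. F x powr t * G y powr (1 - t) \<le> H (\<lambda>i. t * x i + (1 - t) * y i)"
  shows "(\<integral>x. indicator (cube d R) x * F x \<partial>lebE d) powr t * (\<integral>x. indicator (cube d R) x * G x \<partial>lebE d) powr (1 - t)
       \<le> (\<integral>x. indicator (cube d R) x * H x \<partial>lebE d)"
proof -
  let ?r = "\<lambda>F x. indicator (cube d R) (emb d x) * F (emb d x) :: real"
  have emb_cube: "emb d x \<in> cube d R \<longleftrightarrow> (\<forall>i<d. \<bar>x i\<bar> \<le> R)" for x by (auto simp: cube_def emb_def)
  have m': "(\<lambda>x. indicator (cube d R) x * F x :: real) \<in> borel_measurable Rsp" if "F \<in> borel_measurable Rsp" for F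
    using that by measurable
  have bs: "box_supp {..<d} \<bar>c\<bar> R (?r F)"
    if "F \<in> borel_measurable Rsp" "\<And>x. 0 \<le> F x" "\<And>x. x \<in> cube d R \<Longrightarrow> F x \<le> c" for F
    unfolding box_supp_def
  proof (intro conjI allI impI)
    show "?r F \<in> borel_measurable (PiM {..<d} (\<lambda>_. lborel))"
      using measurable_compose[OF measurable_emb_PiM(1) m'[OF that(1)]] .
    fix x
    show "0 \<le> ?r F x" using that(2) by simp
    show "?r F x \<le> \<bar>c\<bar>" using that(3)[of "emb d x"] by (auto simp: indicator_def)
    show "\<exists>i\<in>{..<d}. \<bar>x i\<bar> > R \<Longrightarrow> ?r F x = 0" by (auto simp: emb_cube indicator_def not_le[symmetric])
  qed
  have "(\<integral>x. ?r F x \<partial>PiM {..<d} (\<lambda>_. lborel)) powr t * (\<integral>x. ?r G x \<partial>PiM {..<d} (\<lambda>_. lborel)) powr (1 - t)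
      \<le> (\<integral>x. ?r H x \<partial>PiM {..<d} (\<lambda>_. lborel))"
  proof (rule prekopa_leindler[OF t finite_lessThan bs[OF m(1) F] bs[OF m(2) G] bs[OF m(3) H]])
    fix x y :: "nat \<Rightarrow> real"
    let ?z = "\<lambda>i. t * x i + (1 - t) * y i"
    show "?r F x powr t * ?r G y powr (1 - t) \<le> ?r H ?z"
    proof (cases "emb d x \<in> cube d R \<and> emb d y \<in> cube d R")
      case True
      have "\<bar>t * x i + (1 - t) * y i\<bar> \<le> R" if "i < d" for i
      proof -
        have "\<bar>t * x i + (1 - t) * y i\<bar> \<le> \<bar>t * x i\<bar> + \<bar>(1 - t) * y i\<bar>" by (rule abs_triangle_ineq)
        also have "\<dots> \<le> t * R + (1 - t) * R"
          unfolding abs_mult using True that t by (intro add_mono mult_mono) (auto simp: emb_cube)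
        finally show ?thesis by (simp add: algebra_simps)
      qed
      then have "emb d ?z \<in> cube d R" by (simp add: emb_cube)
      moreover have "emb d ?z = (\<lambda>i. t * emb d x i + (1 - t) * emb d y i)" by (auto simp: emb_def)
      ultimately show ?thesis using True ineq[of "emb d x" "emb d y"] by simp
    next
      case False
      then have "?r F x powr t * ?r G y powr (1 - t) = 0" by (auto simp: indicator_def)
      moreover have "0 \<le> ?r H ?z" using H(1) by simp
      ultimately show ?thesis by linarith
    qed
  qed
  then show ?thesis using m by (simp add: integral_lebE_PiM m')
qed

lemma cube_vnorm: "x \<in> cube d R \<Longrightarrow> vnorm d x \<le> sqrt (real d * R\<^sup>2)"
proof -
  assume x: "x \<in> cube d R"
  have "(x i)\<^sup>2 \<le> R\<^sup>2" if "i < d" for i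
  proof -
    have "\<bar>x i\<bar> \<le> R" using x that by (auto simp: cube_def)
    then have "\<bar>x i\<bar>\<^sup>2 \<le> R\<^sup>2" by (intro power_mono) auto
    then show ?thesis by simp
  qed
  then have "(\<Sum>i<d. (x i)\<^sup>2) \<le> (\<Sum>i<d. R\<^sup>2)" by (intro sum_mono) auto
  then show ?thesis by (simp add: vnorm_def)
qed

lemma polyb_cube_bound:
  assumes f: "polyb d f" shows "\<exists>c. \<forall>x\<in>cube d R. \<bar>f x\<bar> \<le> c"
proof -
  obtain C k where C: "C \<ge> 0" "\<And>x. \<bar>f x\<bar> \<le> C * (1 + vnorm d x) ^ k" using polybE[OF f] by blast
  have "\<bar>f x\<bar> \<le> C * (1 + sqrt (real d * R\<^sup>2)) ^ k" if "x \<in> cube d R" for x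
    by (rule order_trans[OF C(2)]) (intro mult_left_mono power_mono add_left_mono cube_vnorm that C(1), auto)
  then show ?thesis by blast
qed

lemma tendsto_cube_integral:
  fixes f :: "(nat \<Rightarrow> real) \<Rightarrow> real"
  assumes f: "integrable (lebE d) f"
  shows "(\<lambda>n. \<integral>x. indicator (cube d (real n)) x * f x \<partial>lebE d) \<longlonglongrightarrow> (\<integral>x. f x \<partial>lebE d)"
proof (rule integral_dominated_convergence[where w="\<lambda>x. norm (f x)"])
  show "f \<in> borel_measurable (lebE d)" using f by auto
  then show "(\<lambda>x. indicator (cube d (real n)) x * f x) \<in> borel_measurable (lebE d)" for n by measurable
  show "integrable (lebE d) (\<lambda>x. norm (f x))" using f by simp
  show "AE x in lebE d. norm (indicator (cube d (real n)) x * f x) \<le> norm (f x)" for n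
    by (rule AE_I2) (simp add: indicator_def)
  show "AE x in lebE d. (\<lambda>n. indicator (cube d (real n)) x * f x) \<longlonglongrightarrow> f x"
  proof (rule AE_I2)
    fix x
    obtain N :: nat where N: "vnorm d x \<le> real N" using real_arch_simple by blast
    have "indicator (cube d (real n)) x * f x = f x" if "n \<ge> N" for n
    proof -
      have "vnorm d x \<le> real n" using N that by linarith
      then have "x \<in> cube d (real n)" by (auto simp: cube_def intro: order_trans[OF vnorm_component])
      then show ?thesis by simp
    qed
    then show "(\<lambda>n. indicator (cube d (real n)) x * f x) \<longlonglongrightarrow> f x"
      by (intro tendsto_eventually) (auto simp: eventually_sequentially)
  qed
qed

text \<open>The dual form of Talagrand's transport inequality. Weights \<open>1 - e\<close> and \<open>e\<close> in the
  Prekopa--Leindler inequality, linearisation of the exponentials, then \<open>e\<close> to zero.\<close>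

lemma transport_inequality_eps:
  assumes V: "tame d V" "sconv d m V" and V': "tame d V'"
    and A: "polyb d A" and B: "polyb d B"
    and cost: "\<And>x y. A x - B y \<le> m / 2 * (vnorm d (\<lambda>i. x i - y i))\<^sup>2"
    and e: "0 < e" "e < 1"
  shows "(1 - e) * (gibbs d V A - gibbs d V' B) \<le> gibbs d V' (\<lambda>x. V x - V' x) + ln (Zf d V) - ln (Zf d V')"
proof -
  define a where "a = gibbs d V A"
  \<comment> \<open>\<open>X\<close> is the exponent of \<open>G\<close> below, measured relative to
    \<open>- V'\<close>; it brings the second measure into play. Subtracting the mean
    \<open>a\<close> of \<open>A\<close> makes the first-order term of \<open>F\<close> vanish on
    average.\<close>
  define X where "X = (\<lambda>x. - (1 - e) * (B x - a) - (V x - V' x))"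
  have pV: "polyb d V" "polyb d V'" using V V' by (auto simp: tame_def)
  have X: "polyb d X" unfolding X_def using A B pV by (intro polyb_diff polyb_cmult polyb_const)
  define \<kappa> where "\<kappa> = gibbs d V' X"
  have k: "\<kappa> = - (1 - e) * (gibbs d V' B - a) - gibbs d V' (\<lambda>x. V x - V' x)"
    unfolding \<kappa>_def X_def
    by (subst gibbs_diff[OF V'], (intro polyb_cmult polyb_diff polyb_const B pV)+, subst gibbs_cmult, subst gibbs_diff[OF V' B polyb_const])
       (simp add: gibbs_const[OF V'])
  define F where "F = (\<lambda>x. exp (e * (A x - a) - V x))"
  define G where "G = (\<lambda>x. exp (- (1 - e) * (B x - a) - V x))"
  define H where "H = (\<lambda>x. exp (- V x))"
  have mm[measurable]: "A \<in> borel_measurable Rsp" "B \<in> borel_measurable Rsp" "V \<in> borel_measurable Rsp" "V' \<in> borel_measurable Rsp"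
    using A B pV by (auto simp: polyb_def)
  \<comment> \<open>\<open>f\<close> and \<open>g\<close> are the tangent lower bounds of
    \<open>F\<close> and \<open>G\<close>, taken at 0 and at the mean \<open>\<kappa>\<close> of
    \<open>X\<close>. Unlike \<open>F\<close> and \<open>G\<close>, whose exponents may grow like
    any polynomial, they are integrable, with integrals \<open>Zf d V\<close> and
    \<open>exp \<kappa> * Zf d V'\<close>. The inequality is therefore applied on cubes, and the
    limit is taken for \<open>f\<close> and \<open>g\<close> only.\<close>
  define f where "f = (\<lambda>x. (1 + e * (A x - a)) * exp (- V x))"
  define g where "g = (\<lambda>x. exp \<kappa> * (1 + X x - \<kappa>) * exp (- V' x))"
  have fi: "integrable (lebE d) f" unfolding f_def by (rule integrable_tame[OF _ V(1)]) (intro polyb_add polyb_cmult polyb_diff A polyb_const)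
  have gi: "integrable (lebE d) g" unfolding g_def by (rule integrable_tame[OF _ V']) (intro polyb_add polyb_cmult polyb_diff X polyb_const)
  have fint: "(\<integral>x. f x \<partial>lebE d) = Zf d V"
  proof -
    have "gibbs d V (\<lambda>x. 1 + e * (A x - a)) = 1"
      by (subst gibbs_add[OF V(1)], simp, (intro polyb_cmult polyb_diff A polyb_const), subst gibbs_cmult, subst gibbs_diff[OF V(1) A polyb_const])
         (simp add: gibbs_const[OF V(1)] a_def)
    then show ?thesis using Zf_pos[OF V(1)] by (simp add: gibbs_def f_def field_simps)
  qed
  have gint: "(\<integral>x. g x \<partial>lebE d) = exp \<kappa> * Zf d V'"
  proof -
    have "gibbs d V' (\<lambda>x. exp \<kappa> * (1 + X x - \<kappa>)) = exp \<kappa>"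
      by (subst gibbs_cmult, subst gibbs_diff[OF V'], (intro polyb_add X polyb_const), simp, subst gibbs_add[OF V' polyb_const X])
         (simp add: gibbs_const[OF V'] \<kappa>_def)
    then show ?thesis using Zf_pos[OF V'] by (simp add: gibbs_def g_def field_simps)
  qed
  let ?I = "\<lambda>F n. \<integral>x. indicator (cube d (real n)) x * F x \<partial>lebE d"
  have lim: "?I f \<longlonglongrightarrow> Zf d V" "?I g \<longlonglongrightarrow> exp \<kappa> * Zf d V'"
    using tendsto_cube_integral[OF fi] tendsto_cube_integral[OF gi] by (auto simp: fint gint)
  have boxb: "\<exists>c. \<forall>x\<in>cube d R. exp (p x) \<le> c" if p: "polyb d p" for p R
  proof -
    obtain c where "\<forall>x\<in>cube d R. \<bar>p x\<bar> \<le> c" using polyb_cube_bound[OF p] by blast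
    then have "\<forall>x\<in>cube d R. exp (p x) \<le> exp c" by (auto simp: abs_le_iff)
    then show ?thesis by blast
  qed
  have Fp: "polyb d (\<lambda>x. e * (A x - a) - V x)" "polyb d (\<lambda>x. - (1 - e) * (B x - a) - V x)" "polyb d (\<lambda>x. - V x)"
    by (intro polyb_diff polyb_cmult polyb_const polyb_minus A B pV)+
  \<comment> \<open>On a cube both \<open>p\<close> and \<open>V\<close> are bounded, so a multiple
    of exp (- V) dominates.\<close>
  have ibound: "integrable (lebE d) (\<lambda>x. indicator (cube d (real n)) x * exp (p x))" if p: "polyb d p" for p n
  proof -
    obtain c where c: "\<forall>x\<in>cube d (real n). exp (p x) \<le> c" using boxb[OF p] by blast
    obtain c2 where c2: "\<forall>x\<in>cube d (real n). \<bar>V x\<bar> \<le> c2" using polyb_cube_bound[OF pV(1)] by blast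
    show ?thesis
    proof (rule Bochner_Integration.integrable_bound)
      show "integrable (lebE d) (\<lambda>x. c * exp c2 * exp (- V x))"
        using integrable_exp_tame[OF V(1)] by simp
      show "(\<lambda>x. indicator (cube d (real n)) x * exp (p x)) \<in> borel_measurable (lebE d)"
        using p by measurable
      show "AE x in lebE d. norm (indicator (cube d (real n)) x * exp (p x)) \<le> norm (c * exp c2 * exp (- V x))"
      proof (rule AE_I2)
        fix x
        show "norm (indicator (cube d (real n)) x * exp (p x)) \<le> norm (c * exp c2 * exp (- V x))"
        proof (cases "x \<in> cube d (real n)")
          case True
          then have 1: "exp (p x) \<le> c" and 2: "0 \<le> c2 - V x" using c c2 by (auto simp: abs_le_iff)
          have c0: "0 \<le> c" using 1 order_trans[OF exp_ge_zero] by blast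
          have "exp (p x) * 1 \<le> c * exp (c2 - V x)" using 1 2 by (intro mult_mono) (auto simp: order_trans[OF exp_ge_zero 1])
          then show ?thesis using True c0 by (simp add: abs_mult exp_diff exp_minus divide_inverse mult.assoc)
        qed simp
      qed
    qed
  qed
  have "eventually (\<lambda>n. (?I f n) powr (1 - e) * (?I g n) powr e \<le> Zf d V) sequentially"
  proof -
    have "eventually (\<lambda>n. ?I f n > 0) sequentially" "eventually (\<lambda>n. ?I g n > 0) sequentially"
      using order_tendstoD(1)[OF lim(1)] order_tendstoD(1)[OF lim(2)] Zf_pos[OF V(1)] Zf_pos[OF V'] by auto
    then show ?thesis
    proof eventually_elim
      case (elim n)
      have "(?I f n) powr (1 - e) * (?I g n) powr e \<le> (?I F n) powr (1 - e) * (?I G n) powr e"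
      proof (intro mult_mono powr_mono2)
        show "?I f n \<le> ?I F n"
        proof (rule integral_mono)
          show "integrable (lebE d) (\<lambda>x. indicator (cube d (real n)) x * f x)"
            using integrable_mult_indicator[OF _ fi, of "cube d (real n)"] by simp
          show "integrable (lebE d) (\<lambda>x. indicator (cube d (real n)) x * F x)" unfolding F_def by (rule ibound[OF Fp(1)])
          fix x
          have "(1 + e * (A x - a)) * exp (- V x) \<le> exp (e * (A x - a)) * exp (- V x)"
            by (intro mult_right_mono) auto
          then have "f x \<le> F x" by (simp add: f_def F_def flip: exp_add)
          then show "indicator (cube d (real n)) x * f x \<le> indicator (cube d (real n)) x * F x" by (simp add: indicator_def)
        qed
        show "?I g n \<le> ?I G n"
        proof (rule integral_mono)
          show "integrable (lebE d) (\<lambda>x. indicator (cube d (real n)) x * g x)"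
            using integrable_mult_indicator[OF _ gi, of "cube d (real n)"] by simp
          show "integrable (lebE d) (\<lambda>x. indicator (cube d (real n)) x * G x)" unfolding G_def by (rule ibound[OF Fp(2)])
          fix x
          have "exp \<kappa> * (1 + X x - \<kappa>) * exp (- V' x) \<le> exp \<kappa> * exp (X x - \<kappa>) * exp (- V' x)"
            using exp_ge_add_one_self[of "X x - \<kappa>"]
            by (intro mult_right_mono mult_left_mono) (auto simp: algebra_simps simp del: exp_ge_add_one_self)
          also have "\<dots> = exp (X x - V' x)" by (simp flip: exp_add)
          also have "X x - V' x = - (1 - e) * (B x - a) - V x" by (simp add: X_def)
          finally have "g x \<le> G x" by (simp add: g_def G_def)
          then show "indicator (cube d (real n)) x * g x \<le> indicator (cube d (real n)) x * G x" by (simp add: indicator_def)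
        qed
      qed (use elim e in auto)
      also have "\<dots> \<le> ?I H n"
      proof -
        obtain c1 where c1: "\<forall>x\<in>cube d (real n). F x \<le> c1" using boxb[OF Fp(1)] unfolding F_def by blast
        obtain c2 where c2: "\<forall>x\<in>cube d (real n). G x \<le> c2" using boxb[OF Fp(2)] unfolding G_def by blast
        obtain c3 where c3: "\<forall>x\<in>cube d (real n). H x \<le> c3" using boxb[OF Fp(3)] unfolding H_def by blast
        have "(?I F n) powr (1 - e) * (?I G n) powr (1 - (1 - e)) \<le> ?I H n"
        proof (rule prekopa_leindler_lebE[where c="max c1 (max c2 c3)"])
          show "F \<in> borel_measurable Rsp" "G \<in> borel_measurable Rsp" "H \<in> borel_measurable Rsp"
            unfolding F_def G_def H_def by measurable
          fix x y
          have s: "V (\<lambda>i. (1 - e) * x i + (1 - (1 - e)) * y i) \<le> (1 - e) * V x + (1 - (1 - e)) * V y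
              - m * (1 - e) * (1 - (1 - e)) / 2 * (vnorm d (\<lambda>i. x i - y i))\<^sup>2"
            using V(2)[unfolded sconv_def, rule_format, of "1 - e" x y] e by simp
          have c: "(1 - e) * e * (A x - B y) \<le> (1 - e) * e * (m / 2 * (vnorm d (\<lambda>i. x i - y i))\<^sup>2)"
            using e by (intro mult_left_mono cost) auto
          have pw: "exp p powr q = exp (q * p)" for p q :: real by (simp add: exp_powr_real mult.commute)
          have "F x powr (1 - e) * G y powr (1 - (1 - e))
             = exp ((1 - e) * (e * (A x - a) - V x) + e * (- (1 - e) * (B y - a) - V y))"
            unfolding F_def G_def pw exp_add by simp
          also have "\<dots> \<le> H (\<lambda>i. (1 - e) * x i + (1 - (1 - e)) * y i)"
          proof -
            have "(1 - e) * (e * (A x - a) - V x) + e * (- (1 - e) * (B y - a) - V y)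
                = (1 - e) * e * (A x - B y) - ((1 - e) * V x + (1 - (1 - e)) * V y)"
              by (simp add: algebra_simps)
            moreover have "(1 - e) * e * (m / 2 * (vnorm d (\<lambda>i. x i - y i))\<^sup>2)
                = m * (1 - e) * (1 - (1 - e)) / 2 * (vnorm d (\<lambda>i. x i - y i))\<^sup>2" by simp
            ultimately show ?thesis unfolding H_def exp_le_cancel_iff using s c by linarith
          qed
          finally show "F x powr (1 - e) * G y powr (1 - (1 - e)) \<le> H (\<lambda>i. (1 - e) * x i + (1 - (1 - e)) * y i)" .
        qed (use e c1 c2 c3 in \<open>auto simp: F_def G_def H_def le_max_iff_disj\<close>)
        then show ?thesis by simp
      qed
      also have "\<dots> \<le> Zf d V"
        unfolding Zf_def H_def
      proof (rule integral_mono[OF ibound[OF Fp(3)] integrable_exp_tame[OF V(1)]])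
        fix x show "indicator (cube d (real n)) x * exp (- V x) \<le> exp (- V x)" by (simp add: indicator_def)
      qed
      finally show ?case .
    qed
  qed
  moreover have "(\<lambda>n. (?I f n) powr (1 - e) * (?I g n) powr e) \<longlonglongrightarrow> Zf d V powr (1 - e) * (exp \<kappa> * Zf d V') powr e"
    using Zf_pos[OF V(1)] Zf_pos[OF V'] by (intro tendsto_mult tendsto_powr lim tendsto_const) auto
  ultimately have "Zf d V powr (1 - e) * (exp \<kappa> * Zf d V') powr e \<le> Zf d V"
    by (intro tendsto_upperbound) auto
  then have "ln (Zf d V powr (1 - e) * (exp \<kappa> * Zf d V') powr e) \<le> ln (Zf d V)"
    using Zf_pos[OF V(1)] Zf_pos[OF V'] by simp
  then have "(1 - e) * ln (Zf d V) + e * (\<kappa> + ln (Zf d V')) \<le> ln (Zf d V)"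
    using Zf_pos[OF V(1)] Zf_pos[OF V'] by (simp add: ln_mult ln_powr)
  then have "e * (\<kappa> + ln (Zf d V')) \<le> e * ln (Zf d V)" by (simp add: algebra_simps)
  then have "\<kappa> + ln (Zf d V') \<le> ln (Zf d V)" using e by simp
  then show ?thesis unfolding k a_def by (simp add: algebra_simps)
qed

text \<open>Relative entropy of the Gibbs law of \<open>V'\<close> with respect to that of
  \<open>V\<close>: the integral of the logarithm of the density ratio under the first
  argument.\<close>

definition relent :: "nat \<Rightarrow> ((nat \<Rightarrow> real) \<Rightarrow> real) \<Rightarrow> ((nat \<Rightarrow> real) \<Rightarrow> real) \<Rightarrow> real" where
  "relent d V' V = gibbs d V' (\<lambda>x. V x - V' x) + ln (Zf d V) - ln (Zf d V')"

lemma transport_inequality: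
  assumes V: "tame d V" "sconv d m V" and V': "tame d V'"
    and A: "polyb d A" and B: "polyb d B"
    and cost: "\<And>x y. A x - B y \<le> m / 2 * (vnorm d (\<lambda>i. x i - y i))\<^sup>2"
  shows "gibbs d V A - gibbs d V' B \<le> relent d V' V"
proof -
  have "eventually (\<lambda>e. (1 - e) * (gibbs d V A - gibbs d V' B) \<le> relent d V' V) (at_right (0::real))"
    unfolding eventually_at_right_field relent_def
    by (intro exI[of _ 1]) (auto intro!: transport_inequality_eps assms)
  moreover have "((\<lambda>e. (1 - e) * (gibbs d V A - gibbs d V' B)) \<longlongrightarrow> (1 - 0) * (gibbs d V A - gibbs d V' B)) (at_right 0)"
    by (intro tendsto_intros)
  ultimately have "(1 - 0) * (gibbs d V A - gibbs d V' B) \<le> relent d V' V"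
    by (intro tendsto_upperbound[where F="at_right 0"]) auto
  then show ?thesis by simp
qed

text \<open>Unlike \<open>lip1\<close>, this constrains all sequences. Since \<open>vnorm d\<close>
  ignores the tail, such a function depends on the first \<open>d\<close> coordinates only.\<close>

definition lip :: "nat \<Rightarrow> ((nat \<Rightarrow> real) \<Rightarrow> real) \<Rightarrow> bool" where
  "lip d h \<longleftrightarrow> (\<forall>x y. \<bar>h x - h y\<bar> \<le> vnorm d (\<lambda>i. x i - y i))"

lemma lip_polyb: "lip d h \<Longrightarrow> polyb d h"
  using polyb_lipschitz[of h 1 d] by (simp add: lip_def)

text \<open>The pair A = l h, B = l h + l^2 / (2 m) satisfies the cost condition because l r <= l^2
  / (2 m) + m r^2 / 2. The resulting bound l D - l^2 / (2 m) is largest at l = m D.\<close>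

lemma transport_entropy_lip:
  assumes V: "tame d V" "sconv d m V" and m: "m > 0" and V': "tame d V'" and h: "lip d h"
  shows "m / 2 * (gibbs d V h - gibbs d V' h)\<^sup>2 \<le> relent d V' V"
proof -
  define D where "D = gibbs d V h - gibbs d V' h"
  define l where "l = m * D"
  have ph: "polyb d h" by (rule lip_polyb[OF h])
  have "gibbs d V (\<lambda>x. l * h x) - gibbs d V' (\<lambda>x. l * h x + l\<^sup>2 / (2 * m)) \<le> relent d V' V"
  proof (rule transport_inequality[OF V V'])
    show "polyb d (\<lambda>x. l * h x)" "polyb d (\<lambda>x. l * h x + l\<^sup>2 / (2 * m))" using ph by (auto intro!: polyb_add)
    fix x y
    define r where "r = vnorm d (\<lambda>i. x i - y i)"
    have "l * h x - l * h y \<le> \<bar>l\<bar> * r"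
    proof -
      have "l * h x - l * h y \<le> \<bar>l * (h x - h y)\<bar>" by (simp add: right_diff_distrib)
      also have "\<dots> \<le> \<bar>l\<bar> * r" unfolding abs_mult r_def using h by (intro mult_left_mono) (auto simp: lip_def)
      finally show ?thesis .
    qed
    moreover have "0 \<le> (\<bar>l\<bar> - m * r)\<^sup>2 / (2 * m)" using m by simp
    moreover have "(\<bar>l\<bar> - m * r)\<^sup>2 / (2 * m) = l\<^sup>2 / (2 * m) + m / 2 * r\<^sup>2 - \<bar>l\<bar> * r"
      using m by (simp add: power2_eq_square field_simps)
    ultimately show "l * h x - (l * h y + l\<^sup>2 / (2 * m)) \<le> m / 2 * (vnorm d (\<lambda>i. x i - y i))\<^sup>2"
      by (simp add: r_def)
  qed
  also have "gibbs d V' (\<lambda>x. l * h x + l\<^sup>2 / (2 * m)) = l * gibbs d V' h + l\<^sup>2 / (2 * m)"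
    using ph by (subst gibbs_add[OF V']) (auto simp: gibbs_cmult gibbs_const[OF V'])
  finally have "l * D - l\<^sup>2 / (2 * m) \<le> relent d V' V" by (simp add: gibbs_cmult D_def algebra_simps)
  moreover have "l * D - l\<^sup>2 / (2 * m) = m / 2 * D\<^sup>2" using m by (simp add: l_def power2_eq_square field_simps)
  ultimately show ?thesis by (simp add: D_def)
qed

text \<open>The logarithms of the normalising constants cancel, leaving a difference of averages of
  V - V'. Nothing then has to be known about the constants.\<close>

lemma relent_sum:
  assumes "tame d V" "tame d V'"
  shows "relent d V' V + relent d V V' = gibbs d V' (\<lambda>x. V x - V' x) - gibbs d V (\<lambda>x. V x - V' x)"
proof -
  have "gibbs d V (\<lambda>x. V' x - V x) = - gibbs d V (\<lambda>x. V x - V' x)" by (subst gibbs_minus[symmetric]) simp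
  then show ?thesis by (simp add: relent_def)
qed

text \<open>Symmetrised relative entropy makes the contraction constant sharp.\<close>

lemma gibbs_tilt_lipschitz:
  assumes V: "tame d V" "sconv d m V" and V': "tame d V'" "sconv d m V'" and m: "m > 0"
    and L: "L \<ge> 0" "\<And>x y. \<bar>(V x - V' x) - (V y - V' y)\<bar> \<le> L * vnorm d (\<lambda>i. x i - y i)"
    and h: "lip d h"
  shows "\<bar>gibbs d V h - gibbs d V' h\<bar> \<le> L / m"
proof -
  have dev: "m * (gibbs d V h - gibbs d V' h)\<^sup>2 \<le> gibbs d V' (\<lambda>x. V x - V' x) - gibbs d V (\<lambda>x. V x - V' x)" if h: "lip d h" for h
  proof -
    have "m / 2 * (gibbs d V h - gibbs d V' h)\<^sup>2 \<le> relent d V' V" by (rule transport_entropy_lip[OF V m V'(1) h])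
    moreover have "m / 2 * (gibbs d V' h - gibbs d V h)\<^sup>2 \<le> relent d V V'" by (rule transport_entropy_lip[OF V' m V(1) h])
    ultimately show ?thesis using relent_sum[OF V(1) V'(1)] by (simp add: power2_commute)
  qed
  define F where "F = (\<lambda>x. V x - V' x)"
  define D where "D = \<bar>gibbs d V F - gibbs d V' F\<bar>"
  \<comment> \<open>Self-bounding: for the test function F / L the inequality \<open>dev\<close> has
    \<open>D\<close> on both sides, m D^2 <= L^2 D.\<close>
  have D: "D \<le> L\<^sup>2 / m"
  proof (cases "L = 0")
    case True
    then have F0: "F x = F (\<lambda>_. 0)" for x using L(2)[of x "\<lambda>_. 0"] by (simp add: F_def)
    have "F = (\<lambda>x. F (\<lambda>_. 0))" using F0 by (rule ext)
    then have "gibbs d V F = gibbs d V' F" using gibbs_const[OF V(1)] gibbs_const[OF V'(1)] by metis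
    then show ?thesis using True m by (simp add: D_def)
  next
    case False
    then have Lp: "L > 0" using L(1) by simp
    have "lip d (\<lambda>x. (1 / L) * F x)"
      unfolding lip_def
    proof (intro allI)
      fix x y
      have "\<bar>(1 / L) * F x - (1 / L) * F y\<bar> = (1 / L) * \<bar>F x - F y\<bar>"
        by (subst right_diff_distrib[symmetric]) (use Lp in \<open>simp add: abs_mult\<close>)
      also have "\<dots> \<le> (1 / L) * (L * vnorm d (\<lambda>i. x i - y i))"
        unfolding F_def using Lp by (intro mult_left_mono L(2)) auto
      finally show "\<bar>(1 / L) * F x - (1 / L) * F y\<bar> \<le> vnorm d (\<lambda>i. x i - y i)" using Lp by simp
    qed
    from dev[OF this] have "m * ((1 / L) * (gibbs d V F - gibbs d V' F))\<^sup>2 \<le> gibbs d V' F - gibbs d V F"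
      by (simp only: gibbs_cmult right_diff_distrib[symmetric] F_def[symmetric])
    also have "\<dots> \<le> D" by (simp add: D_def)
    finally have *: "m * ((1 / L) * (gibbs d V F - gibbs d V' F))\<^sup>2 \<le> D" .
    have "m * (D * D) = L\<^sup>2 * (m * ((1 / L) * (gibbs d V F - gibbs d V' F))\<^sup>2)"
      using Lp by (simp add: power_mult_distrib D_def power_divide flip: power2_eq_square)
    also have "\<dots> \<le> L\<^sup>2 * D" by (intro mult_left_mono *) simp
    finally have "D * (m * D) \<le> D * L\<^sup>2" by (simp add: mult_ac)
    moreover have "D \<ge> 0" by (simp add: D_def)
    ultimately have "m * D \<le> L\<^sup>2 \<or> D = 0" by (auto simp: mult_le_cancel_left)
    then show ?thesis using m by (auto simp: field_simps)
  qed
  have "m * (gibbs d V h - gibbs d V' h)\<^sup>2 \<le> gibbs d V' F - gibbs d V F" using dev[OF h] by (simp add: F_def)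
  also have "\<dots> \<le> D" by (simp add: D_def)
  also note D
  finally have "m * (gibbs d V h - gibbs d V' h)\<^sup>2 \<le> L\<^sup>2 / m" .
  moreover have "q \<le> (L / m)\<^sup>2" if "m * q \<le> L\<^sup>2 / m" for q
    using that m by (simp add: field_simps power2_eq_square)
  ultimately have "(gibbs d V h - gibbs d V' h)\<^sup>2 \<le> (L / m)\<^sup>2" by blast
  then show ?thesis using abs_le_square_iff[of "gibbs d V h - gibbs d V' h" "L / m"] L(1) m by simp
qed

text \<open>Convexity of \<open>F = V - V'\<close> makes \<open>A = - F\<close>, \<open>B = - F + |G|^2 / (2 m)\<close> an admissible pair in the
  transport inequality.\<close>

lemma gibbs_convex_perturbation:
  assumes V: "tame d V" "sconv d m V" and V': "tame d V'" "sconv d m V'" and m: "m > 0"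
    and G: "polyb d (\<lambda>x. (vnorm d (G x))\<^sup>2)"
    and convex: "\<And>x y. V x - V' x \<ge> V y - V' y + vinner d (G y) (\<lambda>i. x i - y i)"
    and h: "lip d h"
  shows "(gibbs d V' h - gibbs d V h)\<^sup>2 \<le> gibbs d V' (\<lambda>x. (vnorm d (G x))\<^sup>2) / m\<^sup>2"
proof -
  define F where "F = (\<lambda>x. V x - V' x)"
  have pF: "polyb d F" unfolding F_def using V V' by (auto simp: tame_def)
  have "gibbs d V (\<lambda>x. - F x) - gibbs d V' (\<lambda>x. - F x + 1 / (2 * m) * (vnorm d (G x))\<^sup>2) \<le> relent d V' V"
  proof (rule transport_inequality[OF V V'(1)])
    show "polyb d (\<lambda>x. - F x)" by (rule polyb_minus[OF pF])
    show "polyb d (\<lambda>x. - F x + 1 / (2 * m) * (vnorm d (G x))\<^sup>2)"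
      by (rule polyb_add[OF polyb_minus[OF pF] polyb_cmult[OF G]])
    fix x y
    define r where "r = vnorm d (\<lambda>i. x i - y i)"
    define q where "q = vnorm d (G y)"
    have "- vinner d (G y) (\<lambda>i. x i - y i) \<le> q * r"
      using vinner_abs_le[of d "G y" "\<lambda>i. x i - y i"] by (simp add: q_def r_def)
    moreover have "F x \<ge> F y + vinner d (G y) (\<lambda>i. x i - y i)" using convex[of y x] by (simp add: F_def)
    moreover have "0 \<le> (q - m * r)\<^sup>2 / (2 * m)" using m by simp
    moreover have "(q - m * r)\<^sup>2 / (2 * m) = 1 / (2 * m) * q\<^sup>2 + m / 2 * r\<^sup>2 - q * r"
      using m by (simp add: power2_eq_square field_simps)
    ultimately show "- F x - (- F y + 1 / (2 * m) * (vnorm d (G y))\<^sup>2) \<le> m / 2 * (vnorm d (\<lambda>i. x i - y i))\<^sup>2"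
      by (simp add: q_def r_def)
  qed
  moreover have "gibbs d V' (\<lambda>x. - F x + 1 / (2 * m) * (vnorm d (G x))\<^sup>2)
      = - gibbs d V' F + 1 / (2 * m) * gibbs d V' (\<lambda>x. (vnorm d (G x))\<^sup>2)"
    unfolding gibbs_add[OF V'(1) polyb_minus[OF pF] polyb_cmult[OF G]] gibbs_minus gibbs_cmult ..
  moreover have "relent d V' V + relent d V V' = gibbs d V' F - gibbs d V F"
    using relent_sum[OF V(1) V'(1)] by (simp add: F_def)
  \<comment> \<open>The transport inequality bounds the other entropy from below by the difference
    of the averages of F minus the gradient term; the two entropies sum to that same difference, so
    only the gradient term is left. It is averaged under \<open>V'\<close>, which will be Gaussian,
    where moments are explicit.\<close>
  ultimately have "relent d V V' \<le> 1 / (2 * m) * gibbs d V' (\<lambda>x. (vnorm d (G x))\<^sup>2)"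
    by (simp add: gibbs_minus)
  moreover have "m / 2 * (gibbs d V' h - gibbs d V h)\<^sup>2 \<le> relent d V V'"
    by (rule transport_entropy_lip[OF V' m V(1) h])
  ultimately have "m / 2 * (gibbs d V' h - gibbs d V h)\<^sup>2 \<le> 1 / (2 * m) * gibbs d V' (\<lambda>x. (vnorm d (G x))\<^sup>2)"
    by linarith
  moreover have "D \<le> W / m\<^sup>2" if "m / 2 * D \<le> 1 / (2 * m) * W" for D W :: real
    using that m by (simp add: field_simps power2_eq_square)
  ultimately show ?thesis by blast
qed

subsection \<open>Gaussian potentials\<close>

text \<open>Potential of the normal law with mean \<open>a\<close>. Here \<open>s\<close> is the
  variance, whereas \<open>gdens\<close> takes the standard deviation.\<close>

definition quad :: "nat \<Rightarrow> real \<Rightarrow> (nat \<Rightarrow> real) \<Rightarrow> (nat \<Rightarrow> real) \<Rightarrow> real" where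
  "quad d s a z = (vnorm d (\<lambda>i. z i - a i))\<^sup>2 / (2 * s)"

lemma polyb_vinner: "polyb d (\<lambda>x. vinner d x a)" "polyb d (\<lambda>x. vinner d a x)"
proof -
  show "polyb d (\<lambda>x. vinner d x a)"
  proof (rule polyb_lipschitz[where L="vnorm d a"])
    fix x y
    have "\<bar>vinner d x a - vinner d y a\<bar> = \<bar>vinner d (\<lambda>i. x i - y i) a\<bar>" by (simp add: vinner_diff_left)
    also have "\<dots> \<le> vnorm d (\<lambda>i. x i - y i) * vnorm d a" by (rule vinner_abs_le)
    finally show "\<bar>vinner d x a - vinner d y a\<bar> \<le> vnorm d a * vnorm d (\<lambda>i. x i - y i)" by (simp add: mult.commute)
  qed
  then show "polyb d (\<lambda>x. vinner d a x)" by (simp add: vinner_commute)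
qed

lemma quad_expand: "quad d s a z = 1 / (2 * s) * ((vnorm d z)\<^sup>2 - 2 * vinner d z a + (vnorm d a)\<^sup>2)"
  by (simp add: quad_def vnorm_sq_diff)

lemma quad_emb[simp]: "quad d s a (emb d z) = quad d s a z" "quad d s (emb d a) z = quad d s a z"
  unfolding quad_def by (simp_all add: emb_def cong: vnorm_cong)

lemma polyb_quad: "polyb d (quad d s a)"
  unfolding quad_expand[abs_def]
  by (intro polyb_cmult polyb_add polyb_diff polyb_power polyb_vnorm polyb_const polyb_vinner)

lemma sconv_quad: 
  assumes s: "s > 0" shows "sconv d (1 / s) (quad d s a)"
  unfolding sconv_def
proof (intro allI impI)
  fix x y :: "nat \<Rightarrow> real" and t :: real
  have "(vnorm d (\<lambda>i. t * x i + (1 - t) * y i - a i))\<^sup>2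
     = t * (vnorm d (\<lambda>i. x i - a i))\<^sup>2 + (1 - t) * (vnorm d (\<lambda>i. y i - a i))\<^sup>2 - t * (1 - t) * (vnorm d (\<lambda>i. x i - y i))\<^sup>2"
    unfolding vnorm_sq sum_distrib_left sum.distrib[symmetric] sum_subtractf[symmetric]
    by (intro sum.cong refl) (simp add: power2_eq_square algebra_simps)
  then show "quad d s a (\<lambda>i. t * x i + (1 - t) * y i)
     \<le> t * quad d s a x + (1 - t) * quad d s a y - 1 / s * t * (1 - t) / 2 * (vnorm d (\<lambda>i. x i - y i))\<^sup>2"
    using s by (simp add: quad_def add_divide_distrib diff_divide_distrib)
qed

lemma tame_quad:
  assumes s: "s > 0" shows "tame d (quad d s a)"
  unfolding tame_def
proof (intro conjI allI polyb_quad)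
  have "quad d s a x \<ge> 1 / (4 * s) * (vnorm d x)\<^sup>2 - (vnorm d a)\<^sup>2 / (2 * s)" for x
  proof -
    have "0 \<le> (vnorm d (\<lambda>i. x i - 2 * a i))\<^sup>2" by simp
    also have "\<dots> = (vnorm d x)\<^sup>2 - 4 * vinner d x a + 4 * (vnorm d a)\<^sup>2"
      by (simp add: vnorm_sq_diff vinner_scale_right vnorm_scale power_mult_distrib)
    finally have "(vnorm d x)\<^sup>2 / 2 - (vnorm d a)\<^sup>2 \<le> (vnorm d x)\<^sup>2 - 2 * vinner d x a + (vnorm d a)\<^sup>2" by simp
    then have "1 / (2 * s) * ((vnorm d x)\<^sup>2 / 2 - (vnorm d a)\<^sup>2) \<le> quad d s a x"
      unfolding quad_expand using s by (intro mult_left_mono) auto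
    then show ?thesis by (simp add: right_diff_distrib)
  qed
  then show "\<exists>c>0. \<exists>C. \<forall>x. quad d s a x \<ge> c * (vnorm d x)\<^sup>2 - C"
    using s by (intro exI[of _ "1 / (4 * s)"] conjI exI[of _ "(vnorm d a)\<^sup>2 / (2 * s)"]) auto
qed simp

lemma measurable_affine_Rsp[measurable]: "(\<lambda>z i. a i + c * z i) \<in> measurable Rsp Rsp"
  by (rule measurable_into_Rsp) measurable

lemma distr_gaussE_affine:
  assumes c: "c > 0"
  shows "distr (gaussE d) Rsp (\<lambda>z. emb d (\<lambda>i. a i + c * z i)) = density (lebE d) (\<lambda>x. ennreal (gdens d c (\<lambda>i. x i - a i)))"
proof (rule measure_eqI)
  have m: "(\<lambda>z. emb d (\<lambda>i. a i + c * z i)) \<in> measurable (gaussE d) Rsp"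
    using measurable_compose[OF measurable_affine_Rsp measurable_emb] by simp
  fix A assume "A \<in> sets (distr (gaussE d) Rsp (\<lambda>z. emb d (\<lambda>i. a i + c * z i)))"
  then have A: "A \<in> sets Rsp" by simp
  then have A': "A \<in> sets (distr (gaussE d) Rsp (\<lambda>z. emb d (\<lambda>i. a i + c * z i)))" by simp
  have "emeasure (distr (gaussE d) Rsp (\<lambda>z. emb d (\<lambda>i. a i + c * z i))) A
      = (\<integral>\<^sup>+x. indicator A x \<partial>distr (gaussE d) Rsp (\<lambda>z. emb d (\<lambda>i. a i + c * z i)))"
    by (rule nn_integral_indicator[OF A', symmetric])
  also have "\<dots> = (\<integral>\<^sup>+z. indicator A (emb d (\<lambda>i. a i + c * z i)) \<partial>gaussE d)"
    by (rule nn_integral_distr[OF m]) (use A in simp)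
  also have "\<dots> = (\<integral>\<^sup>+x. indicator A x * ennreal (gdens d c (\<lambda>i. x i - a i)) \<partial>lebE d)"
    by (rule nn_integral_gaussE_affine[OF _ c]) (use A in simp)
  also have "\<dots> = emeasure (density (lebE d) (\<lambda>x. ennreal (gdens d c (\<lambda>i. x i - a i)))) A"
    using A by (subst emeasure_density) (auto simp: mult.commute intro!: measurable_gdens)
  finally show "emeasure (distr (gaussE d) Rsp (\<lambda>z. emb d (\<lambda>i. a i + c * z i))) A
    = emeasure (density (lebE d) (\<lambda>x. ennreal (gdens d c (\<lambda>i. x i - a i)))) A" .
qed simp

lemma gdens_quad:
  "s > 0 \<Longrightarrow> gdens d (sqrt s) (\<lambda>i. x i - a i) = (1 / sqrt (2 * pi * s)) ^ d * exp (- quad d s a x)"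
  by (simp add: gdens_def quad_def)

lemma Zf_quad:
  assumes s: "s > 0" shows "(1 / sqrt (2 * pi * s)) ^ d * Zf d (quad d s a) = 1"
proof -
  interpret prob_space "gaussE d" by (rule prob_space_gaussE)
  have k: "(1 / sqrt (2 * pi * s)) ^ d \<ge> 0" using s by simp
  have i: "integrable (lebE d) (\<lambda>x. exp (- quad d s a x))" by (rule integrable_exp_tame[OF tame_quad[OF s]])
  have "1 = (\<integral>\<^sup>+x. ennreal (gdens d (sqrt s) (\<lambda>i. x i - a i)) \<partial>lebE d)"
    using nn_integral_gaussE_affine[of "\<lambda>_. 1" "sqrt s" d a] s emeasure_space_1 by simp
  also have "\<dots> = (\<integral>\<^sup>+x. ennreal ((1 / sqrt (2 * pi * s)) ^ d * exp (- quad d s a x)) \<partial>lebE d)"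
    using s by (simp add: gdens_quad)
  also have "\<dots> = ennreal (\<integral>x. (1 / sqrt (2 * pi * s)) ^ d * exp (- quad d s a x) \<partial>lebE d)"
    using k i by (intro nn_integral_eq_integral) auto
  also have "(\<integral>x. (1 / sqrt (2 * pi * s)) ^ d * exp (- quad d s a x) \<partial>lebE d) = (1 / sqrt (2 * pi * s)) ^ d * Zf d (quad d s a)"
    by (simp add: Zf_def)
  finally show ?thesis using k Zf_pos[OF tame_quad[OF s], of d a]
    by (simp add: one_ennreal_def[symmetric] flip: ennreal_1)
qed

text \<open>Turns a Gibbs average with quadratic potential into an expectation over standard noise,
  so that the inequalities for potentials apply to Euler steps.\<close>

lemma gibbs_quad:
  assumes s: "s > 0" and f: "polyb d f" and fe: "\<And>x. f (emb d x) = f x"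
  shows "integrable (gaussE d) (\<lambda>z. f (\<lambda>i. a i + sqrt s * z i))"
    and "gibbs d (quad d s a) f = (\<integral>z. f (\<lambda>i. a i + sqrt s * z i) \<partial>gaussE d)"
proof -
  let ?T = "\<lambda>z. emb d (\<lambda>i. a i + sqrt s * z i)"
  let ?k = "(1 / sqrt (2 * pi * s)) ^ d"
  have k: "?k > 0" using s by simp
  have T: "?T \<in> measurable (gaussE d) Rsp"
    using measurable_compose[OF measurable_affine_Rsp measurable_emb] by simp
  have D: "distr (gaussE d) Rsp ?T = density (lebE d) (\<lambda>x. ennreal (?k * exp (- quad d s a x)))"
    using distr_gaussE_affine[of "sqrt s" d a] s by (simp add: gdens_quad)
  have fm: "f \<in> borel_measurable Rsp" using f by (simp add: polyb_def)
  have qm: "quad d s a \<in> borel_measurable Rsp" using polyb_quad by (rule polyb_measurable)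
  have km: "(\<lambda>x. ?k * exp (- quad d s a x)) \<in> borel_measurable (lebE d)"
    using qm by simp
  have i: "integrable (lebE d) (\<lambda>x. ?k * (f x * exp (- quad d s a x)))"
    by (intro integrable_mult_right integrable_tame[OF f tame_quad[OF s]])
  then have "integrable (distr (gaussE d) Rsp ?T) f"
    unfolding D using k km fm by (subst integrable_density) (auto simp: mult_ac)
  then have "integrable (gaussE d) (\<lambda>z. f (?T z))" by (rule integrable_distr[OF T])
  then show "integrable (gaussE d) (\<lambda>z. f (\<lambda>i. a i + sqrt s * z i))" by (simp only: fe)
  have "(\<integral>z. f (?T z) \<partial>gaussE d) = (\<integral>x. f x \<partial>distr (gaussE d) Rsp ?T)"
    by (rule integral_distr[OF T fm, symmetric])
  also have "\<dots> = (\<integral>x. ?k * exp (- quad d s a x) * f x \<partial>lebE d)"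
    unfolding D using k km fm by (subst integral_density) auto
  also have "\<dots> = (\<integral>x. ?k * (f x * exp (- quad d s a x)) \<partial>lebE d)" by (simp only: mult_ac)
  also have "\<dots> = ?k * (\<integral>x. f x * exp (- quad d s a x) \<partial>lebE d)" by (rule integral_mult_right_zero)
  also have "\<dots> = gibbs d (quad d s a) f"
    using Zf_quad[OF s, of d a] Zf_pos[OF tame_quad[OF s], of d a]
    unfolding gibbs_def by (simp add: field_simps)
  finally show "gibbs d (quad d s a) f = (\<integral>z. f (\<lambda>i. a i + sqrt s * z i) \<partial>gaussE d)" by (simp only: fe)
qed

lemma measurable_pair_gaussE_sum:
  "(\<lambda>p i. fst p i + snd p i) \<in> measurable (gaussE d \<Otimes>\<^sub>M gaussE d) Rsp"
proof -
  have "(\<lambda>p i. fst p i + snd p i) \<in> measurable (Rsp \<Otimes>\<^sub>M Rsp) Rsp"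
    by (rule measurable_into_Rsp) measurable
  then show ?thesis by (simp cong: measurable_cong_sets sets_pair_measure_cong)
qed

lemma gaussE_sum_distr:
  "distr (gaussE d \<Otimes>\<^sub>M gaussE d) Rsp (\<lambda>p i. fst p i + snd p i) = distr (gaussE d) Rsp (\<lambda>z i. sqrt 2 * z i)"
proof (rule measure_eqI)
  interpret g: prob_space "gaussE d" by (rule prob_space_gaussE)
  note m1 = measurable_pair_gaussE_sum[of d]
  have m2: "(\<lambda>z i. sqrt 2 * z i) \<in> measurable (gaussE d) Rsp"
    using measurable_affine_Rsp[of "\<lambda>_. 0" "sqrt 2"] by simp
  fix A assume "A \<in> sets (distr (gaussE d \<Otimes>\<^sub>M gaussE d) Rsp (\<lambda>p i. fst p i + snd p i))"
  then have A: "A \<in> sets Rsp" by simp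
  have Am: "(\<lambda>p. indicator A (\<lambda>i. fst p i + snd p i) :: ennreal) \<in> borel_measurable (gaussE d \<Otimes>\<^sub>M gaussE d)"
    using measurable_compose[OF m1 borel_measurable_indicator[OF A]] .
  have "emeasure (distr (gaussE d \<Otimes>\<^sub>M gaussE d) Rsp (\<lambda>p i. fst p i + snd p i)) A
     = (\<integral>\<^sup>+x. indicator A x \<partial>distr (gaussE d \<Otimes>\<^sub>M gaussE d) Rsp (\<lambda>p i. fst p i + snd p i))"
    using A by (intro nn_integral_indicator[symmetric]) simp
  also have "\<dots> = (\<integral>\<^sup>+p. indicator A (\<lambda>i. fst p i + snd p i) \<partial>(gaussE d \<Otimes>\<^sub>M gaussE d))"
    by (rule nn_integral_distr[OF m1]) (use A in simp)
  also have "\<dots> = (\<integral>\<^sup>+z. (\<integral>\<^sup>+z'. indicator A (\<lambda>i. z i + z' i) \<partial>gaussE d) \<partial>gaussE d)"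
    by (subst g.nn_integral_fst[OF Am, symmetric]) simp
  also have "\<dots> = (\<integral>\<^sup>+z. indicator A (\<lambda>i. sqrt 2 * z i) \<partial>gaussE d)"
    by (rule nn_integral_gaussE_sum) (use A in simp)
  also have "\<dots> = (\<integral>\<^sup>+x. indicator A x \<partial>distr (gaussE d) Rsp (\<lambda>z i. sqrt 2 * z i))"
    by (rule nn_integral_distr[OF m2, symmetric]) (use A in simp)
  also have "\<dots> = emeasure (distr (gaussE d) Rsp (\<lambda>z i. sqrt 2 * z i)) A"
    using A by (intro nn_integral_indicator) simp
  finally show "emeasure (distr (gaussE d \<Otimes>\<^sub>M gaussE d) Rsp (\<lambda>p i. fst p i + snd p i)) A
    = emeasure (distr (gaussE d) Rsp (\<lambda>z i. sqrt 2 * z i)) A" .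
qed simp

lemma integral_gaussE_sum:
  fixes f :: "(nat \<Rightarrow> real) \<Rightarrow> real"
  assumes f: "f \<in> borel_measurable Rsp" and i: "integrable (gaussE d) (\<lambda>z. f (\<lambda>i. sqrt 2 * z i))"
  shows "integrable (gaussE d) (\<lambda>z. \<integral>z'. f (\<lambda>i. z i + z' i) \<partial>gaussE d)"
    and "(\<integral>z. (\<integral>z'. f (\<lambda>i. z i + z' i) \<partial>gaussE d) \<partial>gaussE d) = (\<integral>z. f (\<lambda>i. sqrt 2 * z i) \<partial>gaussE d)"
proof -
  interpret g: prob_space "gaussE d" by (rule prob_space_gaussE)
  interpret gg: pair_sigma_finite "gaussE d" "gaussE d" ..
  have m2: "(\<lambda>z i. sqrt 2 * z i) \<in> measurable (gaussE d) Rsp"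
    using measurable_affine_Rsp[of "\<lambda>_. 0" "sqrt 2"] by simp
  have "integrable (distr (gaussE d) Rsp (\<lambda>z i. sqrt 2 * z i)) f"
    using i by (subst integrable_distr_eq[OF m2 f])
  then have ii: "integrable (gaussE d \<Otimes>\<^sub>M gaussE d) (\<lambda>p. f (\<lambda>i. fst p i + snd p i))"
    unfolding gaussE_sum_distr[symmetric] by (rule integrable_distr[OF measurable_pair_gaussE_sum])
  show "integrable (gaussE d) (\<lambda>z. \<integral>z'. f (\<lambda>i. z i + z' i) \<partial>gaussE d)"
    using gg.integrable_fst'[OF ii] by simp
  have "(\<integral>z. (\<integral>z'. f (\<lambda>i. z i + z' i) \<partial>gaussE d) \<partial>gaussE d) = (\<integral>p. f (\<lambda>i. fst p i + snd p i) \<partial>(gaussE d \<Otimes>\<^sub>M gaussE d))"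
    using gg.integral_fst'[OF ii] by simp
  also have "\<dots> = (\<integral>x. f x \<partial>distr (gaussE d \<Otimes>\<^sub>M gaussE d) Rsp (\<lambda>p i. fst p i + snd p i))"
    by (rule integral_distr[OF measurable_pair_gaussE_sum f, symmetric])
  also have "\<dots> = (\<integral>z. f (\<lambda>i. sqrt 2 * z i) \<partial>gaussE d)"
    unfolding gaussE_sum_distr by (rule integral_distr[OF m2 f])
  finally show "(\<integral>z. (\<integral>z'. f (\<lambda>i. z i + z' i) \<partial>gaussE d) \<partial>gaussE d) = (\<integral>z. f (\<lambda>i. sqrt 2 * z i) \<partial>gaussE d)" .
qed

lemma lip_emb: "lip d h \<Longrightarrow> h (emb d x) = h x"
proof -
  assume "lip d h"
  then have "\<bar>h (emb d x) - h x\<bar> \<le> vnorm d (\<lambda>i. emb d x i - x i)" by (simp add: lip_def)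
  also have "\<dots> = 0" by (simp add: vnorm_def emb_def)
  finally show ?thesis by simp
qed

lemma lip_measurable: "lip d h \<Longrightarrow> h \<in> borel_measurable Rsp"
  using lip_polyb polyb_measurable by blast

lemma integrable_gaussE_lip:
  assumes h: "\<And>x y. \<bar>h x - h y\<bar> \<le> L * vnorm d (\<lambda>i. x i - y i)"
  shows "integrable (gaussE d) (\<lambda>z. h (\<lambda>i. a i + c * z i))"
proof (rule Bochner_Integration.integrable_bound)
  have n1: "integrable (gaussE d) (\<lambda>z. (1 + (vnorm d z)\<^sup>2))"
  proof -
    interpret prob_space "gaussE d" by (rule prob_space_gaussE)
    show ?thesis using gaussE_vnorm2(1)[of d] by simp
  qed
  show "integrable (gaussE d) (\<lambda>z. \<bar>h a\<bar> * (1 + (vnorm d z)\<^sup>2) + \<bar>L\<bar> * \<bar>c\<bar> * (1 + (vnorm d z)\<^sup>2))"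
    by (rule Bochner_Integration.integrable_add[OF integrable_mult_right[OF n1] integrable_mult_right[OF n1]])
  show "(\<lambda>z. h (\<lambda>i. a i + c * z i)) \<in> borel_measurable (gaussE d)"
    using measurable_compose[OF measurable_affine_Rsp borel_measurable_vnorm_lipschitz[OF h]] by simp
  show "AE z in gaussE d. norm (h (\<lambda>i. a i + c * z i)) \<le> norm (\<bar>h a\<bar> * (1 + (vnorm d z)\<^sup>2) + \<bar>L\<bar> * \<bar>c\<bar> * (1 + (vnorm d z)\<^sup>2))"
  proof (rule AE_I2)
    fix z
    have "\<bar>h (\<lambda>i. a i + c * z i) - h a\<bar> \<le> L * vnorm d (\<lambda>i. c * z i)" using h[of "\<lambda>i. a i + c * z i" a] by simp
    also have "\<dots> \<le> \<bar>L\<bar> * (\<bar>c\<bar> * vnorm d z)" by (simp add: vnorm_scale mult_right_mono)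
    also have "\<dots> \<le> \<bar>L\<bar> * (\<bar>c\<bar> * (1 + (vnorm d z)\<^sup>2))"
    proof (intro mult_left_mono)
      have "0 \<le> (vnorm d z - 1)\<^sup>2" by simp
      then have "2 * vnorm d z \<le> 1 + (vnorm d z)\<^sup>2" by (simp add: power2_diff)
      then show "vnorm d z \<le> 1 + (vnorm d z)\<^sup>2" using vnorm_nonneg[of d z] by linarith
    qed auto
    finally have 1: "\<bar>h (\<lambda>i. a i + c * z i) - h a\<bar> \<le> \<bar>L\<bar> * \<bar>c\<bar> * (1 + (vnorm d z)\<^sup>2)" by (simp add: mult.assoc)
    have "\<bar>h a\<bar> * 1 \<le> \<bar>h a\<bar> * (1 + (vnorm d z)\<^sup>2)" by (intro mult_left_mono) auto
    with 1 have "\<bar>h (\<lambda>i. a i + c * z i)\<bar> \<le> \<bar>h a\<bar> * (1 + (vnorm d z)\<^sup>2) + \<bar>L\<bar> * \<bar>c\<bar> * (1 + (vnorm d z)\<^sup>2)" by linarith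
    then show "norm (h (\<lambda>i. a i + c * z i)) \<le> norm (\<bar>h a\<bar> * (1 + (vnorm d z)\<^sup>2) + \<bar>L\<bar> * \<bar>c\<bar> * (1 + (vnorm d z)\<^sup>2))"
      by simp
  qed
qed

subsection \<open>The Gibbs kernel\<close>

lemma sconv_add: "sconv d m V \<Longrightarrow> sconv d m' V' \<Longrightarrow> sconv d (m + m') (\<lambda>x. V x + V' x)"
  unfolding sconv_def
proof (intro allI impI)
  fix x y :: "nat \<Rightarrow> real" and t :: real
  assume V: "\<forall>x y (t::real). 0 < t \<longrightarrow> t < 1 \<longrightarrow> V (\<lambda>i. t * x i + (1 - t) * y i) \<le> t * V x + (1 - t) * V y - m * t * (1 - t) / 2 * (vnorm d (\<lambda>i. x i - y i))\<^sup>2"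
    and V': "\<forall>x y (t::real). 0 < t \<longrightarrow> t < 1 \<longrightarrow> V' (\<lambda>i. t * x i + (1 - t) * y i) \<le> t * V' x + (1 - t) * V' y - m' * t * (1 - t) / 2 * (vnorm d (\<lambda>i. x i - y i))\<^sup>2"
    and t: "0 < t" "t < 1"
  show "V (\<lambda>i. t * x i + (1 - t) * y i) + V' (\<lambda>i. t * x i + (1 - t) * y i)
    \<le> t * (V x + V' x) + (1 - t) * (V y + V' y) - (m + m') * t * (1 - t) / 2 * (vnorm d (\<lambda>i. x i - y i))\<^sup>2"
    using V[rule_format, OF t, of x y] V'[rule_format, OF t, of x y]
    by (simp add: distrib_left distrib_right add_divide_distrib)
qed

lemma sconv_mono: "sconv d m V \<Longrightarrow> m' \<le> m \<Longrightarrow> sconv d m' V"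
  unfolding sconv_def
proof (intro allI impI)
  fix x y :: "nat \<Rightarrow> real" and t :: real
  assume V: "\<forall>x y (t::real). 0 < t \<longrightarrow> t < 1 \<longrightarrow> V (\<lambda>i. t * x i + (1 - t) * y i) \<le> t * V x + (1 - t) * V y - m * t * (1 - t) / 2 * (vnorm d (\<lambda>i. x i - y i))\<^sup>2"
    and m: "m' \<le> m" and t: "0 < t" "t < 1"
  have "m' * t * (1 - t) / 2 * (vnorm d (\<lambda>i. x i - y i))\<^sup>2 \<le> m * t * (1 - t) / 2 * (vnorm d (\<lambda>i. x i - y i))\<^sup>2"
    using m t by (intro mult_right_mono divide_right_mono) auto
  then show "V (\<lambda>i. t * x i + (1 - t) * y i) \<le> t * V x + (1 - t) * V y - m' * t * (1 - t) / 2 * (vnorm d (\<lambda>i. x i - y i))\<^sup>2"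
    using V[rule_format, OF t, of x y] by linarith
qed

text \<open>Assumption A freed of derivatives. \<open>convex\<close> is strong convexity of
  \<open>U\<close> with gradient - g in first-order form; \<open>growth\<close> is what a drift with
  derivative of at most linear growth satisfies. All functions are extended from R^d to sequences by
  ignoring the tail.\<close>

locale langevin =
  fixes d :: nat and g :: "(nat \<Rightarrow> real) \<Rightarrow> nat \<Rightarrow> real" and U :: "(nat \<Rightarrow> real) \<Rightarrow> real"
    and \<theta> a b :: real
  assumes \<theta>_pos: "\<theta> > 0" and ab: "a \<ge> 0" "b \<ge> 0"
    and g_Esp: "g x \<in> Esp d" and g_emb: "g (emb d x) = g x" and U_emb: "U (emb d x) = U x"
    and convex: "U y \<ge> U x - vinner d (g x) (\<lambda>i. y i - x i) + \<theta> / 2 * (vnorm d (\<lambda>i. y i - x i))\<^sup>2"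
    and growth: "vnorm d (\<lambda>i. g y i - g x i)
      \<le> vnorm d (\<lambda>i. y i - x i) * (a + b * vnorm d x) + b * (vnorm d (\<lambda>i. y i - x i))\<^sup>2"
begin

text \<open>The sum of two instances of \<open>convex\<close> with the endpoints exchanged.\<close>

lemma dissipative: "vinner d (\<lambda>i. y i - x i) (\<lambda>i. g y i - g x i) \<le> - \<theta> * (vnorm d (\<lambda>i. y i - x i))\<^sup>2"
proof -
  have "vinner d (g y) (\<lambda>i. x i - y i) = - vinner d (g y) (\<lambda>i. y i - x i)"
    by (simp add: vinner_diff_right)
  moreover have "vinner d (\<lambda>i. y i - x i) (\<lambda>i. g y i - g x i) = vinner d (g y) (\<lambda>i. y i - x i) - vinner d (g x) (\<lambda>i. y i - x i)"
    by (simp add: vinner_diff_right vinner_diff_left vinner_commute[of d _ "g y"] vinner_commute[of d _ "g x"])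
  ultimately show ?thesis using convex[where x=x and y=y] convex[where x=y and y=x] vnorm_minus_commute[of d x y] by simp
qed

lemma g_component_diff: "\<bar>g y i - g x i\<bar> \<le> vnorm d (\<lambda>i. g y i - g x i)"
proof (cases "i < d")
  case True then show ?thesis by (rule vnorm_component)
next
  case False then show ?thesis using g_Esp[of x] g_Esp[of y] by (simp add: Esp_def)
qed

lemma measurable_g: "(\<lambda>x. g x i) \<in> borel_measurable Rsp"
proof (rule borel_measurable_vnorm_continuous)
  fix x and e :: real assume e: "e > 0"
  define K where "K = a + b * vnorm d x + b + 1"
  have K: "K > 0" using ab unfolding K_def by (intro add_nonneg_pos add_nonneg_nonneg mult_nonneg_nonneg) auto
  have "\<bar>g y i - g x i\<bar> < e" if y: "vnorm d (\<lambda>i. y i - x i) < min 1 (e / K)" for y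
  proof -
    define r where "r = vnorm d (\<lambda>i. y i - x i)"
    have r: "0 \<le> r" "r \<le> 1" "r < e / K" using y by (auto simp: r_def)
    have "\<bar>g y i - g x i\<bar> \<le> r * (a + b * vnorm d x) + b * r\<^sup>2"
      unfolding r_def by (rule order_trans[OF g_component_diff growth])
    also have "\<dots> \<le> r * (a + b * vnorm d x) + b * r" using r ab
      by (intro add_left_mono mult_left_mono) (auto simp: power2_eq_square mult_left_le)
    also have "\<dots> \<le> r * K" using r by (simp add: K_def algebra_simps)
    also have "\<dots> < e" using r(3) K by (simp add: pos_less_divide_eq)
    finally show ?thesis .
  qed
  then show "\<exists>\<delta>>0. \<forall>y. vnorm d (\<lambda>i. y i - x i) < \<delta> \<longrightarrow> \<bar>g y i - g x i\<bar> < e"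
    using e K by (intro exI[of _ "min 1 (e / K)"]) auto
qed

lemma polyb_dist: "polyb d (\<lambda>z. vnorm d (\<lambda>i. z i - x i))"
proof (rule polyb_lipschitz[where L=1])
  fix y z
  show "\<bar>vnorm d (\<lambda>i. y i - x i) - vnorm d (\<lambda>i. z i - x i)\<bar> \<le> 1 * vnorm d (\<lambda>i. y i - z i)"
    using vnorm_diff_tri[of d y x z] vnorm_diff_tri[of d z x y] vnorm_minus_commute[of d y z] by simp
qed

lemma polyb_g_diff: "polyb d (\<lambda>z. (vnorm d (\<lambda>i. g x i - g z i))\<^sup>2)"
proof (rule polyb_power, rule polyb_mono[where g="\<lambda>z. vnorm d (\<lambda>i. z i - x i) * (a + b * vnorm d x) + b * (vnorm d (\<lambda>i. z i - x i))\<^sup>2"])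
  show "polyb d (\<lambda>z. vnorm d (\<lambda>i. z i - x i) * (a + b * vnorm d x) + b * (vnorm d (\<lambda>i. z i - x i))\<^sup>2)"
    by (intro polyb_add polyb_mult polyb_dist polyb_const polyb_power)
  show "(\<lambda>z. vnorm d (\<lambda>i. g x i - g z i)) \<in> borel_measurable Rsp"
    by (rule measurable_vnorm) (intro borel_measurable_diff measurable_g borel_measurable_const)
  fix z show "\<bar>vnorm d (\<lambda>i. g x i - g z i)\<bar> \<le> vnorm d (\<lambda>i. z i - x i) * (a + b * vnorm d x) + b * (vnorm d (\<lambda>i. z i - x i))\<^sup>2"
    using growth[of z x] by (simp add: vnorm_minus_commute[of d "g x"])
qed

text \<open>Convexity bounds the increment from below by the gradient at \<open>x\<close> and from
  above by the gradient at \<open>y\<close>; the latter is brought back to \<open>x\<close> by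
  \<open>growth\<close>.\<close>

lemma U_diff_le:
  "\<bar>U y - U x\<bar> \<le> vnorm d (\<lambda>i. y i - x i) * (vnorm d (g x) + (vnorm d (\<lambda>i. y i - x i) * (a + b * vnorm d x) + b * (vnorm d (\<lambda>i. y i - x i))\<^sup>2))"
proof -
  define r where "r = vnorm d (\<lambda>i. y i - x i)"
  define q where "q = r * (a + b * vnorm d x) + b * r\<^sup>2"
  have q: "q \<ge> 0" using ab by (simp add: q_def r_def)
  have sq: "\<theta> / 2 * (vnorm d (\<lambda>i. y i - x i))\<^sup>2 \<ge> 0" using \<theta>_pos by simp
  have 1: "U y - U x \<ge> - (vnorm d (g x) * r)"
    using convex[where x=x and y=y] vinner_le[of d "g x" "\<lambda>i. y i - x i"] sq
    unfolding r_def by linarith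
  have "vnorm d (g y) \<le> vnorm d (g x) + q"
    using vnorm_sub_le[of d "g y" "g x"] growth[of y x] unfolding q_def r_def by linarith
  then have "vnorm d (g y) * r \<le> (vnorm d (g x) + q) * r" by (intro mult_right_mono) (auto simp: r_def)
  moreover have "U x - U y \<ge> - (vnorm d (g y) * r)"
    using convex[where x=y and y=x] vinner_le[of d "g y" "\<lambda>i. x i - y i"] sq
    unfolding r_def vnorm_minus_commute[of d x y] by linarith
  moreover have "vnorm d (g x) * r \<le> (vnorm d (g x) + q) * r" using q by (intro mult_right_mono) (auto simp: r_def)
  ultimately have "\<bar>U y - U x\<bar> \<le> (vnorm d (g x) + q) * r" using 1 by linarith
  then show ?thesis by (simp add: q_def r_def mult.commute)
qed

lemma measurable_U: "U \<in> borel_measurable Rsp"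
proof (rule borel_measurable_vnorm_continuous)
  fix x and e :: real assume e: "e > 0"
  define K where "K = vnorm d (g x) + (a + b * vnorm d x) + b + 1"
  have K: "K > 0" using ab unfolding K_def by (intro add_nonneg_pos add_nonneg_nonneg mult_nonneg_nonneg) auto
  have "\<bar>U y - U x\<bar> < e" if y: "vnorm d (\<lambda>i. y i - x i) < min 1 (e / K)" for y
  proof -
    define r where "r = vnorm d (\<lambda>i. y i - x i)"
    have r: "0 \<le> r" "r \<le> 1" "r < e / K" using y by (auto simp: r_def)
    have "\<bar>U y - U x\<bar> \<le> r * (vnorm d (g x) + (r * (a + b * vnorm d x) + b * r\<^sup>2))"
      unfolding r_def by (rule U_diff_le)
    also have "\<dots> \<le> r * K"
    proof (rule mult_left_mono)
      have "r * (a + b * vnorm d x) \<le> 1 * (a + b * vnorm d x)" using r ab by (intro mult_right_mono) auto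
      moreover have "b * r\<^sup>2 \<le> b * 1" using r ab by (intro mult_left_mono) (auto simp: power_le_one)
      ultimately show "vnorm d (g x) + (r * (a + b * vnorm d x) + b * r\<^sup>2) \<le> K" by (simp add: K_def)
    qed (rule r(1))
    also have "\<dots> < e" using r(3) K by (simp add: pos_less_divide_eq)
    finally show ?thesis .
  qed
  then show "\<exists>\<delta>>0. \<forall>y. vnorm d (\<lambda>i. y i - x i) < \<delta> \<longrightarrow> \<bar>U y - U x\<bar> < e"
    using e K by (intro exI[of _ "min 1 (e / K)"]) auto
qed

lemma polyb_U: "polyb d U"
proof (rule polyb_mono[where g="\<lambda>y. \<bar>U (\<lambda>_. 0)\<bar> + vnorm d y * (vnorm d (g (\<lambda>_. 0)) + (vnorm d y * a + b * (vnorm d y)\<^sup>2))"])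
  show "polyb d (\<lambda>y. \<bar>U (\<lambda>_. 0)\<bar> + vnorm d y * (vnorm d (g (\<lambda>_. 0)) + (vnorm d y * a + b * (vnorm d y)\<^sup>2)))"
    by (intro polyb_add polyb_mult polyb_const polyb_power polyb_vnorm)
  fix y
  show "\<bar>U y\<bar> \<le> \<bar>U (\<lambda>_. 0)\<bar> + vnorm d y * (vnorm d (g (\<lambda>_. 0)) + (vnorm d y * a + b * (vnorm d y)\<^sup>2))"
    using U_diff_le[of y "\<lambda>_. 0"] by simp
qed (rule measurable_U)

lemma U_lower: "U x \<ge> \<theta> / 4 * (vnorm d x)\<^sup>2 - ((vnorm d (g (\<lambda>_. 0)))\<^sup>2 / \<theta> - U (\<lambda>_. 0))"
proof -
  define p where "p = vnorm d (g (\<lambda>_. 0))"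
  define r where "r = vnorm d x"
  have "U x \<ge> U (\<lambda>_. 0) - p * r + \<theta> / 2 * r\<^sup>2"
    using convex[where x="\<lambda>_. 0" and y=x] vinner_le[of d "g (\<lambda>_. 0)" x] by (simp add: p_def r_def)
  \<comment> \<open>Half of the quadratic term absorbs the linear one, whence the coefficient
    \<open>\<theta> / 4\<close>.\<close>
  moreover have "0 \<le> (p - \<theta> / 2 * r)\<^sup>2 / \<theta>" using \<theta>_pos by simp
  moreover have "(p - \<theta> / 2 * r)\<^sup>2 / \<theta> = p\<^sup>2 / \<theta> + \<theta> / 4 * r\<^sup>2 - p * r"
    using \<theta>_pos by (simp add: power2_eq_square field_simps)
  ultimately show ?thesis unfolding p_def[symmetric] r_def[symmetric] by linarith
qed

lemma tame_U: "tame d U"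
  unfolding tame_def using \<theta>_pos U_lower
  by (intro conjI polyb_U allI U_emb exI[of _ "\<theta> / 4"] exI[of _ "(vnorm d (g (\<lambda>_. 0)))\<^sup>2 / \<theta> - U (\<lambda>_. 0)"]) auto

text \<open>Both endpoints are compared with the tangent at the intermediate point \<open>z\<close>;
  in the convex combination the linear terms cancel.\<close>

lemma sconv_U: "sconv d \<theta> U"
  unfolding sconv_def
proof (intro allI impI)
  fix x y :: "nat \<Rightarrow> real" and t :: real assume t: "0 < t" "t < 1"
  define z where "z = (\<lambda>i. t * x i + (1 - t) * y i)"
  define w where "w = (\<lambda>i. x i - y i)"
  define W where "W = (vnorm d w)\<^sup>2"
  define p where "p = vinner d (g z) w"
  have xz: "(\<lambda>i. x i - z i) = (\<lambda>i. (1 - t) * w i)" and yz: "(\<lambda>i. y i - z i) = (\<lambda>i. (- t) * w i)"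
    by (auto simp: z_def w_def algebra_simps)
  have "U x \<ge> U z - (1 - t) * p + \<theta> / 2 * ((1 - t)\<^sup>2 * W)"
    using convex[where x=z and y=x] unfolding xz by (simp add: vinner_scale_right vnorm_scale power_mult_distrib p_def W_def)
  then have 1: "t * U x \<ge> t * (U z - (1 - t) * p + \<theta> / 2 * ((1 - t)\<^sup>2 * W))" using t by (intro mult_left_mono) auto
  have "U y \<ge> U z - (- t) * p + \<theta> / 2 * (t\<^sup>2 * W)"
    using convex[where x=z and y=y] unfolding yz vinner_scale_right vnorm_scale by (simp add: power_mult_distrib p_def W_def)
  then have 2: "(1 - t) * U y \<ge> (1 - t) * (U z - (- t) * p + \<theta> / 2 * (t\<^sup>2 * W))" using t by (intro mult_left_mono) auto
  have "t * (U z - (1 - t) * p + \<theta> / 2 * ((1 - t)\<^sup>2 * W)) + (1 - t) * (U z - (- t) * p + \<theta> / 2 * (t\<^sup>2 * W))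
      = U z + \<theta> * t * (1 - t) / 2 * W"
    by (simp add: power2_eq_square field_simps)
  with 1 2 show "U (\<lambda>i. t * x i + (1 - t) * y i) \<le> t * U x + (1 - t) * U y - \<theta> * t * (1 - t) / 2 * (vnorm d (\<lambda>i. x i - y i))\<^sup>2"
    unfolding z_def[symmetric] w_def[symmetric] W_def[symmetric] by linarith
qed

text \<open>Up to a constant, minus the logarithm of the conditional density of the new state given
  the intermediate point \<open>y\<close>.\<close>

definition V :: "real \<Rightarrow> (nat \<Rightarrow> real) \<Rightarrow> (nat \<Rightarrow> real) \<Rightarrow> real" where
  "V s y z = U z + quad d s y z"

lemma tame_V: assumes s: "s > 0" shows "tame d (V s y)"
  unfolding tame_def
proof (intro conjI allI)
  show "polyb d (V s y)" unfolding V_def[abs_def] by (intro polyb_add polyb_U polyb_quad)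
  show "V s y (emb d x) = V s y x" for x by (simp add: V_def U_emb)
  have "quad d s y x \<ge> 0" for x using s by (simp add: quad_def)
  then have "V s y x \<ge> \<theta> / 4 * (vnorm d x)\<^sup>2 - ((vnorm d (g (\<lambda>_. 0)))\<^sup>2 / \<theta> - U (\<lambda>_. 0))" for x
    using U_lower[of x] by (simp add: V_def add_increasing2)
  then show "\<exists>c>0. \<exists>C. \<forall>x. V s y x \<ge> c * (vnorm d x)\<^sup>2 - C"
    using \<theta>_pos by (intro exI[of _ "\<theta> / 4"] conjI exI[of _ "(vnorm d (g (\<lambda>_. 0)))\<^sup>2 / \<theta> - U (\<lambda>_. 0)"] allI) auto
qed

lemma sconv_V: "s > 0 \<Longrightarrow> sconv d (\<theta> + 1 / s) (V s y)"
  unfolding V_def[abs_def] by (intro sconv_add sconv_U sconv_quad)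

definition kern :: "real \<Rightarrow> ((nat \<Rightarrow> real) \<Rightarrow> real) \<Rightarrow> (nat \<Rightarrow> real) \<Rightarrow> real" where
  "kern s h y = gibbs d (V s y) h"

lemma kern_emb: "kern s h (emb d y) = kern s h y"
proof -
  have "V s (emb d y) = V s y" by (rule ext) (simp add: V_def)
  then show ?thesis by (simp add: kern_def)
qed

text \<open>Changing \<open>y\<close> to \<open>y'\<close> changes the potential by an affine
  function of slope |y - y'| / s. Divided by the modulus \<theta> + 1 / s this is the contraction
  factor; without the sharp constant in \<open>gibbs_tilt_lipschitz\<close> it could exceed 1 for
  small s.\<close>

lemma kern_lipschitz:
  assumes s: "s > 0" and h: "lip d h"
  shows "\<bar>kern s h y - kern s h y'\<bar> \<le> 1 / (1 + \<theta> * s) * vnorm d (\<lambda>i. y i - y' i)"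
proof -
  have "\<bar>kern s h y - kern s h y'\<bar> \<le> (vnorm d (\<lambda>i. y i - y' i) / s) / (\<theta> + 1 / s)"
    unfolding kern_def
  proof (rule gibbs_tilt_lipschitz[OF tame_V[OF s] sconv_V[OF s] tame_V[OF s] sconv_V[OF s] _ _ _ h])
    show "\<theta> + 1 / s > 0" using s \<theta>_pos by (simp add: add_pos_pos)
    show "vnorm d (\<lambda>i. y i - y' i) / s \<ge> 0" using s by simp
    fix x z
    have "\<bar>(V s y x - V s y' x) - (V s y z - V s y' z)\<bar> = \<bar>vinner d (\<lambda>i. y i - y' i) (\<lambda>i. x i - z i)\<bar> / s"
    proof -
      have "(V s y x - V s y' x) - (V s y z - V s y' z) = - vinner d (\<lambda>i. y i - y' i) (\<lambda>i. x i - z i) / s"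
        using s by (simp add: V_def quad_expand vinner_diff_left vinner_diff_right vinner_commute[of d x] vinner_commute[of d z] field_simps)
      then show ?thesis using s by (simp add: abs_divide)
    qed
    also have "\<dots> \<le> (vnorm d (\<lambda>i. y i - y' i) * vnorm d (\<lambda>i. x i - z i)) / s"
      using s by (intro divide_right_mono vinner_abs_le) auto
    finally show "\<bar>(V s y x - V s y' x) - (V s y z - V s y' z)\<bar> \<le> vnorm d (\<lambda>i. y i - y' i) / s * vnorm d (\<lambda>i. x i - z i)"
      by simp
  qed
  also have "\<dots> = 1 / (1 + \<theta> * s) * vnorm d (\<lambda>i. y i - y' i)"
  proof -
    have "s * (\<theta> + 1 / s) = 1 + \<theta> * s" using s by (simp add: field_simps)
    then show ?thesis by (simp add: divide_divide_eq_left)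
  qed
  finally show ?thesis .
qed

text \<open>The perturbation between the two laws is U z + <z, g x> up to a constant: convex, with
  gradient g x - g z. Both potentials have modulus at least 1 / s, whose inverse square is the
  factor \<open>s\<^sup>2\<close>.\<close>

lemma kern_gaussian_error:
  assumes s: "s > 0" and h: "lip d h"
  shows "(gibbs d (quad d s (\<lambda>i. y i + s * g x i)) h - kern s h y)\<^sup>2
     \<le> s\<^sup>2 * gibbs d (quad d s (\<lambda>i. y i + s * g x i)) (\<lambda>z. (vnorm d (\<lambda>i. g x i - g z i))\<^sup>2)"
proof -
  let ?N = "quad d s (\<lambda>i. y i + s * g x i)"
  have "(gibbs d ?N h - kern s h y)\<^sup>2 \<le> gibbs d ?N (\<lambda>z. (vnorm d (\<lambda>i. g x i - g z i))\<^sup>2) / (1 / s)\<^sup>2"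
    unfolding kern_def
  proof (rule gibbs_convex_perturbation[OF tame_V[OF s] sconv_mono[OF sconv_V[OF s]] tame_quad[OF s] sconv_quad[OF s] _ polyb_g_diff _ h])
    show "1 / s \<le> \<theta> + 1 / s" using \<theta>_pos by simp
    show "1 / s > 0" using s by simp
    fix x' z
    \<comment> \<open>The quadratic parts have the same curvature and cancel.\<close>
    have F: "V s y w - ?N w = U w + vinner d w (g x) + ((vnorm d y)\<^sup>2 - (vnorm d (\<lambda>i. y i + s * g x i))\<^sup>2) / (2 * s)" for w
    proof -
      have "vinner d w (\<lambda>i. y i + s * g x i) = vinner d w y + s * vinner d w (g x)"
        by (simp add: vinner_def sum.distrib sum_distrib_left algebra_simps)
      then show ?thesis using s by (simp add: V_def quad_expand field_simps)
    qed
    have "vinner d (\<lambda>i. g x i - g z i) (\<lambda>i. x' i - z i)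
       = vinner d x' (g x) - vinner d z (g x) - vinner d (g z) (\<lambda>i. x' i - z i)"
      by (simp add: vinner_diff_left vinner_diff_right vinner_commute[of d "g x"])
    moreover have "U x' \<ge> U z - vinner d (g z) (\<lambda>i. x' i - z i)"
      using convex[where x=z and y=x'] \<theta>_pos by (smt (verit) mult_nonneg_nonneg zero_le_power2 divide_nonneg_pos)
    ultimately show "V s y z - ?N z + vinner d (\<lambda>i. g x i - g z i) (\<lambda>i. x' i - z i) \<le> V s y x' - ?N x'"
      unfolding F by linarith
  qed
  moreover have "X / (1 / s)\<^sup>2 = s\<^sup>2 * X" for X using s by (simp add: power_divide)
  ultimately show ?thesis by simp
qed

text \<open>One full step of the Gibbs sampler as an operator on test functions.\<close>

definition R :: "real \<Rightarrow> ((nat \<Rightarrow> real) \<Rightarrow> real) \<Rightarrow> (nat \<Rightarrow> real) \<Rightarrow> real" where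
  "R s h x = (\<integral>z. kern s h (\<lambda>i. x i + sqrt s * z i) \<partial>gaussE d)"

lemma integrable_kern:
  assumes s: "s > 0" and h: "lip d h"
  shows "integrable (gaussE d) (\<lambda>z. kern s h (\<lambda>i. x i + sqrt s * z i))"
  by (rule integrable_gaussE_lip[OF kern_lipschitz[OF s h]])

text \<open>Both starting points use the same Gaussian noise, which preserves their distance; the
  contraction is that of the conditional law.\<close>

lemma R_lipschitz:
  assumes s: "s > 0" and h: "lip d h"
  shows "\<bar>R s h x - R s h x'\<bar> \<le> 1 / (1 + \<theta> * s) * vnorm d (\<lambda>i. x i - x' i)"
proof -
  interpret prob_space "gaussE d" by (rule prob_space_gaussE)
  have "\<bar>R s h x - R s h x'\<bar> = \<bar>\<integral>z. (kern s h (\<lambda>i. x i + sqrt s * z i) - kern s h (\<lambda>i. x' i + sqrt s * z i)) \<partial>gaussE d\<bar>"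
    unfolding R_def by (simp add: integrable_kern[OF s h])
  also have "\<dots> \<le> (\<integral>z. \<bar>kern s h (\<lambda>i. x i + sqrt s * z i) - kern s h (\<lambda>i. x' i + sqrt s * z i)\<bar> \<partial>gaussE d)"
    by (rule integral_abs_bound)
  also have "\<dots> \<le> (\<integral>z. 1 / (1 + \<theta> * s) * vnorm d (\<lambda>i. x i - x' i) \<partial>gaussE d)"
  proof (rule integral_mono)
    show "integrable (gaussE d) (\<lambda>z. \<bar>kern s h (\<lambda>i. x i + sqrt s * z i) - kern s h (\<lambda>i. x' i + sqrt s * z i)\<bar>)"
      by (intro integrable_abs Bochner_Integration.integrable_diff integrable_kern[OF s h])
    fix z
    show "\<bar>kern s h (\<lambda>i. x i + sqrt s * z i) - kern s h (\<lambda>i. x' i + sqrt s * z i)\<bar> \<le> 1 / (1 + \<theta> * s) * vnorm d (\<lambda>i. x i - x' i)"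
      using kern_lipschitz[OF s h, of "\<lambda>i. x i + sqrt s * z i" "\<lambda>i. x' i + sqrt s * z i"] by simp
  qed simp
  also have "\<dots> = 1 / (1 + \<theta> * s) * vnorm d (\<lambda>i. x i - x' i)" using prob_space by simp
  finally show ?thesis .
qed

end

section \<open>Invariance of the target under the Gibbs sampler\<close>

lemma pair_measurable_lebE:
  assumes "f \<in> borel_measurable (Rsp \<Otimes>\<^sub>M Rsp)"
  shows "f \<in> borel_measurable (lebE d \<Otimes>\<^sub>M lebE d)"
proof -
  have "sets (lebE d \<Otimes>\<^sub>M lebE d) = sets (Rsp \<Otimes>\<^sub>M Rsp)" by (rule sets_pair_measure_cong) simp_all
  then show ?thesis using assms measurable_cong_sets by blast
qed

lemma quad_commute: "quad d s x y = quad d s y x"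
  by (simp add: quad_def vnorm_minus_commute[of d x y])

context langevin
begin

lemma kern_nonneg:
  assumes s: "s > 0" and h: "lip d h" "\<And>x. h x \<ge> 0"
  shows "kern s h y \<ge> 0"
proof -
  have "gibbs d (V s y) (\<lambda>_. 0) \<le> gibbs d (V s y) h"
    by (rule gibbs_mono[OF tame_V[OF s] polyb_const lip_polyb[OF h(1)] h(2)])
  then show ?thesis by (simp add: kern_def gibbs_const[OF tame_V[OF s]])
qed

lemma measurable_kern: "s > 0 \<Longrightarrow> lip d h \<Longrightarrow> kern s h \<in> borel_measurable Rsp"
  by (rule borel_measurable_vnorm_lipschitz[OF kern_lipschitz])

lemma R_nn_integral:
  assumes s: "s > 0" and h: "lip d h" "\<And>x. h x \<ge> 0"
  shows "ennreal (R s h x) = (\<integral>\<^sup>+y. ennreal (kern s h y) * ennreal (gdens d (sqrt s) (\<lambda>i. y i - x i)) \<partial>lebE d)"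
proof -
  have "ennreal (R s h x) = (\<integral>\<^sup>+z. ennreal (kern s h (\<lambda>i. x i + sqrt s * z i)) \<partial>gaussE d)"
    unfolding R_def by (rule nn_integral_eq_integral[symmetric, OF integrable_kern[OF s h(1)]]) (simp add: kern_nonneg[OF s h])
  also have "\<dots> = (\<integral>\<^sup>+z. ennreal (kern s h (emb d (\<lambda>i. x i + sqrt s * z i))) \<partial>gaussE d)"
    by (simp only: kern_emb)
  also have "\<dots> = (\<integral>\<^sup>+y. ennreal (kern s h y) * ennreal (gdens d (sqrt s) (\<lambda>i. y i - x i)) \<partial>lebE d)"
    by (rule nn_integral_gaussE_affine) (use s measurable_kern[OF s h(1)] in auto)
  finally show ?thesis .
qed

lemma kern_Zf:
  assumes s: "s > 0" and h: "lip d h" "\<And>x. h x \<ge> 0"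
  shows "ennreal (kern s h y) * ennreal (Zf d (V s y)) = (\<integral>\<^sup>+z. ennreal (h z * exp (- V s y z)) \<partial>lebE d)"
proof -
  have Z: "Zf d (V s y) > 0" by (rule Zf_pos[OF tame_V[OF s]])
  have "(\<integral>\<^sup>+z. ennreal (h z * exp (- V s y z)) \<partial>lebE d) = ennreal (\<integral>z. h z * exp (- V s y z) \<partial>lebE d)"
    by (rule nn_integral_eq_integral[OF integrable_tame[OF lip_polyb[OF h(1)] tame_V[OF s]]]) (simp add: h(2))
  also have "(\<integral>z. h z * exp (- V s y z) \<partial>lebE d) = kern s h y * Zf d (V s y)"
    using Z by (simp add: kern_def gibbs_def)
  finally show ?thesis using Z kern_nonneg[OF s h] by (simp add: ennreal_mult)
qed

lemma nn_Zf:
  assumes s: "s > 0"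
  shows "(\<integral>\<^sup>+z. ennreal (exp (- V s y z)) \<partial>lebE d) = ennreal (Zf d (V s y))"
  unfolding Zf_def by (rule nn_integral_eq_integral[OF integrable_exp_tame[OF tame_V[OF s]]]) simp

text \<open>For fixed y, the joint density of state and intermediate point is proportional to exp (-
  V s y x), the very law averaged by \<open>kern\<close>. Exchanging the integrals, averaging under
  that law and exchanging back replaces \<open>R s h\<close> by \<open>h\<close>. For nonnegative
  \<open>h\<close> no integrability has to be checked when exchanging.\<close>

lemma R_invariant_nn:
  assumes s: "s > 0" and h: "lip d h" "\<And>x. h x \<ge> 0" and K: "K > 0"
  shows "(\<integral>\<^sup>+x. ennreal (K * exp (- U x)) * ennreal (R s h x) \<partial>lebE d)
       = (\<integral>\<^sup>+x. ennreal (K * exp (- U x)) * ennreal (h x) \<partial>lebE d)"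
proof -
  interpret L: sigma_finite_measure "lebE d" by (rule sigma_finite_lebE)
  interpret LL: pair_sigma_finite "lebE d" "lebE d" ..
  let ?k = "(1 / sqrt (2 * pi * s)) ^ d"
  let ?g = "\<lambda>x y. gdens d (sqrt s) (\<lambda>i. y i - x i)"
  have k: "?k > 0" using s by simp
  have gd: "gdens d (sqrt s) (\<lambda>i. y i - x i) = ?k * exp (- quad d s x y)" for x y
    by (rule gdens_quad[OF s])
  have gpos: "?g x y > 0" for x y using s by (intro gdens_pos) simp
  \<comment> \<open>Prior times Gaussian likelihood is the unnormalised posterior; the symmetry of
    \<open>quad\<close> in its two points lets \<open>V s y\<close> appear.\<close>
  have key: "K * exp (- U x) * ?g x y = K * ?k * exp (- V s y x)" for x y
    by (simp add: gd V_def quad_commute[of d s x y] exp_diff exp_minus exp_add divide_inverse mult_ac)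
  note mU = measurable_U and mk = measurable_kern[OF s h(1)] and mh = lip_measurable[OF h(1)]
  have m_fst: "(\<lambda>p. f (fst p)) \<in> borel_measurable (Rsp \<Otimes>\<^sub>M Rsp)" if "f \<in> borel_measurable Rsp" for f :: "_ \<Rightarrow> real"
    by (rule measurable_compose[OF measurable_fst that])
  have m_snd: "(\<lambda>p. f (snd p)) \<in> borel_measurable (Rsp \<Otimes>\<^sub>M Rsp)" if "f \<in> borel_measurable Rsp" for f :: "_ \<Rightarrow> real"
    by (rule measurable_compose[OF measurable_snd that])
  have mg: "(\<lambda>p. ?g (fst p) (snd p)) \<in> borel_measurable (Rsp \<Otimes>\<^sub>M Rsp)"
    by (rule measurable_gdens) (intro borel_measurable_diff measurable_Rsp_component_fst measurable_Rsp_component_snd)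
  have mg2: "(\<lambda>p. ?g (snd p) (fst p)) \<in> borel_measurable (Rsp \<Otimes>\<^sub>M Rsp)"
    by (rule measurable_gdens) (intro borel_measurable_diff measurable_Rsp_component_fst measurable_Rsp_component_snd)
  have mg1: "(\<lambda>y. ?g x y) \<in> borel_measurable Rsp" for x
    by (rule measurable_gdens) (intro borel_measurable_diff measurable_Rsp_component borel_measurable_const)
  have mexpU: "(\<lambda>x. K * exp (- U x)) \<in> borel_measurable Rsp" using mU by simp
  have "(\<integral>\<^sup>+x. ennreal (K * exp (- U x)) * ennreal (R s h x) \<partial>lebE d)
     = (\<integral>\<^sup>+x. (\<integral>\<^sup>+y. ennreal (K * exp (- U x)) * (ennreal (kern s h y) * ennreal (?g x y)) \<partial>lebE d) \<partial>lebE d)"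
  proof (rule nn_integral_cong)
    fix x
    have "(\<lambda>y. ennreal (kern s h y) * ennreal (?g x y)) \<in> borel_measurable (lebE d)"
      using mk mg1[of x] by simp
    then show "ennreal (K * exp (- U x)) * ennreal (R s h x)
      = (\<integral>\<^sup>+y. ennreal (K * exp (- U x)) * (ennreal (kern s h y) * ennreal (?g x y)) \<partial>lebE d)"
      unfolding R_nn_integral[OF s h] by (rule nn_integral_cmult[symmetric])
  qed
  also have "\<dots> = (\<integral>\<^sup>+y. (\<integral>\<^sup>+x. ennreal (K * exp (- U x)) * (ennreal (kern s h y) * ennreal (?g x y)) \<partial>lebE d) \<partial>lebE d)"
  proof (rule LL.Fubini'[symmetric])
    have "(\<lambda>p. ennreal (K * exp (- U (fst p))) * (ennreal (kern s h (snd p)) * ennreal (?g (fst p) (snd p)))) \<in> borel_measurable (Rsp \<Otimes>\<^sub>M Rsp)"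
      using m_fst[OF mexpU] m_snd[OF mk] mg by simp
    then show "(\<lambda>(x, y). ennreal (K * exp (- U x)) * (ennreal (kern s h y) * ennreal (?g x y))) \<in> borel_measurable (lebE d \<Otimes>\<^sub>M lebE d)"
      unfolding split_beta' by (rule pair_measurable_lebE)
  qed
  also have "\<dots> = (\<integral>\<^sup>+y. (\<integral>\<^sup>+z. ennreal (K * ?k) * ennreal (h z * exp (- V s y z)) \<partial>lebE d) \<partial>lebE d)"
  proof (rule nn_integral_cong)
    fix y
    have [measurable]: "V s y \<in> borel_measurable Rsp" using tame_V[OF s, of y] by (simp add: tame_def polyb_def)
    have mV: "(\<lambda>x. exp (- V s y x)) \<in> borel_measurable Rsp"
      by measurable
    have "(\<integral>\<^sup>+x. ennreal (K * exp (- U x)) * (ennreal (kern s h y) * ennreal (?g x y)) \<partial>lebE d)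
       = (\<integral>\<^sup>+x. (ennreal (kern s h y) * ennreal (K * ?k)) * ennreal (exp (- V s y x)) \<partial>lebE d)"
    proof (rule nn_integral_cong)
      fix x
      have "ennreal (K * exp (- U x)) * ennreal (?g x y) = ennreal (K * ?k) * ennreal (exp (- V s y x))"
        unfolding ennreal_mult''[OF less_imp_le[OF gpos], symmetric] key
        by (rule ennreal_mult'') simp
      then show "ennreal (K * exp (- U x)) * (ennreal (kern s h y) * ennreal (?g x y))
         = (ennreal (kern s h y) * ennreal (K * ?k)) * ennreal (exp (- V s y x))"
        by (metis mult.assoc mult.commute)
    qed
    also have "\<dots> = (ennreal (kern s h y) * ennreal (K * ?k)) * ennreal (Zf d (V s y))"
      by (subst nn_integral_cmult) (use mV in \<open>simp_all add: nn_Zf[OF s]\<close>)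
    also have "\<dots> = ennreal (K * ?k) * (ennreal (kern s h y) * ennreal (Zf d (V s y)))" by (simp add: mult_ac)
    also have "\<dots> = (\<integral>\<^sup>+z. ennreal (K * ?k) * ennreal (h z * exp (- V s y z)) \<partial>lebE d)"
      unfolding kern_Zf[OF s h] by (rule nn_integral_cmult[symmetric]) (use mV mh in simp)
    finally show "(\<integral>\<^sup>+x. ennreal (K * exp (- U x)) * (ennreal (kern s h y) * ennreal (?g x y)) \<partial>lebE d)
      = (\<integral>\<^sup>+z. ennreal (K * ?k) * ennreal (h z * exp (- V s y z)) \<partial>lebE d)" .
  qed
  also have "\<dots> = (\<integral>\<^sup>+y. (\<integral>\<^sup>+z. ennreal (K * exp (- U z) * h z) * ennreal (?g z y) \<partial>lebE d) \<partial>lebE d)"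
  proof (intro nn_integral_cong)
    fix y z
    have "ennreal (K * ?k) * ennreal (h z * exp (- V s y z)) = ennreal (K * ?k * exp (- V s y z) * h z)"
      using K k h(2)[of z] by (subst ennreal_mult[symmetric]) (auto simp: mult_ac)
    also have "K * ?k * exp (- V s y z) * h z = K * exp (- U z) * h z * ?g z y"
      unfolding key[symmetric] by (simp add: mult_ac)
    also have "ennreal \<dots> = ennreal (K * exp (- U z) * h z) * ennreal (?g z y)"
      by (rule ennreal_mult'') (simp add: less_imp_le[OF gpos])
    finally show "ennreal (K * ?k) * ennreal (h z * exp (- V s y z)) = ennreal (K * exp (- U z) * h z) * ennreal (?g z y)" .
  qed
  also have "\<dots> = (\<integral>\<^sup>+z. (\<integral>\<^sup>+y. ennreal (K * exp (- U z) * h z) * ennreal (?g z y) \<partial>lebE d) \<partial>lebE d)"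
  proof (rule LL.Fubini'[symmetric])
    have "(\<lambda>x. K * exp (- U x) * h x) \<in> borel_measurable Rsp" using mexpU mh by simp
    from m_snd[OF this] mg2 have "(\<lambda>p. ennreal (K * exp (- U (snd p)) * h (snd p)) * ennreal (?g (snd p) (fst p))) \<in> borel_measurable (Rsp \<Otimes>\<^sub>M Rsp)"
      by simp
    then show "(\<lambda>(y, z). ennreal (K * exp (- U z) * h z) * ennreal (?g z y)) \<in> borel_measurable (lebE d \<Otimes>\<^sub>M lebE d)"
      unfolding split_beta' by (rule pair_measurable_lebE)
  qed
  also have "\<dots> = (\<integral>\<^sup>+z. ennreal (K * exp (- U z)) * ennreal (h z) \<partial>lebE d)"
  proof (rule nn_integral_cong)
    fix z
    interpret P: prob_space "gaussE d" by (rule prob_space_gaussE)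
    have "(\<integral>\<^sup>+y. ennreal (?g z y) \<partial>lebE d) = 1"
      using nn_integral_gaussE_affine[of "\<lambda>_. 1" "sqrt s" d z] s P.emeasure_space_1 by simp
    moreover have "(\<integral>\<^sup>+y. ennreal (K * exp (- U z) * h z) * ennreal (?g z y) \<partial>lebE d)
        = ennreal (K * exp (- U z) * h z) * (\<integral>\<^sup>+y. ennreal (?g z y) \<partial>lebE d)"
      by (rule nn_integral_cmult) (use mg1 in simp)
    ultimately show "(\<integral>\<^sup>+y. ennreal (K * exp (- U z) * h z) * ennreal (?g z y) \<partial>lebE d) = ennreal (K * exp (- U z)) * ennreal (h z)"
      using K h(2)[of z] by (simp add: ennreal_mult)
  qed
  finally show ?thesis .
qed

lemma integrable_stationary:
  assumes K: "K > 0" and f: "polyb d f"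
  shows "integrable (density (lebE d) (\<lambda>x. ennreal (K * exp (- U x)))) f"
    and "(\<integral>x. f x \<partial>density (lebE d) (\<lambda>x. ennreal (K * exp (- U x)))) = (\<integral>x. K * exp (- U x) * f x \<partial>lebE d)"
proof -
  have m: "f \<in> borel_measurable (lebE d)" "(\<lambda>x. K * exp (- U x)) \<in> borel_measurable (lebE d)"
    using f measurable_U by (auto simp: polyb_def)
  have "integrable (lebE d) (\<lambda>x. K * (f x * exp (- U x)))"
    by (intro integrable_mult_right integrable_tame[OF f tame_U])
  then show "integrable (density (lebE d) (\<lambda>x. ennreal (K * exp (- U x)))) f"
    using K m by (subst integrable_density) (auto simp: mult_ac)
  show "(\<integral>x. f x \<partial>density (lebE d) (\<lambda>x. ennreal (K * exp (- U x)))) = (\<integral>x. K * exp (- U x) * f x \<partial>lebE d)"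
    using K m by (subst integral_density) auto
qed

lemma polyb_R: "s > 0 \<Longrightarrow> lip d h \<Longrightarrow> polyb d (R s h)"
  by (rule polyb_lipschitz[OF R_lipschitz])

lemma R_nonneg: "s > 0 \<Longrightarrow> lip d h \<Longrightarrow> (\<And>x. h x \<ge> 0) \<Longrightarrow> R s h x \<ge> 0"
  unfolding R_def by (intro integral_nonneg_AE AE_I2 kern_nonneg)

text \<open>The positive and negative parts of a Lipschitz function are Lipschitz with the same
  constant, and \<open>R\<close> is linear.\<close>

lemma R_invariant:
  assumes s: "s > 0" and h: "lip d h" and K: "K > 0"
  shows "(\<integral>x. R s h x \<partial>density (lebE d) (\<lambda>x. ennreal (K * exp (- U x)))) = (\<integral>x. h x \<partial>density (lebE d) (\<lambda>x. ennreal (K * exp (- U x))))"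
proof -
  let ?\<mu> = "density (lebE d) (\<lambda>x. ennreal (K * exp (- U x)))"
  have pos: "(\<integral>x. R s h x \<partial>?\<mu>) = (\<integral>x. h x \<partial>?\<mu>)" if h: "lip d h" "\<And>x. h x \<ge> 0" for h
  proof -
    have i: "integrable (lebE d) (\<lambda>x. K * exp (- U x) * f x)" if "polyb d f" for f
      using integrable_mult_right[of K, OF integrable_tame[OF that tame_U]] by (simp add: mult_ac)
    have "ennreal (\<integral>x. K * exp (- U x) * R s h x \<partial>lebE d) = (\<integral>\<^sup>+x. ennreal (K * exp (- U x) * R s h x) \<partial>lebE d)"
      by (rule nn_integral_eq_integral[symmetric, OF i[OF polyb_R[OF s h(1)]]]) (use K R_nonneg[OF s h] in simp)
    also have "\<dots> = (\<integral>\<^sup>+x. ennreal (K * exp (- U x)) * ennreal (R s h x) \<partial>lebE d)"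
      using K R_nonneg[OF s h] by (simp add: ennreal_mult)
    also have "\<dots> = (\<integral>\<^sup>+x. ennreal (K * exp (- U x)) * ennreal (h x) \<partial>lebE d)" by (rule R_invariant_nn[OF s h K])
    also have "\<dots> = (\<integral>\<^sup>+x. ennreal (K * exp (- U x) * h x) \<partial>lebE d)" using K h(2) by (simp add: ennreal_mult)
    also have "\<dots> = ennreal (\<integral>x. K * exp (- U x) * h x \<partial>lebE d)"
      by (rule nn_integral_eq_integral[OF i[OF lip_polyb[OF h(1)]]]) (use K h(2) in simp)
    finally have "(\<integral>x. K * exp (- U x) * R s h x \<partial>lebE d) = (\<integral>x. K * exp (- U x) * h x \<partial>lebE d)"
      using K R_nonneg[OF s h] h(2) by (simp add: integral_nonneg_AE)
    then show ?thesis by (simp add: integrable_stationary(2)[OF K polyb_R[OF s h(1)]] integrable_stationary(2)[OF K lip_polyb[OF h(1)]])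
  qed
  define p where "p = (\<lambda>x. max (h x) 0)"
  define n where "n = (\<lambda>x. max (- h x) 0)"
  have pn: "lip d p" "lip d n" "\<And>x. p x \<ge> 0" "\<And>x. n x \<ge> 0"
  proof -
    have l: "\<bar>h x - h y\<bar> \<le> vnorm d (\<lambda>i. x i - y i)" for x y using h by (simp add: lip_def)
    have "\<bar>p x - p y\<bar> \<le> \<bar>h x - h y\<bar>" "\<bar>n x - n y\<bar> \<le> \<bar>h x - h y\<bar>" for x y
      by (auto simp: p_def n_def max_def)
    then show "lip d p" "lip d n" using l unfolding lip_def by (meson order_trans)+
  qed (auto simp: p_def n_def)
  have hpn: "h x = p x - n x" for x by (simp add: p_def n_def max_def)
  have "kern s h y = kern s p y - kern s n y" for y
    unfolding kern_def gibbs_diff[OF tame_V[OF s] lip_polyb[OF pn(1)] lip_polyb[OF pn(2)], symmetric] hpn[symmetric] ..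
  then have Rpn: "R s h x = R s p x - R s n x" for x
    unfolding R_def by (simp add: integrable_kern[OF s pn(1)] integrable_kern[OF s pn(2)])
  note i = integrable_stationary(1)[OF K]
  have "(\<integral>x. R s h x \<partial>?\<mu>) = (\<integral>x. R s p x \<partial>?\<mu>) - (\<integral>x. R s n x \<partial>?\<mu>)"
    unfolding Rpn by (rule Bochner_Integration.integral_diff[OF i[OF polyb_R[OF s pn(1)]] i[OF polyb_R[OF s pn(2)]]])
  also have "\<dots> = (\<integral>x. p x \<partial>?\<mu>) - (\<integral>x. n x \<partial>?\<mu>)" using pos[OF pn(1,3)] pos[OF pn(2,4)] by simp
  also have "\<dots> = (\<integral>x. h x \<partial>?\<mu>)"
    unfolding hpn by (rule Bochner_Integration.integral_diff[symmetric, OF i[OF lip_polyb[OF pn(1)]] i[OF lip_polyb[OF pn(2)]]])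
  finally show ?thesis .
qed

end

subsection \<open>The Euler chain\<close>

context langevin
begin

text \<open>Expectation of the bound 2 s^2 |g x|^2 + 4 s |Z|^2 on the squared length of an Euler
  step.\<close>

definition r2 :: "real \<Rightarrow> (nat \<Rightarrow> real) \<Rightarrow> real" where
  "r2 s x = 2 * s\<^sup>2 * (vnorm d (g x))\<^sup>2 + 4 * s * real d"

text \<open>Bound on the L^2 norm of the drift increment over one Euler step from \<open>x\<close>,
  read off from \<open>growth\<close>. The factors 2 and 4 absorb the squaring of a sum and the
  fourth Gaussian moment.\<close>

definition lerr :: "real \<Rightarrow> (nat \<Rightarrow> real) \<Rightarrow> real" where
  "lerr s x = 2 * (a + b * vnorm d x) * sqrt (r2 s x) + 4 * b * r2 s x"

text \<open>Transition operator of the Euler chain.\<close>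

definition Q :: "real \<Rightarrow> ((nat \<Rightarrow> real) \<Rightarrow> real) \<Rightarrow> (nat \<Rightarrow> real) \<Rightarrow> real" where
  "Q s h x = (\<integral>z. h (\<lambda>i. (x i + s * g x i) + sqrt (2 * s) * z i) \<partial>gaussE d)"

lemma r2_nonneg: "s > 0 \<Longrightarrow> r2 s x \<ge> 0"
  by (simp add: r2_def)

lemma lerr_nonneg: "s > 0 \<Longrightarrow> lerr s x \<ge> 0"
  using ab r2_nonneg[of s x] by (simp add: lerr_def)

lemma drift_increment_second_moment:
  assumes s: "s > 0"
  shows "integrable (gaussE d) (\<lambda>z. (vnorm d (\<lambda>i. g x i - g (\<lambda>i. (x i + s * g x i) + sqrt (2 * s) * z i) i))\<^sup>2)"
    and "(\<integral>z. (vnorm d (\<lambda>i. g x i - g (\<lambda>i. (x i + s * g x i) + sqrt (2 * s) * z i) i))\<^sup>2 \<partial>gaussE d) \<le> (lerr s x)\<^sup>2"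
proof -
  interpret prob_space "gaussE d" by (rule prob_space_gaussE)
  let ?G = "\<lambda>z. (vnorm d (\<lambda>i. g x i - g z i))\<^sup>2"
  let ?y = "\<lambda>z i. (x i + s * g x i) + sqrt (2 * s) * z i"
  show i: "integrable (gaussE d) (\<lambda>z. ?G (?y z))"
    by (rule gibbs_quad(1)[where s="2 * s", OF _ polyb_g_diff[of x]]) (use s in \<open>simp_all add: g_emb\<close>)
  define q where "q = vnorm d (g x)"
  define L where "L = a + b * vnorm d x"
  have L: "L \<ge> 0" using ab by (simp add: L_def)
  \<comment> \<open>\<open>p\<close> bounds the squared displacement pointwise in the noise, and its
    mean is exactly \<open>r2 s x\<close>.\<close>
  define p where "p = (\<lambda>z. 2 * s\<^sup>2 * q\<^sup>2 + 4 * s * (vnorm d z)\<^sup>2)"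
  have pw: "?G (?y z) \<le> 2 * L\<^sup>2 * p z + 2 * b\<^sup>2 * (p z)\<^sup>2" for z
  proof -
    define r where "r = vnorm d (\<lambda>i. ?y z i - x i)"
    have "r \<le> s * q + sqrt (2 * s) * vnorm d z"
      unfolding r_def using vnorm_tri[of d "\<lambda>i. s * g x i" "\<lambda>i. sqrt (2 * s) * z i"] s
      by (simp add: vnorm_scale q_def)
    then have "r\<^sup>2 \<le> (s * q + sqrt (2 * s) * vnorm d z)\<^sup>2" by (intro power_mono) (auto simp: r_def)
    also have "\<dots> \<le> 2 * (s * q)\<^sup>2 + 2 * (sqrt (2 * s) * vnorm d z)\<^sup>2"
      using sum_squares_bound[of "s * q" "sqrt (2 * s) * vnorm d z"] by (simp add: power2_sum)
    also have "\<dots> = p z" using s by (simp add: p_def power_mult_distrib)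
    finally have rp: "r\<^sup>2 \<le> p z" .
    have "vnorm d (\<lambda>i. g x i - g (?y z) i) \<le> r * L + b * r\<^sup>2"
      using growth[of "?y z" x] by (simp add: r_def L_def vnorm_minus_commute[of d "g x"])
    then have "?G (?y z) \<le> (r * L + b * r\<^sup>2)\<^sup>2" by (intro power_mono) auto
    also have "\<dots> \<le> 2 * (r * L)\<^sup>2 + 2 * (b * r\<^sup>2)\<^sup>2"
      using sum_squares_bound[of "r * L" "b * r\<^sup>2"] by (simp add: power2_sum)
    also have "\<dots> = 2 * L\<^sup>2 * r\<^sup>2 + 2 * b\<^sup>2 * (r\<^sup>2)\<^sup>2" by (simp add: power_mult_distrib)
    also have "\<dots> \<le> 2 * L\<^sup>2 * p z + 2 * b\<^sup>2 * (p z)\<^sup>2"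
      using rp by (intro add_mono mult_left_mono power_mono) auto
    finally show ?thesis .
  qed
  note v2 = gaussE_vnorm2[of d] and v4 = gaussE_vnorm4[of d]
  have ip: "integrable (gaussE d) p" unfolding p_def using v2(1) by simp
  have p2: "(p z)\<^sup>2 = (2 * s\<^sup>2 * q\<^sup>2)\<^sup>2 + 16 * s ^ 3 * q\<^sup>2 * (vnorm d z)\<^sup>2 + 16 * s\<^sup>2 * vnorm d z ^ 4" for z
    by (simp add: p_def power2_eq_square power3_eq_cube power4_eq_xxxx algebra_simps)
  have ip2: "integrable (gaussE d) (\<lambda>z. (p z)\<^sup>2)" unfolding p2 using v2(1) v4(1) by simp
  have Ep: "(\<integral>z. p z \<partial>gaussE d) = r2 s x"
    unfolding p_def r2_def using v2 prob_space by (simp add: q_def)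
  have "(\<integral>z. (p z)\<^sup>2 \<partial>gaussE d) = (2 * s\<^sup>2 * q\<^sup>2)\<^sup>2 + 16 * s ^ 3 * q\<^sup>2 * real d + 16 * s\<^sup>2 * (\<integral>z. vnorm d z ^ 4 \<partial>gaussE d)"
    unfolding p2 using v2 v4(1) prob_space by simp
  also have "\<dots> \<le> (2 * s\<^sup>2 * q\<^sup>2)\<^sup>2 + 16 * s ^ 3 * q\<^sup>2 * real d + 16 * s\<^sup>2 * (3 * (real d)\<^sup>2)"
    using v4(2) by (intro add_left_mono mult_left_mono) auto
  \<comment> \<open>The bracket is the expanded square of \<open>r2 s x\<close>. Since the fourth
    Gaussian moment is at most 3 d^2, the mean of p^2 is comparable with the square of the mean of
    p, uniformly in d.\<close>
  also have "\<dots> \<le> 6 * ((2 * s\<^sup>2 * q\<^sup>2)\<^sup>2 + 16 * s ^ 3 * q\<^sup>2 * real d + 16 * s\<^sup>2 * (real d)\<^sup>2)"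
  proof -
    have "0 \<le> (2 * s\<^sup>2 * q\<^sup>2)\<^sup>2" "0 \<le> 16 * s ^ 3 * q\<^sup>2 * real d" "0 \<le> 16 * s\<^sup>2 * (real d)\<^sup>2" using s by auto
    moreover have "A + B + 3 * F \<le> 6 * (A + B + F)" if "0 \<le> A" "0 \<le> B" "0 \<le> F" for A B F :: real
      using that by simp
    ultimately show ?thesis by (simp only: mult.left_commute[of _ 3])
  qed
  also have "\<dots> = 6 * (r2 s x)\<^sup>2"
    by (simp add: r2_def q_def power2_eq_square power3_eq_cube algebra_simps)
  finally have Ep2: "(\<integral>z. (p z)\<^sup>2 \<partial>gaussE d) \<le> 6 * (r2 s x)\<^sup>2" .
  have "(\<integral>z. ?G (?y z) \<partial>gaussE d) \<le> (\<integral>z. 2 * L\<^sup>2 * p z + 2 * b\<^sup>2 * (p z)\<^sup>2 \<partial>gaussE d)"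
    using i ip ip2 pw by (intro integral_mono) auto
  also have "\<dots> = 2 * L\<^sup>2 * r2 s x + 2 * b\<^sup>2 * (\<integral>z. (p z)\<^sup>2 \<partial>gaussE d)"
    using ip ip2 Ep by simp
  also have "\<dots> \<le> 2 * L\<^sup>2 * r2 s x + 2 * b\<^sup>2 * (6 * (r2 s x)\<^sup>2)"
    by (intro add_left_mono mult_left_mono Ep2) simp
  also have "\<dots> \<le> (2 * L * sqrt (r2 s x))\<^sup>2 + (4 * b * r2 s x)\<^sup>2"
  proof -
    have "2 * L\<^sup>2 * r2 s x \<le> 4 * L\<^sup>2 * r2 s x" using r2_nonneg[OF s, of x] by (intro mult_right_mono) auto
    moreover have "2 * b\<^sup>2 * (6 * (r2 s x)\<^sup>2) \<le> 16 * b\<^sup>2 * (r2 s x)\<^sup>2" by simp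
    ultimately show ?thesis using r2_nonneg[OF s, of x] by (simp add: power_mult_distrib)
  qed
  also have "\<dots> \<le> (lerr s x)\<^sup>2"
  proof -
    have "0 \<le> (2 * L * sqrt (r2 s x)) * (4 * b * r2 s x)" using L ab r2_nonneg[OF s, of x] by simp
    then show ?thesis unfolding lerr_def L_def[symmetric] power2_sum by linarith
  qed
  finally show "(\<integral>z. ?G (?y z) \<partial>gaussE d) \<le> (lerr s x)\<^sup>2" .
qed

text \<open>With the first Gaussian half shared, the steps are compared conditionally by
  \<open>kern_gaussian_error\<close>. Young's inequality t <= s M / (2 \<beta>) + s \<beta> / 2
  avoids the square root of M, so that only the mean of M enters: the second moment of the drift
  increment over a full Euler step.\<close>

lemma step_error:
  assumes s: "s > 0" and h: "lip d h"
  shows "\<bar>Q s h x - R s h x\<bar> \<le> s * lerr s x"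
proof (rule field_le_epsilon)
  fix e :: real assume e: "e > 0"
  interpret prob_space "gaussE d" by (rule prob_space_gaussE)
  \<comment> \<open>The weight in Young's inequality; \<open>e / s\<close> keeps it positive when
    \<open>lerr s x\<close> vanishes and costs \<open>e\<close> in the end.\<close>
  define \<beta> where "\<beta> = lerr s x + e / s"
  have \<beta>: "\<beta> > 0" using lerr_nonneg[OF s, of x] e s by (simp add: \<beta>_def add_nonneg_pos)
  let ?G = "\<lambda>z. (vnorm d (\<lambda>i. g x i - g z i))\<^sup>2"
  let ?A = "\<lambda>i. x i + s * g x i"
  define f where "f = (\<lambda>w. h (\<lambda>i. ?A i + sqrt s * w i))"
  define k where "k = (\<lambda>w. ?G (\<lambda>i. ?A i + sqrt s * w i))"
  define N where "N = (\<lambda>z. gibbs d (quad d s (\<lambda>i. (x i + sqrt s * z i) + s * g x i)) h)"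
  define M where "M = (\<lambda>z. gibbs d (quad d s (\<lambda>i. (x i + sqrt s * z i) + s * g x i)) ?G)"
  \<comment> \<open>Two halves of size sqrt s recombine into the Euler noise of size sqrt (2
    s).\<close>
  have sq: "(\<lambda>i. ?A i + sqrt s * (sqrt 2 * z i)) = (\<lambda>i. ?A i + sqrt (2 * s) * z i)" for z
    by (simp add: real_sqrt_mult mult_ac)
  have sq2: "(\<lambda>i. ((x i + sqrt s * z i) + s * g x i) + sqrt s * z' i) = (\<lambda>i. ?A i + sqrt s * (z i + z' i))" for z z'
    by (simp add: algebra_simps)
  have Neq: "N z = (\<integral>z'. f (\<lambda>i. z i + z' i) \<partial>gaussE d)" for z
    unfolding N_def f_def sq2[symmetric] by (rule gibbs_quad(2)[OF s lip_polyb[OF h] lip_emb[OF h]])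
  have Meq: "M z = (\<integral>z'. k (\<lambda>i. z i + z' i) \<partial>gaussE d)" for z
    unfolding M_def k_def sq2[symmetric] by (rule gibbs_quad(2)[OF s polyb_g_diff[of x]]) (simp add: g_emb)
  have fm: "f \<in> borel_measurable Rsp"
    unfolding f_def using measurable_compose[OF measurable_affine_Rsp lip_measurable[OF h]] .
  have km: "k \<in> borel_measurable Rsp"
    unfolding k_def using measurable_compose[OF measurable_affine_Rsp polyb_measurable[OF polyb_g_diff[of x]]] .
  have fi: "integrable (gaussE d) (\<lambda>z. f (\<lambda>i. sqrt 2 * z i))"
    unfolding f_def sq by (rule integrable_gaussE_lip[where L=1]) (use h in \<open>simp add: lip_def\<close>)
  have ki: "integrable (gaussE d) (\<lambda>z. k (\<lambda>i. sqrt 2 * z i))"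
    unfolding k_def sq by (rule drift_increment_second_moment(1)[OF s])
  have Ni: "integrable (gaussE d) N" unfolding Neq[abs_def] by (rule integral_gaussE_sum(1)[OF fm fi])
  have Mi: "integrable (gaussE d) M" unfolding Meq[abs_def] by (rule integral_gaussE_sum(1)[OF km ki])
  have NQ: "(\<integral>z. N z \<partial>gaussE d) = Q s h x"
    unfolding Neq integral_gaussE_sum(2)[OF fm fi] Q_def unfolding f_def sq ..
  have ME: "(\<integral>z. M z \<partial>gaussE d) \<le> (lerr s x)\<^sup>2"
    unfolding Meq integral_gaussE_sum(2)[OF km ki] unfolding k_def sq by (rule drift_increment_second_moment(2)[OF s])
  let ?K = "\<lambda>z. kern s h (\<lambda>i. x i + sqrt s * z i)"
  have pw: "\<bar>N z - ?K z\<bar> \<le> s / (2 * \<beta>) * M z + s * \<beta> / 2" for z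
  proof -
    define t where "t = \<bar>N z - ?K z\<bar>"
    have "t\<^sup>2 \<le> s\<^sup>2 * M z"
      unfolding t_def N_def M_def power2_abs by (rule kern_gaussian_error[OF s h])
    moreover have "0 \<le> (t - s * \<beta>)\<^sup>2" by simp
    ultimately have "2 * t * (s * \<beta>) \<le> s\<^sup>2 * M z + (s * \<beta>)\<^sup>2" by (simp add: power2_diff)
    then have "t \<le> (s\<^sup>2 * M z + (s * \<beta>)\<^sup>2) / (2 * (s * \<beta>))"
      using s \<beta> by (simp add: pos_le_divide_eq mult_ac)
    also have "\<dots> = s / (2 * \<beta>) * M z + s * \<beta> / 2"
      using s \<beta> by (simp add: power2_eq_square field_simps)
    finally show ?thesis by (simp add: t_def)
  qed
  have "\<bar>Q s h x - R s h x\<bar> = \<bar>\<integral>z. (N z - ?K z) \<partial>gaussE d\<bar>"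
    using Ni integrable_kern[OF s h, of x] NQ by (simp add: R_def)
  also have "\<dots> \<le> (\<integral>z. \<bar>N z - ?K z\<bar> \<partial>gaussE d)" by (rule integral_abs_bound)
  also have "\<dots> \<le> (\<integral>z. s / (2 * \<beta>) * M z + s * \<beta> / 2 \<partial>gaussE d)"
    using Ni Mi integrable_kern[OF s h, of x] pw by (intro integral_mono) auto
  also have "\<dots> = s / (2 * \<beta>) * (\<integral>z. M z \<partial>gaussE d) + s * \<beta> / 2" using Mi prob_space by simp
  also have "\<dots> \<le> s / (2 * \<beta>) * \<beta>\<^sup>2 + s * \<beta> / 2"
  proof -
    have "(lerr s x)\<^sup>2 \<le> \<beta>\<^sup>2" using lerr_nonneg[OF s, of x] e s by (intro power_mono) (auto simp: \<beta>_def)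
    then have "(\<integral>z. M z \<partial>gaussE d) \<le> \<beta>\<^sup>2" using ME by linarith
    then show ?thesis using s \<beta> by (intro add_right_mono mult_left_mono) auto
  qed
  also have "\<dots> = s * \<beta>" using \<beta> by (simp add: power2_eq_square field_simps)
  also have "\<dots> = s * lerr s x + e" using s by (simp add: \<beta>_def field_simps)
  finally show "\<bar>Q s h x - R s h x\<bar> \<le> s * lerr s x + e" .
qed

lemma measurable_step:
  assumes "sets N = sets Rsp"
  shows "(\<lambda>p i. (fst p i + s * g (fst p) i) + sqrt (2 * s) * snd p i) \<in> measurable (N \<Otimes>\<^sub>M gaussE d) Rsp"
proof -
  have "(\<lambda>p i. (fst p i + s * g (fst p) i) + sqrt (2 * s) * snd p i) \<in> measurable (Rsp \<Otimes>\<^sub>M Rsp) Rsp"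
  proof (rule measurable_into_Rsp)
    fix i
    have gf: "(\<lambda>p. g (fst p) i) \<in> borel_measurable (Rsp \<Otimes>\<^sub>M Rsp)"
      by (rule measurable_compose[OF measurable_fst measurable_g])
    show "(\<lambda>p. (fst p i + s * g (fst p) i) + sqrt (2 * s) * snd p i) \<in> borel_measurable (Rsp \<Otimes>\<^sub>M Rsp)"
      by (intro borel_measurable_add borel_measurable_times borel_measurable_const gf measurable_Rsp_component_fst measurable_Rsp_component_snd)
  qed
  moreover have "sets (N \<Otimes>\<^sub>M gaussE d) = sets (Rsp \<Otimes>\<^sub>M Rsp)" using assms by (intro sets_pair_measure_cong) auto
  ultimately show ?thesis using measurable_cong_sets by blast
qed

end

text \<open>A stationary law of the Euler chain. The finite second moment of the drift is assumed
  here; when it is infinite, so is the bound to be proved.\<close>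

locale langevin_chain = langevin +
  fixes s :: real and N :: "(nat \<Rightarrow> real) measure"
  assumes s: "s > 0" and prob_N: "prob_space N" and sets_N: "sets N = sets Rsp"
    and invariant: "distr (N \<Otimes>\<^sub>M gaussE d) Rsp (\<lambda>p i. (fst p i + s * g (fst p) i) + sqrt (2 * s) * snd p i) = N"
    and drift_moment: "integrable N (\<lambda>x. (vnorm d (g x))\<^sup>2)"
begin

sublocale N: prob_space N by (rule prob_N)
sublocale Z: prob_space "gaussE d" by (rule prob_space_gaussE)
sublocale NZ: pair_prob_space N "gaussE d" ..

lemma measurable_N: "f \<in> borel_measurable Rsp \<Longrightarrow> f \<in> borel_measurable N" for f :: "_ \<Rightarrow> real"
  using measurable_cong_sets[OF sets_N refl] by blast

lemma invariant_integral:
  fixes f :: "(nat \<Rightarrow> real) \<Rightarrow> real"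
  assumes f: "f \<in> borel_measurable Rsp" and i: "integrable N f"
  shows "integrable N (\<lambda>x. \<integral>z. f (\<lambda>i. (x i + s * g x i) + sqrt (2 * s) * z i) \<partial>gaussE d)"
    and "(\<integral>x. (\<integral>z. f (\<lambda>i. (x i + s * g x i) + sqrt (2 * s) * z i) \<partial>gaussE d) \<partial>N) = (\<integral>x. f x \<partial>N)"
proof -
  note m = measurable_step[OF sets_N, of s]
  have "integrable (distr (N \<Otimes>\<^sub>M gaussE d) Rsp (\<lambda>p i. (fst p i + s * g (fst p) i) + sqrt (2 * s) * snd p i)) f"
    using i by (simp only: invariant)
  then have ii: "integrable (N \<Otimes>\<^sub>M gaussE d) (\<lambda>p. f (\<lambda>i. (fst p i + s * g (fst p) i) + sqrt (2 * s) * snd p i))"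
    by (rule integrable_distr[OF m])
  show "integrable N (\<lambda>x. \<integral>z. f (\<lambda>i. (x i + s * g x i) + sqrt (2 * s) * z i) \<partial>gaussE d)"
    using NZ.integrable_fst'[OF ii] by simp
  have "(\<integral>x. (\<integral>z. f (\<lambda>i. (x i + s * g x i) + sqrt (2 * s) * z i) \<partial>gaussE d) \<partial>N)
      = (\<integral>p. f (\<lambda>i. (fst p i + s * g (fst p) i) + sqrt (2 * s) * snd p i) \<partial>(N \<Otimes>\<^sub>M gaussE d))"
    using NZ.integral_fst'[OF ii] by simp
  also have "\<dots> = (\<integral>x. f x \<partial>distr (N \<Otimes>\<^sub>M gaussE d) Rsp (\<lambda>p i. (fst p i + s * g (fst p) i) + sqrt (2 * s) * snd p i))"
    by (rule integral_distr[OF m f, symmetric])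
  also have "\<dots> = (\<integral>x. f x \<partial>N)" by (simp only: invariant)
  finally show "(\<integral>x. (\<integral>z. f (\<lambda>i. (x i + s * g x i) + sqrt (2 * s) * z i) \<partial>gaussE d) \<partial>N) = (\<integral>x. f x \<partial>N)" .
qed

abbreviation g0 :: real where "g0 \<equiv> vnorm d (g (\<lambda>_. 0))"

text \<open>Dissipativity relative to the origin with Cauchy--Schwarz. This coercivity lets moments
  of the drift control moments of the state.\<close>

lemma vnorm_le_g: "\<theta> * vnorm d x \<le> vnorm d (g x) + g0"
proof -
  define r where "r = vnorm d x"
  have "\<theta> * r\<^sup>2 \<le> - vinner d x (\<lambda>i. g x i - g (\<lambda>_. 0) i)"
    using dissipative[of x "\<lambda>_. 0"] by (simp add: r_def)
  also have "\<dots> \<le> r * vnorm d (\<lambda>i. g x i - g (\<lambda>_. 0) i)"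
    using vinner_abs_le[of d x "\<lambda>i. g x i - g (\<lambda>_. 0) i"] by (simp add: r_def)
  also have "\<dots> \<le> r * (vnorm d (g x) + g0)" by (intro mult_left_mono vnorm_tri_diff) (simp add: r_def)
  finally have *: "r * (\<theta> * r) \<le> r * (vnorm d (g x) + g0)" by (simp add: power2_eq_square mult_ac)
  show ?thesis
  proof (cases "r = 0")
    case False
    then have "r > 0" using vnorm_nonneg[of d x] unfolding r_def by linarith
    then show ?thesis using * by (simp add: r_def)
  qed (simp add: r_def[symmetric])
qed

lemma integrable_vnorm2: "integrable N (\<lambda>x. (vnorm d x)\<^sup>2)"
proof (rule Bochner_Integration.integrable_bound)
  show "integrable N (\<lambda>x. (2 * (vnorm d (g x))\<^sup>2 + 2 * g0\<^sup>2) / \<theta>\<^sup>2)"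
    using drift_moment by simp
  show "(\<lambda>x. (vnorm d x)\<^sup>2) \<in> borel_measurable N"
    by (rule measurable_N, rule borel_measurable_power, rule measurable_vnorm, rule measurable_Rsp_component)
  show "AE x in N. norm ((vnorm d x)\<^sup>2) \<le> norm ((2 * (vnorm d (g x))\<^sup>2 + 2 * g0\<^sup>2) / \<theta>\<^sup>2)"
  proof (rule AE_I2)
    fix x
    have "(\<theta> * vnorm d x)\<^sup>2 \<le> (vnorm d (g x) + g0)\<^sup>2" using vnorm_le_g[of x] \<theta>_pos by (intro power_mono) auto
    also have "\<dots> \<le> 2 * (vnorm d (g x))\<^sup>2 + 2 * g0\<^sup>2"
      using sum_squares_bound[of "vnorm d (g x)" g0] by (simp add: power2_sum)
    finally have "(vnorm d x)\<^sup>2 \<le> (2 * (vnorm d (g x))\<^sup>2 + 2 * g0\<^sup>2) / \<theta>\<^sup>2"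
      using \<theta>_pos by (simp add: power_mult_distrib pos_le_divide_eq mult.commute)
    then show "norm ((vnorm d x)\<^sup>2) \<le> norm ((2 * (vnorm d (g x))\<^sup>2 + 2 * g0\<^sup>2) / \<theta>\<^sup>2)" by simp
  qed
qed

lemma integrable_lin:
  assumes m: "f \<in> borel_measurable N" and le: "\<And>x. \<bar>f x\<bar> \<le> A + B * (vnorm d x)\<^sup>2 + C * (vnorm d (g x))\<^sup>2"
  shows "integrable N f"
proof (rule Bochner_Integration.integrable_bound[OF _ m])
  show "integrable N (\<lambda>x. A + B * (vnorm d x)\<^sup>2 + C * (vnorm d (g x))\<^sup>2)"
    using integrable_vnorm2 drift_moment by simp
  show "AE x in N. norm (f x) \<le> norm (A + B * (vnorm d x)\<^sup>2 + C * (vnorm d (g x))\<^sup>2)"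
    using le by (intro AE_I2) (simp add: order_trans[OF _ abs_ge_self])
qed

abbreviation G2 :: real where "G2 \<equiv> (\<integral>x. (vnorm d (g x))\<^sup>2 \<partial>N)"

text \<open>Stationarity applied to |x|^2 gives 2 E <x, g x> + s E |g x|^2 + 2 d = 0, and
  dissipativity with Young's inequality bounds the first term by - \<theta> E |x|^2 plus a constant.
  Integrability of |x|^2, which is needed to cancel it, comes from
  \<open>drift_moment\<close>.\<close>

lemma second_moment: "\<theta> / 2 * (\<integral>x. (vnorm d x)\<^sup>2 \<partial>N) \<le> g0\<^sup>2 / (2 * \<theta>) + s * G2 / 2 + real d"
proof -
  let ?I = "\<lambda>x. vinner d x (g x)"
  have mI: "?I \<in> borel_measurable N"
    by (rule measurable_N, rule measurable_vinner, rule measurable_Rsp_component, rule measurable_g)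
  have iI: "integrable N ?I"
  proof (rule integrable_lin[OF mI, where A=0 and B="1/2" and C="1/2"])
    fix x show "\<bar>?I x\<bar> \<le> 0 + 1 / 2 * (vnorm d x)\<^sup>2 + 1 / 2 * (vnorm d (g x))\<^sup>2"
      using vinner_abs_le[of d x "g x"] sum_squares_bound[of "vnorm d x" "vnorm d (g x)"] by simp
  qed
  have step: "(\<integral>z. (vnorm d (\<lambda>i. (x i + s * g x i) + sqrt (2 * s) * z i))\<^sup>2 \<partial>gaussE d)
     = (vnorm d x)\<^sup>2 + 2 * s * ?I x + s\<^sup>2 * (vnorm d (g x))\<^sup>2 + 2 * s * real d" for x
  proof -
    have e: "(vnorm d (\<lambda>i. (x i + s * g x i) + sqrt (2 * s) * z i))\<^sup>2
       = (vnorm d (\<lambda>i. x i + s * g x i))\<^sup>2 + 2 * sqrt (2 * s) * vinner d (\<lambda>i. x i + s * g x i) z + 2 * s * (vnorm d z)\<^sup>2" for z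
      using s by (simp add: vnorm_sq_add vinner_scale_right vnorm_scale power_mult_distrib)
    have "(\<integral>z. (vnorm d (\<lambda>i. (x i + s * g x i) + sqrt (2 * s) * z i))\<^sup>2 \<partial>gaussE d)
       = (vnorm d (\<lambda>i. x i + s * g x i))\<^sup>2 + 2 * s * real d"
      unfolding e using gaussE_vnorm2[of d] gaussE_vinner[of d "\<lambda>i. x i + s * g x i"] Z.prob_space by simp
    also have "(vnorm d (\<lambda>i. x i + s * g x i))\<^sup>2 = (vnorm d x)\<^sup>2 + 2 * s * ?I x + s\<^sup>2 * (vnorm d (g x))\<^sup>2"
      using s by (simp add: vnorm_sq_add vinner_scale_right vnorm_scale power_mult_distrib)
    finally show ?thesis by simp
  qed
  have m2: "(\<lambda>x. (vnorm d x)\<^sup>2) \<in> borel_measurable Rsp"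
    by (rule borel_measurable_power, rule measurable_vnorm, rule measurable_Rsp_component)
  have "(\<integral>x. (vnorm d x)\<^sup>2 \<partial>N) = (\<integral>x. (vnorm d x)\<^sup>2 + 2 * s * ?I x + s\<^sup>2 * (vnorm d (g x))\<^sup>2 + 2 * s * real d \<partial>N)"
    unfolding invariant_integral(2)[OF m2 integrable_vnorm2, symmetric] step ..
  also have "\<dots> = (\<integral>x. (vnorm d x)\<^sup>2 \<partial>N) + 2 * s * (\<integral>x. ?I x \<partial>N) + s\<^sup>2 * G2 + 2 * s * real d"
    using integrable_vnorm2 iI drift_moment N.prob_space by simp
  finally have "s * (2 * (\<integral>x. ?I x \<partial>N) + s * G2 + 2 * real d) = 0" by (simp add: power2_eq_square algebra_simps)
  then have eq: "2 * (\<integral>x. ?I x \<partial>N) + s * G2 + 2 * real d = 0" using s by simp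
  have "(\<integral>x. ?I x \<partial>N) \<le> (\<integral>x. - (\<theta> / 2) * (vnorm d x)\<^sup>2 + g0\<^sup>2 / (2 * \<theta>) \<partial>N)"
  proof (rule integral_mono[OF iI])
    show "integrable N (\<lambda>x. - (\<theta> / 2) * (vnorm d x)\<^sup>2 + g0\<^sup>2 / (2 * \<theta>))" using integrable_vnorm2 by simp
    fix x
    have "?I x \<le> vinner d x (g (\<lambda>_. 0)) - \<theta> * (vnorm d x)\<^sup>2"
      using dissipative[of x "\<lambda>_. 0"] by (simp add: vinner_diff_right)
    moreover have "vinner d x (g (\<lambda>_. 0)) \<le> vnorm d x * g0" by (rule vinner_le)
    moreover have "0 \<le> (\<theta> * vnorm d x - g0)\<^sup>2 / (2 * \<theta>)" using \<theta>_pos by simp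
    moreover have "(\<theta> * vnorm d x - g0)\<^sup>2 / (2 * \<theta>) = \<theta> / 2 * (vnorm d x)\<^sup>2 + g0\<^sup>2 / (2 * \<theta>) - vnorm d x * g0"
      using \<theta>_pos by (simp add: power2_eq_square field_simps)
    ultimately show "?I x \<le> - (\<theta> / 2) * (vnorm d x)\<^sup>2 + g0\<^sup>2 / (2 * \<theta>)" by linarith
  qed
  also have "\<dots> = - (\<theta> / 2) * (\<integral>x. (vnorm d x)\<^sup>2 \<partial>N) + g0\<^sup>2 / (2 * \<theta>)"
    using integrable_vnorm2 N.prob_space by simp
  finally show ?thesis using eq by linarith
qed

end

context langevin_chain
begin

text \<open>Each mixed product is split by Young's inequality. The powers are then aligned using s
  <= sqrt s, which needs s <= 1, and sqrt d <= d, which needs d >= 1.\<close>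

lemma lerr_le:
  assumes s1: "s \<le> 1" and d: "d \<ge> 1"
  shows "lerr s x \<le> (8 * a + 18 * b) * (sqrt s * real d) + 4 * b * sqrt s * (vnorm d x)\<^sup>2 + (4 * a + 10 * b) * s * (vnorm d (g x))\<^sup>2"
proof -
  define q where "q = vnorm d (g x)"
  define r where "r = vnorm d x"
  define t where "t = sqrt s"
  define D where "D = real d"
  have nn: "q \<ge> 0" "r \<ge> 0" "t > 0" "D \<ge> 1" "t \<le> 1" using s s1 d by (auto simp: q_def r_def t_def D_def)
  have st: "s = t * t" using s by (simp add: t_def)
  have sle: "s \<le> t" using nn by (simp add: st mult_left_le)
  have sq: "sqrt (r2 s x) \<le> 2 * s * q + 2 * t * sqrt D"
  proof (rule real_le_lsqrt)
    show "0 \<le> 2 * s * q + 2 * t * sqrt D" using nn s by simp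
    have "(2 * s * q + 2 * t * sqrt D)\<^sup>2 = 4 * s\<^sup>2 * q\<^sup>2 + 4 * s * D + 8 * s * q * t * sqrt D"
      using nn by (simp add: power2_sum power_mult_distrib st power2_eq_square[of t])
    moreover have "0 \<le> 8 * s * q * t * sqrt D" using nn s by simp
    moreover have "2 * s\<^sup>2 * q\<^sup>2 \<le> 4 * s\<^sup>2 * q\<^sup>2" by (intro mult_right_mono) auto
    ultimately show "r2 s x \<le> (2 * s * q + 2 * t * sqrt D)\<^sup>2" by (simp add: r2_def q_def D_def)
  qed
  have sD: "sqrt D \<le> D" using nn by (simp add: real_le_lsqrt power2_eq_square mult_left_le)
  have q1: "q \<le> 1 + q\<^sup>2"
  proof -
    have "0 \<le> (q - 1)\<^sup>2" by simp
    then show ?thesis using nn(1) by (simp add: power2_diff)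
  qed
  have rq: "2 * (r * q) \<le> r\<^sup>2 + q\<^sup>2" using sum_squares_bound[of r q] by simp
  have rD: "2 * (r * sqrt D) \<le> r\<^sup>2 + D" using sum_squares_bound[of r "sqrt D"] nn by simp
  have "2 * (a + b * r) * sqrt (r2 s x) \<le> 2 * (a + b * r) * (2 * s * q + 2 * t * sqrt D)"
    using nn ab sq by (intro mult_left_mono) auto
  also have "\<dots> = 4 * a * s * q + 4 * a * t * sqrt D + 2 * b * s * (2 * (r * q)) + 2 * b * t * (2 * (r * sqrt D))"
    by (simp add: algebra_simps)
  also have "\<dots> \<le> 4 * a * s * (1 + q\<^sup>2) + 4 * a * t * D + 2 * b * s * (r\<^sup>2 + q\<^sup>2) + 2 * b * t * (r\<^sup>2 + D)"
    using nn ab s by (intro add_mono mult_left_mono q1 sD rq rD) auto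
  finally have 1: "2 * (a + b * r) * sqrt (r2 s x)
      \<le> 4 * a * s * (1 + q\<^sup>2) + 4 * a * t * D + 2 * b * s * (r\<^sup>2 + q\<^sup>2) + 2 * b * t * (r\<^sup>2 + D)" .
  have s2: "s\<^sup>2 \<le> s" using s s1 by (simp add: power2_eq_square mult_left_le)
  have 2: "4 * b * r2 s x \<le> 8 * b * s * q\<^sup>2 + 16 * b * t * D"
  proof -
    have "8 * b * q\<^sup>2 * s\<^sup>2 \<le> 8 * b * q\<^sup>2 * s" using s2 ab by (intro mult_left_mono) auto
    moreover have "16 * b * D * s \<le> 16 * b * D * t" using sle ab nn by (intro mult_left_mono) auto
    ultimately show ?thesis by (simp add: r2_def q_def D_def algebra_simps)
  qed
  have 3: "4 * a * s \<le> 4 * a * (t * D)"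
  proof -
    have "t * 1 \<le> t * D" using nn by (intro mult_left_mono) auto
    then have "s \<le> t * D" using sle by linarith
    then show ?thesis using ab by (intro mult_left_mono) auto
  qed
  have 4: "2 * b * r\<^sup>2 * s \<le> 2 * b * r\<^sup>2 * t" using sle ab by (intro mult_left_mono) auto
  have "lerr s x \<le> (4 * a * s * (1 + q\<^sup>2) + 4 * a * t * D + 2 * b * s * (r\<^sup>2 + q\<^sup>2) + 2 * b * t * (r\<^sup>2 + D)) + (8 * b * s * q\<^sup>2 + 16 * b * t * D)"
    unfolding lerr_def using 1 2 by (simp add: r_def)
  also have "\<dots> \<le> (8 * a + 18 * b) * (t * D) + 4 * b * t * r\<^sup>2 + (4 * a + 10 * b) * s * q\<^sup>2"
    using 3 4 by (simp add: algebra_simps)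
  finally show ?thesis by (simp add: q_def r_def t_def D_def)
qed

lemma measurable_lerr: "lerr s \<in> borel_measurable N"
proof (rule measurable_N)
  have m: "(\<lambda>x. vnorm d x) \<in> borel_measurable Rsp" "(\<lambda>x. vnorm d (g x)) \<in> borel_measurable Rsp"
    by (rule measurable_vnorm, rule measurable_Rsp_component, rule measurable_vnorm, rule measurable_g)
  then show "lerr s \<in> borel_measurable Rsp"
    unfolding lerr_def[abs_def] r2_def by measurable
qed

lemma integrable_lerr:
  assumes "s \<le> 1" "d \<ge> 1"
  shows "integrable N (lerr s)"
proof (rule integrable_lin[OF measurable_lerr])
  fix x
  show "\<bar>lerr s x\<bar> \<le> (8 * a + 18 * b) * (sqrt s * real d) + 4 * b * sqrt s * (vnorm d x)\<^sup>2 + ((4 * a + 10 * b) * s) * (vnorm d (g x))\<^sup>2"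
    using lerr_le[OF assms, of x] lerr_nonneg[OF s, of x] by simp
qed

text \<open>The second moment of the state is exchanged for d + s G2. The drift at the origin enters
  only through the upper bound \<open>\<tau>\<close>, so that the constant can be expressed by
  \<theta>4.\<close>

lemma lerr_mean:
  assumes s1: "s \<le> 1" and d: "d \<ge> 1" and \<tau>: "g0 \<le> \<tau>"
  shows "(\<integral>x. lerr s x \<partial>N) \<le> (8 * a + 18 * b + 4 * b * (\<tau>\<^sup>2 / \<theta>\<^sup>2 + 3 / \<theta>)) * (sqrt s * real d + s * G2)"
proof -
  define t where "t = sqrt s"
  define D where "D = real d"
  define E where "E = (\<integral>x. (vnorm d x)\<^sup>2 \<partial>N)"
  define C where "C = \<tau>\<^sup>2 / \<theta>\<^sup>2 + 3 / \<theta>"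
  have nn: "t \<ge> 0" "t \<le> 1" "D \<ge> 1" "G2 \<ge> 0" "C \<ge> 0"
    using s s1 d \<theta>_pos by (auto simp: t_def D_def C_def)
  have sG: "s * G2 \<ge> 0" using nn s by simp
  have E: "E \<le> C * (D + s * G2)"
  proof -
    have "\<theta> / 2 * E \<le> g0\<^sup>2 / (2 * \<theta>) + s * G2 / 2 + D" using second_moment by (simp add: E_def D_def)
    then have "E \<le> (g0\<^sup>2 / (2 * \<theta>) + s * G2 / 2 + D) * (2 / \<theta>)"
      using \<theta>_pos by (simp add: pos_le_divide_eq mult.commute)
    also have "\<dots> = g0\<^sup>2 / \<theta>\<^sup>2 + 1 / \<theta> * (s * G2) + 2 / \<theta> * D"
      using \<theta>_pos by (simp add: field_simps power2_eq_square)
    also have "\<dots> \<le> \<tau>\<^sup>2 / \<theta>\<^sup>2 * (D + s * G2) + 1 / \<theta> * (D + s * G2) + 2 / \<theta> * (D + s * G2)"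
    proof (intro add_mono)
      have "g0\<^sup>2 / \<theta>\<^sup>2 \<le> \<tau>\<^sup>2 / \<theta>\<^sup>2 * 1" using \<tau> \<theta>_pos by (simp add: divide_right_mono power_mono)
      also have "\<dots> \<le> \<tau>\<^sup>2 / \<theta>\<^sup>2 * (D + s * G2)" using nn sG by (intro mult_left_mono) auto
      finally show "g0\<^sup>2 / \<theta>\<^sup>2 \<le> \<tau>\<^sup>2 / \<theta>\<^sup>2 * (D + s * G2)" .
      show "1 / \<theta> * (s * G2) \<le> 1 / \<theta> * (D + s * G2)" using nn \<theta>_pos by (intro mult_left_mono) auto
      show "2 / \<theta> * D \<le> 2 / \<theta> * (D + s * G2)" using nn sG \<theta>_pos by (intro mult_left_mono) auto
    qed
    also have "\<dots> = C * (D + s * G2)" by (simp add: C_def algebra_simps add_divide_distrib)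
    finally show ?thesis .
  qed
  have "(\<integral>x. lerr s x \<partial>N) \<le> (\<integral>x. (8 * a + 18 * b) * (t * D) + 4 * b * t * (vnorm d x)\<^sup>2 + (4 * a + 10 * b) * s * (vnorm d (g x))\<^sup>2 \<partial>N)"
  proof (rule integral_mono[OF integrable_lerr[OF s1 d]])
    show "integrable N (\<lambda>x. (8 * a + 18 * b) * (t * D) + 4 * b * t * (vnorm d x)\<^sup>2 + (4 * a + 10 * b) * s * (vnorm d (g x))\<^sup>2)"
      using integrable_vnorm2 drift_moment by simp
  qed (use lerr_le[OF s1 d] in \<open>simp add: t_def D_def\<close>)
  also have "\<dots> = (8 * a + 18 * b) * (t * D) + 4 * b * t * E + (4 * a + 10 * b) * s * G2"
    using integrable_vnorm2 drift_moment N.prob_space by (simp add: E_def)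
  also have "\<dots> \<le> (8 * a + 18 * b) * (t * D) + 4 * b * (C * (t * D + s * G2)) + (8 * a + 18 * b) * (s * G2)"
  proof (intro add_mono order_refl)
    have "t * E \<le> t * (C * (D + s * G2))" using E nn by (intro mult_left_mono) auto
    also have "\<dots> = C * (t * D + t * (s * G2))" by (simp add: algebra_simps)
    also have "\<dots> \<le> C * (t * D + s * G2)" using nn sG by (intro mult_left_mono add_left_mono) (auto simp: mult_left_le_one_le)
    finally have "4 * b * (t * E) \<le> 4 * b * (C * (t * D + s * G2))" using ab by (intro mult_left_mono) auto
    then show "4 * b * t * E \<le> 4 * b * (C * (t * D + s * G2))" by (simp add: mult.assoc)
    have "(4 * a + 10 * b) * (s * G2) \<le> (8 * a + 18 * b) * (s * G2)" using ab sG by (intro mult_right_mono) auto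
    then show "(4 * a + 10 * b) * s * G2 \<le> (8 * a + 18 * b) * (s * G2)" by (simp add: mult.assoc)
  qed
  also have "\<dots> = (8 * a + 18 * b + 4 * b * C) * (t * D + s * G2)" by (simp add: algebra_simps)
  finally show ?thesis by (simp add: C_def t_def D_def)
qed

lemma integrable_lip_N:
  assumes h: "lip d h" shows "integrable N h"
proof (rule integrable_lin[OF measurable_N[OF lip_measurable[OF h]], where A="\<bar>h (\<lambda>_. 0)\<bar> + 1" and B=1 and C=0])
  fix x
  have "\<bar>h x - h (\<lambda>_. 0)\<bar> \<le> vnorm d x" using h[unfolded lip_def, rule_format, of x "\<lambda>_. 0"] by simp
  moreover have "vnorm d x \<le> 1 + (vnorm d x)\<^sup>2"
  proof -
    have "0 \<le> (vnorm d x - 1)\<^sup>2" by simp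
    then show ?thesis using vnorm_nonneg[of d x] by (simp add: power2_diff del: vnorm_nonneg)
  qed
  ultimately show "\<bar>h x\<bar> \<le> \<bar>h (\<lambda>_. 0)\<bar> + 1 + 1 * (vnorm d x)\<^sup>2 + 0 * (vnorm d (g x))\<^sup>2" by simp
qed

text \<open>Under \<open>N\<close> the test function may be replaced by \<open>Q s h\<close>, which
  is within \<open>s * lerr s\<close> of \<open>R s h\<close>; under \<mu> it may be replaced by
  \<open>R s h\<close> itself. As \<open>R s h\<close> has a smaller Lipschitz constant, the
  discrepancy is bounded by the one-step error plus a contracted copy of itself.\<close>

lemma contraction_iterate:
  assumes s1: "s \<le> 1" and d: "d \<ge> 1" and K: "K > 0" and \<mu>: "\<mu> = density (lebE d) (\<lambda>x. ennreal (K * exp (- U x)))"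
    and P: "prob_space \<mu>" and h: "lip d h"
  shows "\<bar>(\<integral>x. h x \<partial>N) - (\<integral>x. h x \<partial>\<mu>)\<bar>
     \<le> s * (\<integral>x. lerr s x \<partial>N) * (\<Sum>k<n. (1 / (1 + \<theta> * s)) ^ k)
       + (1 / (1 + \<theta> * s)) ^ n * ((\<integral>x. vnorm d x \<partial>N) + (\<integral>x. vnorm d x \<partial>\<mu>))"
  using h
proof (induction n arbitrary: h)
  case 0
  interpret P: prob_space \<mu> by (rule P)
  note h = 0
  have iv: "integrable \<mu> f" if "polyb d f" for f
    unfolding \<mu> by (rule integrable_stationary(1)[OF K that])
  have vl: "lip d (vnorm d)" unfolding lip_def
  proof (intro allI)
    fix x y show "\<bar>vnorm d x - vnorm d y\<bar> \<le> vnorm d (\<lambda>i. x i - y i)"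
      using vnorm_sub_le[of d x y] vnorm_sub_le[of d y x] vnorm_minus_commute[of d x y] by simp
  qed
  define c where "c = h (\<lambda>_. 0)"
  have hc: "\<bar>h x - c\<bar> \<le> vnorm d x" for x using h[unfolded lip_def, rule_format, of x "\<lambda>_. 0"] by (simp add: c_def)
  have "\<bar>(\<integral>x. h x \<partial>N) - c\<bar> \<le> (\<integral>x. vnorm d x \<partial>N)"
  proof -
    have "\<bar>(\<integral>x. h x \<partial>N) - c\<bar> = \<bar>\<integral>x. (h x - c) \<partial>N\<bar>" using integrable_lip_N[OF h] N.prob_space by simp
    also have "\<dots> \<le> (\<integral>x. \<bar>h x - c\<bar> \<partial>N)" by (rule integral_abs_bound)
    also have "\<dots> \<le> (\<integral>x. vnorm d x \<partial>N)"
      using integrable_lip_N[OF h] integrable_lip_N[OF vl] hc by (intro integral_mono) auto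
    finally show ?thesis .
  qed
  moreover have "\<bar>(\<integral>x. h x \<partial>\<mu>) - c\<bar> \<le> (\<integral>x. vnorm d x \<partial>\<mu>)"
  proof -
    have "\<bar>(\<integral>x. h x \<partial>\<mu>) - c\<bar> = \<bar>\<integral>x. (h x - c) \<partial>\<mu>\<bar>" using iv[OF lip_polyb[OF h]] P.prob_space by simp
    also have "\<dots> \<le> (\<integral>x. \<bar>h x - c\<bar> \<partial>\<mu>)" by (rule integral_abs_bound)
    also have "\<dots> \<le> (\<integral>x. vnorm d x \<partial>\<mu>)"
      using iv[OF lip_polyb[OF h]] iv[OF polyb_vnorm] hc by (intro integral_mono) auto
    finally show ?thesis .
  qed
  ultimately show ?case by simp
next
  case (Suc n)
  note h = Suc.prems
  define q where "q = 1 / (1 + \<theta> * s)"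
  have q: "q > 0" using \<theta>_pos s by (simp add: q_def add_pos_pos)
  define M where "M = (\<integral>x. vnorm d x \<partial>N) + (\<integral>x. vnorm d x \<partial>\<mu>)"
  define L where "L = s * (\<integral>x. lerr s x \<partial>N)"
  \<comment> \<open>Division by the contraction factor restores Lipschitz constant 1, which the
    induction hypothesis requires.\<close>
  have h': "lip d (\<lambda>x. (1 / q) * R s h x)"
    unfolding lip_def
  proof (intro allI)
    fix x y
    have "\<bar>(1 / q) * R s h x - (1 / q) * R s h y\<bar> = (1 / q) * \<bar>R s h x - R s h y\<bar>"
      by (subst right_diff_distrib[symmetric]) (use q in \<open>simp add: abs_mult\<close>)
    also have "\<dots> \<le> (1 / q) * (q * vnorm d (\<lambda>i. x i - y i))"
      using R_lipschitz[OF s h, of x y] q by (intro mult_left_mono) (auto simp: q_def)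
    finally show "\<bar>(1 / q) * R s h x - (1 / q) * R s h y\<bar> \<le> vnorm d (\<lambda>i. x i - y i)" using q by simp
  qed
  have iR: "integrable N (R s h)"
    using integrable_mult_right[of q, OF integrable_lip_N[OF h']] q by simp
  have iQ: "integrable N (Q s h)" and EQ: "(\<integral>x. Q s h x \<partial>N) = (\<integral>x. h x \<partial>N)"
    unfolding Q_def[abs_def] by (rule invariant_integral[OF lip_measurable[OF h] integrable_lip_N[OF h]])+
  have "\<bar>(\<integral>x. Q s h x \<partial>N) - (\<integral>x. R s h x \<partial>N)\<bar> = \<bar>\<integral>x. (Q s h x - R s h x) \<partial>N\<bar>" using iQ iR by simp
  also have "\<dots> \<le> (\<integral>x. \<bar>Q s h x - R s h x\<bar> \<partial>N)" by (rule integral_abs_bound)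
  also have "\<dots> \<le> (\<integral>x. s * lerr s x \<partial>N)"
    using iQ iR integrable_lerr[OF s1 d] step_error[OF s h] by (intro integral_mono) auto
  also have "\<dots> = L" by (simp add: L_def)
  finally have 1: "\<bar>(\<integral>x. h x \<partial>N) - (\<integral>x. R s h x \<partial>N)\<bar> \<le> L" by (simp add: EQ)
  have "\<bar>(\<integral>x. (1 / q) * R s h x \<partial>N) - (\<integral>x. (1 / q) * R s h x \<partial>\<mu>)\<bar> \<le> L * (\<Sum>k<n. q ^ k) + q ^ n * M"
    using Suc.IH[OF h'] by (simp only: L_def M_def q_def)
  moreover have "(\<integral>x. (1 / q) * R s h x \<partial>N) - (\<integral>x. (1 / q) * R s h x \<partial>\<mu>) = (1 / q) * ((\<integral>x. R s h x \<partial>N) - (\<integral>x. h x \<partial>\<mu>))"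
    unfolding integral_mult_right_zero right_diff_distrib \<mu> R_invariant[OF s h K] ..
  ultimately have "(1 / q) * \<bar>(\<integral>x. R s h x \<partial>N) - (\<integral>x. h x \<partial>\<mu>)\<bar> \<le> L * (\<Sum>k<n. q ^ k) + q ^ n * M"
    using q by (simp add: abs_mult)
  then have "\<bar>(\<integral>x. R s h x \<partial>N) - (\<integral>x. h x \<partial>\<mu>)\<bar> \<le> (L * (\<Sum>k<n. q ^ k) + q ^ n * M) * q"
    using q by (simp add: pos_divide_le_eq)
  also have "\<dots> = L * (\<Sum>k<n. q ^ Suc k) + q ^ Suc n * M"
    by (simp add: algebra_simps sum_distrib_left)
  finally have "\<bar>(\<integral>x. h x \<partial>N) - (\<integral>x. h x \<partial>\<mu>)\<bar> \<le> L + L * (\<Sum>k<n. q ^ Suc k) + q ^ Suc n * M" using 1 by linarith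
  also have "L + L * (\<Sum>k<n. q ^ Suc k) = L * (\<Sum>k<Suc n. q ^ k)"
    by (simp add: sum.lessThan_Suc_shift distrib_left del: sum.lessThan_Suc)
  finally show ?case by (simp only: L_def M_def q_def)
qed

text \<open>As \<open>n\<close> grows the initial discrepancy disappears, and the geometric series
  sums to (1 + \<theta> s) / (\<theta> s). The factor s of the one-step error cancels, so the final
  error has the order of the mean of \<open>lerr\<close>.\<close>

lemma lip_discrepancy:
  assumes s1: "s \<le> 1" and d: "d \<ge> 1" and K: "K > 0" and \<mu>: "\<mu> = density (lebE d) (\<lambda>x. ennreal (K * exp (- U x)))"
    and P: "prob_space \<mu>" and h: "lip d h" and \<tau>: "g0 \<le> \<tau>"
  shows "\<bar>(\<integral>x. h x \<partial>N) - (\<integral>x. h x \<partial>\<mu>)\<bar>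
     \<le> (1 + \<theta>) / \<theta> * (8 * a + 18 * b + 4 * b * (\<tau>\<^sup>2 / \<theta>\<^sup>2 + 3 / \<theta>)) * (sqrt s * real d + s * G2)"
proof -
  define q where "q = 1 / (1 + \<theta> * s)"
  have ts: "\<theta> * s > 0" using \<theta>_pos s by simp
  have q: "q > 0" "q < 1" using ts by (auto simp: q_def)
  define M where "M = (\<integral>x. vnorm d x \<partial>N) + (\<integral>x. vnorm d x \<partial>\<mu>)"
  define E where "E = (\<integral>x. lerr s x \<partial>N)"
  have E0: "E \<ge> 0" unfolding E_def using lerr_nonneg[OF s] by (intro integral_nonneg_AE) auto
  have le: "\<bar>(\<integral>x. h x \<partial>N) - (\<integral>x. h x \<partial>\<mu>)\<bar> \<le> s * E * (1 / (1 - q)) + q ^ n * M" for n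
  proof -
    have "(\<Sum>k<n. q ^ k) \<le> 1 / (1 - q)"
      using q by (simp add: sum_gp_strict divide_right_mono)
    then have "s * E * (\<Sum>k<n. q ^ k) \<le> s * E * (1 / (1 - q))" using s E0 by (intro mult_left_mono) auto
    then show ?thesis
      using contraction_iterate[OF s1 d K \<mu> P h, of n] unfolding q_def[symmetric] M_def[symmetric] E_def[symmetric] by linarith
  qed
  have "(\<lambda>n. s * E * (1 / (1 - q)) + q ^ n * M) \<longlonglongrightarrow> s * E * (1 / (1 - q)) + 0 * M"
    using q by (intro tendsto_intros LIMSEQ_power_zero) auto
  then have "\<bar>(\<integral>x. h x \<partial>N) - (\<integral>x. h x \<partial>\<mu>)\<bar> \<le> s * E * (1 / (1 - q)) + 0 * M"
    by (rule LIMSEQ_le_const) (use le in auto)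
  also have "\<dots> = (1 + \<theta> * s) / \<theta> * E"
  proof -
    have "1 - q = \<theta> * s / (1 + \<theta> * s)" using ts by (simp add: q_def field_simps)
    then show ?thesis using s \<theta>_pos by simp
  qed
  also have "\<dots> \<le> (1 + \<theta>) / \<theta> * E"
    using s1 \<theta>_pos E0 by (intro mult_right_mono divide_right_mono) (auto simp: mult_left_le)
  also have "\<dots> \<le> (1 + \<theta>) / \<theta> * ((8 * a + 18 * b + 4 * b * (\<tau>\<^sup>2 / \<theta>\<^sup>2 + 3 / \<theta>)) * (sqrt s * real d + s * G2))"
    unfolding E_def using \<theta>_pos by (intro mult_left_mono lerr_mean[OF s1 d \<tau>]) auto
  finally show ?thesis by (simp add: mult.assoc)
qed

end

subsection \<open>Consequences of Assumption A\<close>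

lemma Esp_combine[intro]: "x \<in> Esp d \<Longrightarrow> u \<in> Esp d \<Longrightarrow> (\<lambda>k. x k + t * u k) \<in> Esp d"
  by (simp add: Esp_def)

lemma unitv_Esp: "j < d \<Longrightarrow> unitv j \<in> Esp d"
  by (auto simp: Esp_def unitv_def)

text \<open>A mean value theorem that does not distinguish the sign of the increment.\<close>

lemma real_mean_value:
  fixes \<psi> :: "real \<Rightarrow> real"
  assumes "\<And>t. (\<psi> has_real_derivative \<psi>' t) (at t)"
  shows "\<exists>\<tau>. \<bar>\<tau>\<bar> \<le> \<bar>c\<bar> \<and> \<psi> c - \<psi> 0 = c * \<psi>' \<tau>"
proof (cases c "0 :: real" rule: linorder_cases)
  case less
  from MVT2[OF less, of \<psi> \<psi>'] assms obtain z where "c < z" "z < 0" "\<psi> 0 - \<psi> c = (0 - c) * \<psi>' z" by blast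
  then show ?thesis by (intro exI[of _ z]) (auto simp: algebra_simps)
next
  case equal then show ?thesis by auto
next
  case greater
  from MVT2[OF greater, of \<psi> \<psi>'] assms obtain z where "0 < z" "z < c" "\<psi> c - \<psi> 0 = (c - 0) * \<psi>' z" by blast
  then show ?thesis by (intro exI[of _ z]) auto
qed

text \<open>The displacement t u is made one coordinate at a time. Each move is governed by a
  partial derivative at a point that tends to \<open>x\<close>, and the partial derivatives are
  continuous.\<close>

lemma directional_derivative_zero:
  assumes D: "\<And>j x. j < d \<Longrightarrow> x \<in> Esp d \<Longrightarrow> ((\<lambda>t. f (\<lambda>k. x k + t * unitv j k)) has_real_derivative D j x) (at 0)"
    and cont: "\<And>j. j < d \<Longrightarrow> Econt d (D j)" and x: "x \<in> Esp d" and u: "u \<in> Esp d"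
  shows "((\<lambda>t. f (\<lambda>k. x k + t * u k)) has_real_derivative (\<Sum>j<d. u j * D j x)) (at 0)"
proof -
  have line: "((\<lambda>t. f (\<lambda>k. y k + t * unitv j k)) has_real_derivative D j (\<lambda>k. y k + t * unitv j k)) (at t)"
    if "j < d" "y \<in> Esp d" for j y t
  proof -
    have "(\<lambda>k. y k + t * unitv j k) \<in> Esp d" using that unitv_Esp by blast
    from D[OF that(1) this] have "((\<lambda>h. f (\<lambda>k. y k + (h + t) * unitv j k)) has_real_derivative D j (\<lambda>k. y k + t * unitv j k)) (at 0)"
      by (simp add: algebra_simps)
    then show ?thesis using DERIV_shift[of "\<lambda>t. f (\<lambda>k. y k + t * unitv j k)" "D j (\<lambda>k. y k + t * unitv j k)" 0 t] by simp
  qed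
  define S where "S = (\<Sum>j<d. \<bar>u j\<bar>)"
  have S: "S \<ge> 0" by (simp add: S_def sum_nonneg)
  show ?thesis
    unfolding has_field_derivative_iff
  proof (rule LIM_I)
    fix e :: real assume e: "e > 0"
    define e' where "e' = e / (S + 1)"
    have e': "e' > 0" using e S by (simp add: e'_def)
    have "\<forall>j. \<exists>\<delta>>0. j < d \<longrightarrow> (\<forall>y\<in>Esp d. vnorm d (\<lambda>i. y i - x i) < \<delta> \<longrightarrow> \<bar>D j y - D j x\<bar> < e')"
    proof
      fix j
      show "\<exists>\<delta>>0. j < d \<longrightarrow> (\<forall>y\<in>Esp d. vnorm d (\<lambda>i. y i - x i) < \<delta> \<longrightarrow> \<bar>D j y - D j x\<bar> < e')"
      proof (cases "j < d")
        case True then show ?thesis using cont[OF True] x e' unfolding Econt_def by blast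
      next
        case False then show ?thesis by (intro exI[of _ 1]) auto
      qed
    qed
    then obtain \<delta> where \<delta>: "\<And>j. \<delta> j > 0" "\<And>j y. j < d \<Longrightarrow> y \<in> Esp d \<Longrightarrow> vnorm d (\<lambda>i. y i - x i) < \<delta> j \<Longrightarrow> \<bar>D j y - D j x\<bar> < e'"
      by metis
    define m where "m = Min (insert 1 (\<delta> ` {..<d}))"
    have m: "m > 0" "\<And>j. j < d \<Longrightarrow> m \<le> \<delta> j" using \<delta>(1) by (auto simp: m_def)
    define \<eta> where "\<eta> = m / (vnorm d u + 1)"
    have \<eta>: "\<eta> > 0" using m by (simp add: \<eta>_def add_nonneg_pos)
    have "\<bar>(f (\<lambda>k. x k + t * u k) - f (\<lambda>k. x k + 0 * u k)) / t - (\<Sum>j<d. u j * D j x)\<bar> < e"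
      if t: "t \<noteq> 0" "\<bar>t\<bar> < \<eta>" for t
    proof -
      \<comment> \<open>\<open>p j\<close> has the coordinates below \<open>j\<close> already moved.
        At j = d the whole displacement is done, since \<open>u\<close> vanishes from index
        \<open>d\<close> on.\<close>
      define p where "p = (\<lambda>j k. x k + (if k < j then t * u k else 0))"
      have pE: "p j \<in> Esp d" for j using x u by (auto simp: Esp_def p_def)
      have tel: "(\<Sum>j<d. f (p (Suc j)) - f (p j)) = f (p d) - f (p 0)" by (rule sum_lessThan_telescope)
      have p0: "p 0 = (\<lambda>k. x k + 0 * u k)" and pd: "p d = (\<lambda>k. x k + t * u k)"
        using u by (auto simp: p_def Esp_def fun_eq_iff)
      have step: "\<bar>f (p (Suc j)) - f (p j) - t * u j * D j x\<bar> \<le> \<bar>t\<bar> * \<bar>u j\<bar> * e'" if j: "j < d" for j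
      proof -
        from real_mean_value[of "\<lambda>t. f (\<lambda>k. p j k + t * unitv j k)", OF line[OF j pE], of "t * u j"]
        obtain \<tau> where \<tau>: "\<bar>\<tau>\<bar> \<le> \<bar>t * u j\<bar>"
          "f (\<lambda>k. p j k + t * u j * unitv j k) - f (\<lambda>k. p j k + 0 * unitv j k) = t * u j * D j (\<lambda>k. p j k + \<tau> * unitv j k)"
          by blast
        define y where "y = (\<lambda>k. p j k + \<tau> * unitv j k)"
        have y: "y \<in> Esp d" unfolding y_def using pE unitv_Esp[OF j] by blast
        have "(\<lambda>k. p j k + t * u j * unitv j k) = p (Suc j)" by (auto simp: p_def unitv_def fun_eq_iff less_Suc_eq)
        with \<tau>(2) have eq: "f (p (Suc j)) - f (p j) = t * u j * D j y" by (simp add: y_def)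
        have "vnorm d (\<lambda>i. y i - x i) \<le> vnorm d (\<lambda>i. t * u i)"
          unfolding vnorm_def
        proof (intro real_sqrt_le_mono sum_mono)
          fix i
          have "\<bar>y i - x i\<bar> \<le> \<bar>t * u i\<bar>" using \<tau>(1) by (auto simp: y_def p_def unitv_def)
          then show "(y i - x i)\<^sup>2 \<le> (t * u i)\<^sup>2" by (simp add: abs_le_square_iff)
        qed
        also have "\<dots> = \<bar>t\<bar> * vnorm d u" by (rule vnorm_scale)
        also have "\<dots> \<le> \<bar>t\<bar> * (vnorm d u + 1)" by (intro mult_left_mono) auto
        also have "\<dots> < m" using t(2) by (simp add: \<eta>_def pos_less_divide_eq add_nonneg_pos)
        also have "m \<le> \<delta> j" by (rule m(2)[OF j])
        finally have "\<bar>D j y - D j x\<bar> < e'" by (rule \<delta>(2)[OF j y])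
        then have "\<bar>t * u j\<bar> * \<bar>D j y - D j x\<bar> \<le> \<bar>t * u j\<bar> * e'" by (intro mult_left_mono) auto
        then show ?thesis unfolding eq by (simp add: abs_mult flip: right_diff_distrib)
      qed
      have "f (\<lambda>k. x k + t * u k) - f (\<lambda>k. x k + 0 * u k) - t * (\<Sum>j<d. u j * D j x)
         = (\<Sum>j<d. f (p (Suc j)) - f (p j) - t * u j * D j x)"
        unfolding sum_subtractf[of "\<lambda>j. f (p (Suc j)) - f (p j)"] tel p0 pd by (simp add: sum_distrib_left mult.assoc)
      also have "\<bar>\<dots>\<bar> \<le> (\<Sum>j<d. \<bar>t\<bar> * \<bar>u j\<bar> * e')"
        by (rule order_trans[OF sum_abs]) (intro sum_mono step, simp)
      also have "\<dots> = \<bar>t\<bar> * (S * e')" by (simp add: S_def sum_distrib_left sum_distrib_right mult.assoc)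
      finally have "\<bar>f (\<lambda>k. x k + t * u k) - f (\<lambda>k. x k + 0 * u k) - t * (\<Sum>j<d. u j * D j x)\<bar> \<le> \<bar>t\<bar> * (S * e')" .
      moreover have "(f (\<lambda>k. x k + t * u k) - f (\<lambda>k. x k + 0 * u k)) / t - (\<Sum>j<d. u j * D j x)
         = (f (\<lambda>k. x k + t * u k) - f (\<lambda>k. x k + 0 * u k) - t * (\<Sum>j<d. u j * D j x)) / t"
        using t(1) by (simp add: diff_divide_distrib)
      ultimately have "\<bar>(f (\<lambda>k. x k + t * u k) - f (\<lambda>k. x k + 0 * u k)) / t - (\<Sum>j<d. u j * D j x)\<bar> \<le> S * e'"
        using t(1) by (simp add: abs_divide pos_divide_le_eq mult.commute)
      also have "\<dots> < (S + 1) * e'" using e' by simp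
      also have "\<dots> = e" using S by (simp add: e'_def)
      finally show ?thesis .
    qed
    then show "\<exists>\<eta>>0. \<forall>t. t \<noteq> 0 \<and> norm (t - 0) < \<eta> \<longrightarrow>
        norm ((f (\<lambda>k. x k + t * u k) - f (\<lambda>k. x k + 0 * u k)) / (t - 0) - (\<Sum>j<d. u j * D j x)) < e"
      using \<eta> by (intro exI[of _ \<eta>]) auto
  qed
qed

lemma directional_derivative:
  assumes D: "\<And>j x. j < d \<Longrightarrow> x \<in> Esp d \<Longrightarrow> ((\<lambda>t. f (\<lambda>k. x k + t * unitv j k)) has_real_derivative D j x) (at 0)"
    and cont: "\<And>j. j < d \<Longrightarrow> Econt d (D j)" and x: "x \<in> Esp d" and u: "u \<in> Esp d"
  shows "((\<lambda>t. f (\<lambda>k. x k + t * u k)) has_real_derivative (\<Sum>j<d. u j * D j (\<lambda>k. x k + t * u k))) (at t)"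
proof -
  have "(\<lambda>k. x k + t * u k) \<in> Esp d" using x u by blast
  from directional_derivative_zero[of d f D, OF D cont this u]
  have "((\<lambda>h. f (\<lambda>k. x k + (h + t) * u k)) has_real_derivative (\<Sum>j<d. u j * D j (\<lambda>k. x k + t * u k))) (at 0)"
    by (simp add: algebra_simps)
  then show ?thesis using DERIV_shift[of "\<lambda>t. f (\<lambda>k. x k + t * u k)" _ 0 t] by simp
qed

lemma has_partialD: "has_partial f j x \<Longrightarrow> ((\<lambda>t. f (\<lambda>k. x k + t * unitv j k)) has_real_derivative partial f j x) (at 0)"
  unfolding has_partial_def partial_def by (simp add: DERIV_deriv_iff_real_differentiable)

lemma C2_vecD:
  assumes g: "C2_vec d g" and i: "i < d" and x: "x \<in> Esp d" and u: "u \<in> Esp d"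
  shows dirD_eq: "dirD d u g x i = (\<Sum>j<d. u j * partial (\<lambda>x. g x i) j x)"
    and has_dirD: "((\<lambda>t. g (\<lambda>k. x k + t * u k) i) has_real_derivative dirD d u g (\<lambda>k. x k + t * u k) i) (at t)"
proof -
  have C: "C2_real d (\<lambda>x. g x i)" using g i by (simp add: C2_vec_def)
  have dd: "((\<lambda>t. g (\<lambda>k. y k + t * u k) i) has_real_derivative (\<Sum>j<d. u j * partial (\<lambda>x. g x i) j (\<lambda>k. y k + t * u k))) (at t)"
    if "y \<in> Esp d" for y t
    by (rule directional_derivative[of d "\<lambda>x. g x i"]) (use C that u in \<open>auto simp: C2_real_def intro: has_partialD\<close>)
  have eq: "dirD d u g y i = (\<Sum>j<d. u j * partial (\<lambda>x. g x i) j y)" if "y \<in> Esp d" for y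
    using DERIV_imp_deriv[OF dd[OF that, of 0]] i by (simp add: dirD_def)
  show "dirD d u g x i = (\<Sum>j<d. u j * partial (\<lambda>x. g x i) j x)" by (rule eq[OF x])
  have "(\<lambda>k. x k + t * u k) \<in> Esp d" using x u by blast
  then show "((\<lambda>t. g (\<lambda>k. x k + t * u k) i) has_real_derivative dirD d u g (\<lambda>k. x k + t * u k) i) (at t)"
    using dd[OF x] eq by simp
qed

lemma has_dirD2:
  assumes g: "C2_vec d g" and i: "i < d" and x: "x \<in> Esp d" and u: "u \<in> Esp d" and v: "v \<in> Esp d"
  shows "((\<lambda>t. dirD d v g (\<lambda>k. x k + t * u k) i) has_real_derivative dirD d u (dirD d v g) (\<lambda>k. x k + t * u k) i) (at t)"
proof -
  have C: "C2_real d (\<lambda>x. g x i)" using g i by (simp add: C2_vec_def)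
  let ?P = "\<lambda>j. partial (\<lambda>x. g x i) j"
  have lin: "(\<lambda>k. y k + t * u k) \<in> Esp d" if "y \<in> Esp d" for y t using that u by blast
  have pd: "((\<lambda>t. ?P j (\<lambda>k. y k + t * u k)) has_real_derivative (\<Sum>l<d. u l * partial (?P j) l (\<lambda>k. y k + t * u k))) (at t)"
    if "y \<in> Esp d" "j < d" for y t j
    by (rule directional_derivative[of d "?P j"]) (use C that u in \<open>auto simp: C2_real_def intro: has_partialD\<close>)
  have dd: "((\<lambda>t. dirD d v g (\<lambda>k. y k + t * u k) i) has_real_derivative
      (\<Sum>j<d. v j * (\<Sum>l<d. u l * partial (?P j) l (\<lambda>k. y k + t * u k)))) (at t)" if y: "y \<in> Esp d" for y t
    unfolding dirD_eq[OF g i lin[OF y] v]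
    by (intro DERIV_sum DERIV_cmult pd y) simp
  have eq: "dirD d u (dirD d v g) y i = (\<Sum>j<d. v j * (\<Sum>l<d. u l * partial (?P j) l y))" if "y \<in> Esp d" for y
    using DERIV_imp_deriv[OF dd[OF that, of 0]] i by (simp add: dirD_def[of d u])
  show ?thesis using dd[OF x] eq[OF lin[OF x]] by simp
qed

lemma has_derivative_vinner:
  assumes "\<And>i. i < d \<Longrightarrow> ((\<lambda>t. F t i) has_real_derivative F' i) (at t)"
  shows "((\<lambda>t. vinner d e (F t)) has_real_derivative vinner d e F') (at t)"
  unfolding vinner_def by (intro DERIV_sum DERIV_cmult assms) simp

section \<open>Monotonicity, convexity and growth under Assumption A\<close>

locale assumption_A =
  fixes d :: nat and g :: "(nat \<Rightarrow> real) \<Rightarrow> nat \<Rightarrow> real" and \<theta>0 \<theta>1 \<theta>2 \<theta>3 :: real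
  assumes A: "assumptionA d g \<theta>0 \<theta>1 \<theta>2 \<theta>3"
begin

lemma C2: "C2_vec d g" and pos: "\<theta>0 > 0" "\<theta>1 \<ge> 0" "\<theta>2 \<ge> 0" "\<theta>3 \<ge> 0"
  and first_order: "\<And>x u. x \<in> Esp d \<Longrightarrow> u \<in> Esp d \<Longrightarrow>
    vinner d u (dirD d u g x) \<le> - \<theta>0 * (1 + \<theta>1 * rpow (vnorm d x) \<theta>2) * (vnorm d u)\<^sup>2"
  and second_order: "\<And>x u1 u2. x \<in> Esp d \<Longrightarrow> u1 \<in> Esp d \<Longrightarrow> u2 \<in> Esp d \<Longrightarrow>
    vnorm d (dirD d u1 (dirD d u2 g) x) \<le> \<theta>3 * rpow (1 + \<theta>1 * vnorm d x) (\<theta>2 - 1) * vnorm d u1 * vnorm d u2"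
  using A unfolding assumptionA_def by blast+

lemma g_in_Esp: "x \<in> Esp d \<Longrightarrow> g x \<in> Esp d"
  using C2 by (simp add: C2_vec_def)

lemma line_derivative:
  assumes "x \<in> Esp d" "u \<in> Esp d"
  shows "((\<lambda>t. vinner d e (g (\<lambda>k. x k + t * u k))) has_real_derivative vinner d e (dirD d u g (\<lambda>k. x k + t * u k))) (at t)"
  by (rule has_derivative_vinner) (rule has_dirD[OF C2 _ assms])

lemma rpow_nonneg: "r \<ge> 0 \<Longrightarrow> rpow r p \<ge> 0"
  by (simp add: rpow_def)

lemma first_order_weak:
  assumes "x \<in> Esp d" "u \<in> Esp d"
  shows "vinner d u (dirD d u g x) \<le> - \<theta>0 * (vnorm d u)\<^sup>2"
proof -
  have "\<theta>0 * 1 * (vnorm d u)\<^sup>2 \<le> \<theta>0 * (1 + \<theta>1 * rpow (vnorm d x) \<theta>2) * (vnorm d u)\<^sup>2"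
    using pos rpow_nonneg[of "vnorm d x" \<theta>2] by (intro mult_right_mono mult_left_mono) auto
  then show ?thesis using first_order[OF assms] by simp
qed

lemma drift_monotone:
  assumes x: "x \<in> Esp d" and u: "u \<in> Esp d" and t: "t \<ge> 0"
  shows "vinner d u (g (\<lambda>k. x k + t * u k)) \<le> vinner d u (g x) - \<theta>0 * t * (vnorm d u)\<^sup>2"
proof (cases "t = 0")
  case False
  then have t': "0 < t" using t by simp
  have lin: "(\<lambda>k. x k + z * u k) \<in> Esp d" for z using x u by blast
  from MVT2[OF t', of "\<lambda>t. vinner d u (g (\<lambda>k. x k + t * u k))" "\<lambda>t. vinner d u (dirD d u g (\<lambda>k. x k + t * u k))"]
    line_derivative[OF x u]
  obtain z where z: "0 < z" "vinner d u (g (\<lambda>k. x k + t * u k)) - vinner d u (g (\<lambda>k. x k + 0 * u k))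
      = (t - 0) * vinner d u (dirD d u g (\<lambda>k. x k + z * u k))" by blast
  have "t * vinner d u (dirD d u g (\<lambda>k. x k + z * u k)) \<le> t * (- \<theta>0 * (vnorm d u)\<^sup>2)"
    using t by (intro mult_left_mono first_order_weak lin u)
  then show ?thesis using z(2) by (simp add: mult_ac)
qed simp

text \<open>The segment from the origin to \<open>v\<close> is halved. On the first half
  monotonicity suffices; on the second half every point has norm at least half that of
  \<open>v\<close>, so the superlinear part of the first-order bound has a uniform size
  there.\<close>

lemma drift_superlinear:
  assumes v: "v \<in> Esp d"
  shows "vinner d v (g v) \<le> vinner d v (g (\<lambda>_. 0)) - \<theta>0 * \<theta>1 / 2 * rpow (vnorm d v / 2) \<theta>2 * (vnorm d v)\<^sup>2"
proof -
  have z: "(\<lambda>_. 0) \<in> Esp d" by (simp add: Esp_def)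
  have lin: "(\<lambda>k. 0 + z * v k) \<in> Esp d" for z using Esp_combine[OF z v] .
  let ?\<phi> = "\<lambda>t. vinner d v (g (\<lambda>k. 0 + t * v k))"
  have half: "?\<phi> (1 / 2) \<le> vinner d v (g (\<lambda>_. 0))"
    using drift_monotone[OF z v, of "1 / 2"] pos(1)
    by (smt (verit) mult_nonneg_nonneg zero_le_power2 divide_nonneg_nonneg)
  have "(1 / 2 :: real) < 1" by simp
  from MVT2[OF this, of ?\<phi> "\<lambda>t. vinner d v (dirD d v g (\<lambda>k. 0 + t * v k))"] line_derivative[OF z v]
  obtain t where t: "1 / 2 < t" "t < 1" "?\<phi> 1 - ?\<phi> (1 / 2) = (1 - 1 / 2) * vinner d v (dirD d v g (\<lambda>k. 0 + t * v k))"
    by blast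
  have n: "vnorm d (\<lambda>k. 0 + t * v k) = t * vnorm d v" using t vnorm_scale[of d t v] by simp
  have "rpow (vnorm d v / 2) \<theta>2 \<le> rpow (t * vnorm d v) \<theta>2"
  proof -
    have "vnorm d v / 2 \<le> t * vnorm d v" using t mult_right_mono[of "1 / 2" t "vnorm d v"] by simp
    then show ?thesis using pos(3) by (auto simp: rpow_def intro!: powr_mono2)
  qed
  then have "\<theta>0 * (\<theta>1 * rpow (vnorm d v / 2) \<theta>2) * (vnorm d v)\<^sup>2 \<le> \<theta>0 * (1 + \<theta>1 * rpow (t * vnorm d v) \<theta>2) * (vnorm d v)\<^sup>2"
    using pos by (intro mult_right_mono mult_left_mono add_increasing) auto
  then have "vinner d v (dirD d v g (\<lambda>k. 0 + t * v k)) \<le> - (\<theta>0 * (\<theta>1 * rpow (vnorm d v / 2) \<theta>2) * (vnorm d v)\<^sup>2)"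
    using first_order[OF lin[of t] v] unfolding n by linarith
  then have "?\<phi> 1 \<le> ?\<phi> (1 / 2) - \<theta>0 * \<theta>1 / 2 * rpow (vnorm d v / 2) \<theta>2 * (vnorm d v)\<^sup>2"
    using t(3) by (simp add: mult_ac)
  then show ?thesis using half by simp
qed

text \<open>Along the segment, the potential minus its tangent and minus the expected quadratic term
  is nondecreasing, by \<open>drift_monotone\<close>.\<close>

lemma potential_convex:
  assumes U: "\<And>x i. x \<in> Esp d \<Longrightarrow> i < d \<Longrightarrow> ((\<lambda>t. U (\<lambda>k. x k + t * unitv i k)) has_real_derivative (- g x i)) (at 0)"
    and x: "x \<in> Esp d" and y: "y \<in> Esp d"
  shows "U y \<ge> U x - vinner d (g x) (\<lambda>i. y i - x i) + \<theta>0 / 2 * (vnorm d (\<lambda>i. y i - x i))\<^sup>2"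
proof -
  define u where "u = (\<lambda>i. y i - x i)"
  have u: "u \<in> Esp d" using x y by (simp add: u_def Esp_def)
  have cont: "Econt d (\<lambda>x. - g x j)" if "j < d" for j
  proof -
    have "Econt d (\<lambda>x. g x j)" using C2 that by (simp add: C2_vec_def C2_real_def)
    then show ?thesis unfolding Econt_def by (simp add: abs_minus_commute)
  qed
  have dU: "((\<lambda>t. U (\<lambda>k. x k + t * u k)) has_real_derivative - vinner d u (g (\<lambda>k. x k + t * u k))) (at t)" for t
    using directional_derivative[of d U "\<lambda>j x. - g x j", OF U cont x u, of t]
    by (simp add: vinner_def sum_negf)
  define p where "p = vinner d u (g x)"
  define W where "W = (vnorm d u)\<^sup>2"
  let ?\<chi> = "\<lambda>t. U (\<lambda>k. x k + t * u k) + p * t - \<theta>0 / 2 * W * t\<^sup>2"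
  have "?\<chi> 0 \<le> ?\<chi> 1"
  proof (rule DERIV_nonneg_imp_nondecreasing[of 0 1 ?\<chi>])
    fix t :: real assume t: "0 \<le> t" "t \<le> 1"
    have "(?\<chi> has_real_derivative (- vinner d u (g (\<lambda>k. x k + t * u k)) + p * 1 - \<theta>0 / 2 * W * (2 * t))) (at t)"
      by (intro DERIV_diff DERIV_add DERIV_cmult dU DERIV_ident) (auto intro!: derivative_eq_intros)
    moreover have "0 \<le> - vinner d u (g (\<lambda>k. x k + t * u k)) + p * 1 - \<theta>0 / 2 * W * (2 * t)"
      using drift_monotone[OF x u t(1)] by (simp add: p_def W_def mult_ac)
    ultimately show "\<exists>y. (?\<chi> has_real_derivative y) (at t) \<and> 0 \<le> y" by blast
  qed simp
  moreover have "(\<lambda>k. x k + 1 * u k) = y" "(\<lambda>k. x k + 0 * u k) = x" by (auto simp: u_def)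
  ultimately show ?thesis by (simp add: p_def W_def u_def vinner_commute[of d "g x"])
qed

text \<open>If \<open>\<theta>1 = 0\<close> the base of the power is 1; if
  \<open>\<theta>2 = 0\<close> the base is at least 1 and the exponent is -1. Either way the weight
  is at most 1.\<close>

lemma second_order_bounded:
  assumes deg: "\<theta>1 = 0 \<or> \<theta>2 = 0" and x: "x \<in> Esp d" and "u \<in> Esp d" "v \<in> Esp d"
  shows "vnorm d (dirD d u (dirD d v g) x) \<le> \<theta>3 * vnorm d u * vnorm d v"
proof -
  have "rpow (1 + \<theta>1 * vnorm d x) (\<theta>2 - 1) \<le> 1"
  proof (cases "\<theta>1 = 0")
    case False
    then have t2: "\<theta>2 = 0" using deg by simp
    have "1 \<le> 1 + \<theta>1 * vnorm d x" using pos by simp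
    then show ?thesis using t2 by (simp add: rpow_def powr_minus inverse_le_1_iff)
  qed (simp add: rpow_def)
  then have "\<theta>3 * rpow (1 + \<theta>1 * vnorm d x) (\<theta>2 - 1) * vnorm d u * vnorm d v \<le> \<theta>3 * 1 * vnorm d u * vnorm d v"
    using pos by (intro mult_right_mono mult_left_mono) auto
  then show ?thesis using second_order[OF assms(2-4)] by simp
qed

lemma dirD_increment:
  assumes deg: "\<theta>1 = 0 \<or> \<theta>2 = 0" and x: "x \<in> Esp d" and w: "w \<in> Esp d" and v: "v \<in> Esp d"
  shows "\<bar>vinner d e (dirD d v g (\<lambda>k. x k + w k)) - vinner d e (dirD d v g x)\<bar> \<le> \<theta>3 * vnorm d e * vnorm d v * vnorm d w"
proof -
  let ?\<phi> = "\<lambda>t. vinner d e (dirD d v g (\<lambda>k. x k + t * w k))"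
  have "(?\<phi> has_real_derivative vinner d e (dirD d w (dirD d v g) (\<lambda>k. x k + t * w k))) (at t)" for t
    by (rule has_derivative_vinner) (rule has_dirD2[OF C2 _ x w v])
  from real_mean_value[of ?\<phi>, OF this, of 1]
  obtain t where t: "?\<phi> 1 - ?\<phi> 0 = vinner d e (dirD d w (dirD d v g) (\<lambda>k. x k + t * w k))" by auto
  have "(\<lambda>k. x k + t * w k) \<in> Esp d" using x w by blast
  note so = second_order_bounded[OF deg this w v]
  have "\<bar>?\<phi> 1 - ?\<phi> 0\<bar> \<le> vnorm d e * vnorm d (dirD d w (dirD d v g) (\<lambda>k. x k + t * w k))"
    unfolding t by (rule vinner_abs_le)
  also have "\<dots> \<le> vnorm d e * (\<theta>3 * vnorm d w * vnorm d v)" by (intro mult_left_mono so) simp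
  finally show ?thesis by (simp add: mult_ac)
qed

text \<open>There is no mean value theorem for vectors, so the increment is paired with a fixed
  \<open>e\<close>; the intermediate point depends on \<open>e\<close>.\<close>

lemma line_increment:
  assumes x: "x \<in> Esp d" and v: "v \<in> Esp d"
  shows "\<exists>t. \<bar>t\<bar> \<le> 1 \<and> vinner d e (\<lambda>i. g (\<lambda>k. x k + v k) i - g x i) = vinner d e (dirD d v g (\<lambda>k. x k + t * v k))"
proof -
  from real_mean_value[of "\<lambda>t. vinner d e (g (\<lambda>k. x k + t * v k))", OF line_derivative[OF x v], of 1]
  show ?thesis by (auto simp: vinner_diff_right)
qed

text \<open>The derivative at the origin has to be bounded by \<theta>3 and \<theta>4 alone. For a
  unit vector, the increment of g from the origin is at most 3 \<theta>4, it is a derivative at some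
  point of norm at most 1, and moving that derivative to the origin costs \<theta>3. From the
  origin, the Lipschitz bound on the derivative reaches any segment.\<close>

lemma drift_growth:
  assumes deg: "\<theta>1 = 0 \<or> \<theta>2 = 0" and \<theta>4: "\<theta>4 > 0"
    and gb: "\<And>x. x \<in> Esp d \<Longrightarrow> vnorm d (g x) \<le> \<theta>4 * (1 + vnorm d x powr (1 + \<theta>2))"
    and x: "x \<in> Esp d" and y: "y \<in> Esp d"
  shows "vnorm d (\<lambda>i. g y i - g x i)
    \<le> vnorm d (\<lambda>i. y i - x i) * ((3 * \<theta>4 + \<theta>3) + \<theta>3 * vnorm d x) + \<theta>3 * (vnorm d (\<lambda>i. y i - x i))\<^sup>2"
proof -
  have z: "(\<lambda>_. 0) \<in> Esp d" by (simp add: Esp_def)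
  have unit: "\<bar>vinner d e (dirD d v g (\<lambda>_. 0))\<bar> \<le> vnorm d e * (3 * \<theta>4 + \<theta>3)"
    if v: "v \<in> Esp d" "vnorm d v = 1" for e v
  proof -
    from line_increment[OF z v(1), of e] obtain t where t: "\<bar>t\<bar> \<le> 1"
      "vinner d e (\<lambda>i. g v i - g (\<lambda>_. 0) i) = vinner d e (dirD d v g (\<lambda>k. 0 + t * v k))" by auto
    have tv: "(\<lambda>k. t * v k) \<in> Esp d" using v(1) by (simp add: Esp_def)
    have "\<bar>vinner d e (dirD d v g (\<lambda>k. 0 + t * v k)) - vinner d e (dirD d v g (\<lambda>_. 0))\<bar> \<le> \<theta>3 * vnorm d e * 1 * (\<bar>t\<bar> * 1)"
      using dirD_increment[OF deg z tv v(1), of e] v(2) by (simp add: vnorm_scale)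
    also have "\<dots> \<le> \<theta>3 * vnorm d e * 1 * (1 * 1)" using t(1) pos by (intro mult_left_mono) auto
    finally have 1: "\<bar>vinner d e (dirD d v g (\<lambda>k. 0 + t * v k)) - vinner d e (dirD d v g (\<lambda>_. 0))\<bar> \<le> \<theta>3 * vnorm d e" by simp
    \<comment> \<open>The growth bound gives the factor 1 + 1 at a unit vector and only 1 at the
      origin.\<close>
    have "vnorm d (g v) \<le> 2 * \<theta>4" "vnorm d (g (\<lambda>_. 0)) \<le> \<theta>4" using gb[OF v(1)] gb[OF z] v(2) by auto
    then have g3: "vnorm d (\<lambda>i. g v i - g (\<lambda>_. 0) i) \<le> 3 * \<theta>4" using vnorm_tri_diff[of d "g v" "g (\<lambda>_. 0)"] by linarith
    have "\<bar>vinner d e (\<lambda>i. g v i - g (\<lambda>_. 0) i)\<bar> \<le> vnorm d e * vnorm d (\<lambda>i. g v i - g (\<lambda>_. 0) i)" by (rule vinner_abs_le)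
    also have "\<dots> \<le> vnorm d e * (3 * \<theta>4)" by (intro mult_left_mono g3) simp
    finally show ?thesis using 1 t(2) by (simp add: algebra_simps)
  qed
  define v where "v = (\<lambda>i. y i - x i)"
  have v: "v \<in> Esp d" using x y by (simp add: v_def Esp_def)
  have yv: "(\<lambda>k. x k + v k) = y" by (auto simp: v_def)
  \<comment> \<open>Extension from unit vectors by linearity of the derivative in the
    direction.\<close>
  have origin: "\<bar>vinner d e (dirD d v g (\<lambda>_. 0))\<bar> \<le> vnorm d e * (vnorm d v * (3 * \<theta>4 + \<theta>3))" for e
  proof (cases "vnorm d v = 0")
    case True
    then have "v j = 0" if "j < d" for j using vnorm_component[OF that, of v] by simp
    then have "vinner d e (dirD d v g (\<lambda>_. 0)) = 0"
      by (simp add: vinner_def dirD_eq[OF C2 _ z v])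
    then show ?thesis using True by simp
  next
    case False
    define w where "w = (\<lambda>i. 1 / vnorm d v * v i)"
    have w: "w \<in> Esp d" "vnorm d w = 1"
      using v False unfolding w_def vnorm_scale by (auto simp: Esp_def)
    have "vinner d e (dirD d v g (\<lambda>_. 0)) = vnorm d v * vinner d e (dirD d w g (\<lambda>_. 0))"
      unfolding vinner_def sum_distrib_left
    proof (intro sum.cong refl)
      fix i assume "i \<in> {..<d}"
      then have i: "i < d" by simp
      have "v j = vnorm d v * w j" for j using False by (simp add: w_def)
      then have "dirD d v g (\<lambda>_. 0) i = vnorm d v * dirD d w g (\<lambda>_. 0) i"
        unfolding dirD_eq[OF C2 i z v] dirD_eq[OF C2 i z w(1)] sum_distrib_left
        by (intro sum.cong refl) (metis mult.assoc)
      then show "e i * dirD d v g (\<lambda>_. 0) i = vnorm d v * (e i * dirD d w g (\<lambda>_. 0) i)" by simp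
    qed
    then have "\<bar>vinner d e (dirD d v g (\<lambda>_. 0))\<bar> = vnorm d v * \<bar>vinner d e (dirD d w g (\<lambda>_. 0))\<bar>" by (simp add: abs_mult)
    also have "\<dots> \<le> vnorm d v * (vnorm d e * (3 * \<theta>4 + \<theta>3))" by (intro mult_left_mono unit w) simp
    finally show ?thesis by (simp add: mult_ac)
  qed
  \<comment> \<open>Pairing the increment with itself yields its squared norm, of which one factor
    cancels.\<close>
  define e where "e = (\<lambda>i. g y i - g x i)"
  from line_increment[OF x v, of e] obtain t where t: "\<bar>t\<bar> \<le> 1"
    "vinner d e e = vinner d e (dirD d v g (\<lambda>k. x k + t * v k))" unfolding yv e_def[symmetric] by blast
  define w where "w = (\<lambda>k. x k + t * v k)"
  have w: "w \<in> Esp d" unfolding w_def using x v by blast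
  have nw: "vnorm d w \<le> vnorm d x + vnorm d v"
  proof -
    have "vnorm d w \<le> vnorm d x + \<bar>t\<bar> * vnorm d v" unfolding w_def by (rule order_trans[OF vnorm_tri]) (simp add: vnorm_scale)
    also have "\<bar>t\<bar> * vnorm d v \<le> 1 * vnorm d v" using t by (intro mult_right_mono) auto
    finally show ?thesis by simp
  qed
  have inc: "\<bar>vinner d e (dirD d v g w) - vinner d e (dirD d v g (\<lambda>_. 0))\<bar> \<le> \<theta>3 * vnorm d e * vnorm d v * vnorm d w"
    using dirD_increment[OF deg z w v, of e] by simp
  have "vnorm d e * vnorm d e = vinner d e (dirD d v g w)"
    using t(2) vnorm_sq_vinner[of d e] by (simp add: w_def power2_eq_square)
  also have "\<dots> \<le> vnorm d e * (vnorm d v * (3 * \<theta>4 + \<theta>3)) + \<theta>3 * vnorm d e * vnorm d v * vnorm d w"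
    using inc origin[of e] by linarith
  also have "\<dots> \<le> vnorm d e * (vnorm d v * (3 * \<theta>4 + \<theta>3)) + \<theta>3 * vnorm d e * vnorm d v * (vnorm d x + vnorm d v)"
    using pos by (intro add_left_mono mult_left_mono nw) auto
  also have "\<dots> = vnorm d e * (vnorm d v * ((3 * \<theta>4 + \<theta>3) + \<theta>3 * vnorm d x) + \<theta>3 * (vnorm d v)\<^sup>2)"
    by (simp add: algebra_simps power2_eq_square)
  finally have *: "vnorm d e * vnorm d e \<le> vnorm d e * (vnorm d v * ((3 * \<theta>4 + \<theta>3) + \<theta>3 * vnorm d x) + \<theta>3 * (vnorm d v)\<^sup>2)" .
  have "vnorm d e \<le> vnorm d v * ((3 * \<theta>4 + \<theta>3) + \<theta>3 * vnorm d x) + \<theta>3 * (vnorm d v)\<^sup>2"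
  proof (cases "vnorm d e = 0")
    case True
    then show ?thesis using pos \<theta>4 by simp
  next
    case False
    then have "vnorm d e > 0" using vnorm_nonneg[of d e] by linarith
    then show ?thesis using * by simp
  qed
  then show ?thesis by (simp add: e_def v_def)
qed

end

subsection \<open>Superlinear drifts\<close>

lemma Econt_measurable:
  assumes f: "Econt d f" shows "(\<lambda>x. f (emb d x)) \<in> borel_measurable Rsp"
proof (rule borel_measurable_vnorm_continuous)
  fix x and e :: real assume "e > 0"
  then obtain \<delta> where \<delta>: "\<delta> > 0" "\<And>y. y \<in> Esp d \<Longrightarrow> vnorm d (\<lambda>i. y i - emb d x i) < \<delta> \<Longrightarrow> \<bar>f y - f (emb d x)\<bar> < e"
    using f emb_Esp unfolding Econt_def by blast
  have "vnorm d (\<lambda>i. emb d y i - emb d x i) = vnorm d (\<lambda>i. y i - x i)" for y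
    by (rule vnorm_cong) (simp add: emb_def)
  then show "\<exists>\<delta>>0. \<forall>y. vnorm d (\<lambda>i. y i - x i) < \<delta> \<longrightarrow> \<bar>f (emb d y) - f (emb d x)\<bar> < e"
    using \<delta> by (intro exI[of _ \<delta>]) auto
qed

lemma emeasure_stdn_greater_pos: "emeasure stdn {K<..} > 0"
proof -
  have "emeasure stdn {K<..} \<noteq> 0"
  proof
    assume "emeasure stdn {K<..} = 0"
    then have "(\<integral>\<^sup>+x. ennreal (std_normal_density x) * indicator {K<..} x \<partial>lborel) = 0"
      by (subst (asm) emeasure_density) auto
    then have "AE x in lborel. ennreal (std_normal_density x) * indicator {K<..} x = 0"
      by (subst (asm) nn_integral_0_iff_AE) auto
    then have "AE x in lborel. x \<notin> {K<..<K + 1}"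
    proof (rule AE_mp, intro AE_I2 impI)
      fix x assume "ennreal (std_normal_density x) * indicator {K<..} x = 0"
      moreover have "ennreal (std_normal_density x) > 0" by (simp add: normal_density_pos)
      ultimately show "x \<notin> {K<..<K + 1}" by (auto simp: indicator_def)
    qed
    then have "emeasure lborel {K<..<K + 1} = 0"
      by (subst (asm) AE_iff_measurable[of "{K<..<K + 1}"]) auto
    then show False by simp
  qed
  then show ?thesis by (simp add: zero_less_iff_neq_zero)
qed

text \<open>The first coordinate alone exceeds any level with positive probability, and it is
  dominated by the norm; this is where d >= 1 is used.\<close>

lemma gaussE_escape_pos:
  assumes d: "d \<ge> 1" and c: "c > 0"
  shows "emeasure (gaussE d) {z. vnorm d (\<lambda>i. a i + c * z i) > r} > 0"
proof -
  let ?K = "(r - a 0) / c"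
  have d0: "0 < d" using d by simp
  have s1: "{z. z 0 > ?K} \<subseteq> {z. vnorm d (\<lambda>i. a i + c * z i) > r}"
  proof
    fix z :: "nat \<Rightarrow> real" assume "z \<in> {z. z 0 > ?K}"
    then have "r < a 0 + c * z 0" using c by (simp add: pos_divide_less_eq mult.commute)
    also have "\<dots> \<le> vnorm d (\<lambda>i. a i + c * z i)"
      using vnorm_component[OF d0, of "\<lambda>i. a i + c * z i"] by simp
    finally show "z \<in> {z. vnorm d (\<lambda>i. a i + c * z i) > r}" by simp
  qed
  have m: "(\<lambda>z. vnorm d (\<lambda>i. a i + c * z i)) \<in> borel_measurable Rsp"
    by (rule measurable_vnorm) measurable
  have s2: "{z. vnorm d (\<lambda>i. a i + c * z i) > r} \<in> sets (gaussE d)"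
    using borel_measurable_less[OF borel_measurable_const m, of r] by simp
  have "0 < emeasure stdn {?K<..}" by (rule emeasure_stdn_greater_pos)
  also have "\<dots> = emeasure (distr (gaussE d) borel (\<lambda>z. z 0)) {?K<..}" by (simp only: distr_gaussE_component[OF d0])
  also have "\<dots> = emeasure (gaussE d) ((\<lambda>z. z 0) -` {?K<..} \<inter> space (gaussE d))"
    by (rule emeasure_distr) auto
  also have "(\<lambda>z. z 0) -` {?K<..} \<inter> space (gaussE d) = {z. z 0 > ?K}" by auto
  also have "emeasure (gaussE d) \<dots> \<le> emeasure (gaussE d) {z. vnorm d (\<lambda>i. a i + c * z i) > r}"
    by (rule emeasure_mono[OF s1 s2])
  finally show ?thesis .
qed

text \<open>Along the radii \<open>2^k r\<close> the losses \<open>\<delta> / (4^k r^2)\<close> are summable, so the tail cannot vanish.\<close>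

lemma doubling_tail_contradiction:
  fixes \<Phi> :: "real \<Rightarrow> real"
  assumes pos: "\<And>r. \<Phi> r > 0" and step: "\<And>r. r \<ge> R0 \<Longrightarrow> \<Phi> (2 * r) \<ge> \<Phi> r * (1 - \<delta> / r\<^sup>2)"
    and lim: "\<And>r. r > 0 \<Longrightarrow> (\<lambda>k. \<Phi> (2 ^ k * r)) \<longlonglongrightarrow> 0"
  shows False
proof -
  \<comment> \<open>Large enough that the first relative loss \<delta> / r^2 is at most 3 /
    8.\<close>
  define r where "r = max 1 (max R0 (sqrt (8 / 3 * \<bar>\<delta>\<bar>)))"
  have r: "r \<ge> 1" "r \<ge> R0" by (auto simp: r_def)
  have "8 / 3 * \<bar>\<delta>\<bar> \<le> r\<^sup>2"
  proof -
    have "(sqrt (8 / 3 * \<bar>\<delta>\<bar>))\<^sup>2 \<le> r\<^sup>2" by (intro power_mono) (auto simp: r_def)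
    then show ?thesis by simp
  qed
  then have dr: "\<delta> / r\<^sup>2 \<le> 3 / 8" using r by (simp add: pos_divide_le_eq)
  \<comment> \<open>An explicit lower bound that is stable under the step. With q = 4^(-k), (1/2 +
    q/2) (1 - 3q/8) = 1/2 + 5q/16 - 3q^2/16, which is at least 1/2 + q/8 because q^2 <= q; and q/8
    is the next value of q/2.\<close>
  have "\<Phi> (2 ^ k * r) \<ge> \<Phi> r * (1 / 2 + 1 / 2 * (1 / 4) ^ k)" for k
  proof (induction k)
    case (Suc k)
    define q where "q = (1 / 4 :: real) ^ k"
    have q: "0 < q" "q \<le> 1" by (auto simp: q_def power_le_one)
    have "1 * R0 \<le> 2 ^ k * r \<or> R0 \<le> 0" using r by (intro disjCI mult_mono) auto
    moreover have "2 ^ k * r \<ge> 0" using r by simp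
    ultimately have R: "2 ^ k * r \<ge> R0" by linarith
    have "\<delta> / (2 ^ k * r)\<^sup>2 = \<delta> / r\<^sup>2 * q"
    proof -
      have "(2 ^ k)\<^sup>2 = (4 :: real) ^ k" by (simp add: power2_eq_square flip: power_mult_distrib)
      then show ?thesis by (simp add: q_def power_mult_distrib power_one_over)
    qed
    also have "\<dots> \<le> 3 / 8 * q" using dr q by (intro mult_right_mono) auto
    finally have b: "1 - \<delta> / (2 ^ k * r)\<^sup>2 \<ge> 1 - 3 / 8 * q" by simp
    have "1 / 2 + 1 / 2 * (1 / 4) ^ Suc k \<le> (1 / 2 + 1 / 2 * q) * (1 - 3 / 8 * q)"
    proof -
      have "q * q \<le> q" using q by (simp add: mult_left_le)
      moreover have "(1 / 2 + 1 / 2 * q) * (1 - 3 / 8 * q) = 1 / 2 + 5 / 16 * q - 3 / 16 * (q * q)"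
        by (simp add: field_simps)
      moreover have "(1 / 4) ^ Suc k = q / 4" by (simp add: q_def)
      ultimately show ?thesis by linarith
    qed
    then have "\<Phi> r * (1 / 2 + 1 / 2 * (1 / 4) ^ Suc k) \<le> \<Phi> r * ((1 / 2 + 1 / 2 * q) * (1 - 3 / 8 * q))"
      using pos[of r] by (intro mult_left_mono) auto
    also have "\<dots> = (\<Phi> r * (1 / 2 + 1 / 2 * q)) * (1 - 3 / 8 * q)" by simp
    also have "\<dots> \<le> \<Phi> (2 ^ k * r) * (1 - 3 / 8 * q)"
      using Suc q by (intro mult_right_mono) (auto simp: q_def)
    also have "\<dots> \<le> \<Phi> (2 ^ k * r) * (1 - \<delta> / (2 ^ k * r)\<^sup>2)"
      using b pos[of "2 ^ k * r"] by (intro mult_left_mono) auto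
    also have "\<dots> \<le> \<Phi> (2 * (2 ^ k * r))" by (rule step[OF R])
    finally show ?case by (simp add: mult.assoc)
  qed simp
  moreover have "\<Phi> r * (1 / 2) \<le> \<Phi> r * (1 / 2 + 1 / 2 * (1 / 4) ^ k)" for k
    using pos[of r] by (intro mult_left_mono) auto
  ultimately have "\<Phi> r * (1 / 2) \<le> \<Phi> (2 ^ k * r)" for k by (meson order_trans)
  then have "\<Phi> r * (1 / 2) \<le> 0" using r by (intro LIMSEQ_le_const[OF lim[of r]]) auto
  then show False using pos[of r] by simp
qed

context assumption_A
begin

lemma measurable_g_emb: "(\<lambda>x. g (emb d x) i) \<in> borel_measurable Rsp"
proof (cases "i < d")
  case True
  then have "Econt d (\<lambda>x. g x i)" using C2 by (simp add: C2_vec_def C2_real_def)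
  then show ?thesis by (rule Econt_measurable)
next
  case False
  then have "g (emb d x) i = 0" for x using g_in_Esp[OF emb_Esp, of x] by (simp add: Esp_def)
  then show ?thesis by simp
qed

text \<open>By \<open>drift_superlinear\<close> and Cauchy--Schwarz, |g v| is at least \<kappa> (r /
  2)^\<theta>2 r - |g 0|, which outgrows every multiple of r. The step size is fixed, so the Euler
  map expands outside a large ball.\<close>

lemma drift_dominates:
  assumes t: "\<theta>1 > 0" "\<theta>2 > 0" and s: "s > 0"
  shows "\<exists>R0>0. \<forall>v\<in>Esp d. vnorm d v \<ge> R0 \<longrightarrow> 4 * vnorm d v \<le> s * vnorm d (g v)"
proof -
  define q where "q = vnorm d (g (\<lambda>_. 0))"
  define \<kappa> where "\<kappa> = \<theta>0 * \<theta>1 / 2"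
  have \<kappa>: "\<kappa> > 0" using pos t by (simp add: \<kappa>_def)
  \<comment> \<open>Once the superlinear factor reaches \<open>B\<close>, the scaled drift exceeds 4
    r even after the drift at the origin has been subtracted.\<close>
  define B where "B = (4 + s * q) / (s * \<kappa>)"
  have B: "B > 0" using s \<kappa> by (simp add: B_def q_def add_pos_nonneg)
  define R0 where "R0 = max 1 (2 * B powr (1 / \<theta>2))"
  have "4 * vnorm d v \<le> s * vnorm d (g v)" if v: "v \<in> Esp d" "vnorm d v \<ge> R0" for v
  proof -
    define r where "r = vnorm d v"
    have r: "r \<ge> 1" "r / 2 \<ge> B powr (1 / \<theta>2)" using v by (auto simp: r_def R0_def)
    have "B = (B powr (1 / \<theta>2)) powr \<theta>2" using B t by (simp add: powr_powr)
    also have "\<dots> \<le> (r / 2) powr \<theta>2" using r t by (intro powr_mono2) auto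
    also have "\<dots> = rpow (r / 2) \<theta>2" using t by (simp add: rpow_def)
    finally have BR: "B \<le> rpow (r / 2) \<theta>2" .
    have "\<kappa> * rpow (r / 2) \<theta>2 * r\<^sup>2 \<le> vinner d v (g (\<lambda>_. 0)) - vinner d v (g v)"
      using drift_superlinear[OF v(1)] by (simp add: \<kappa>_def r_def)
    also have "\<dots> \<le> r * q + r * vnorm d (g v)"
      using vinner_abs_le[of d v "g (\<lambda>_. 0)"] vinner_abs_le[of d v "g v"] by (simp add: r_def q_def)
    finally have "r * (\<kappa> * rpow (r / 2) \<theta>2 * r) \<le> r * (q + vnorm d (g v))"
      by (simp add: power2_eq_square algebra_simps)
    then have 1: "\<kappa> * rpow (r / 2) \<theta>2 * r \<le> q + vnorm d (g v)" using r by simp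
    have "\<kappa> * B * r \<le> \<kappa> * rpow (r / 2) \<theta>2 * r" using \<kappa> r BR by (intro mult_right_mono mult_left_mono) auto
    with 1 have "\<kappa> * B * r \<le> q + vnorm d (g v)" by linarith
    then have "s * (\<kappa> * B * r) \<le> s * (q + vnorm d (g v))" using s by (intro mult_left_mono) auto
    moreover have "s * (\<kappa> * B * r) = (4 + s * q) * r" using s \<kappa> by (simp add: B_def)
    ultimately have "(4 + s * q) * r \<le> s * q + s * vnorm d (g v)" by (simp add: distrib_left)
    moreover have "s * q * 1 \<le> s * q * r" using s r by (intro mult_left_mono) (auto simp: q_def)
    ultimately show ?thesis by (simp add: r_def distrib_right)
  qed
  then show ?thesis by (intro exI[of _ R0]) (auto simp: R0_def)
qed

text \<open>Outside a large ball the chain doubles its norm unless the noise is exceptionally large.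
  Stationarity turns this into a recursion for the tail of \<open>N\<close>, which is incompatible
  with the tail being positive and vanishing at infinity.\<close>

lemma superlinear_no_invariant:
  assumes d: "d \<ge> 1" and t: "\<theta>1 > 0" "\<theta>2 > 0" and s: "s > 0" and inv: "invariant_ula d s g N"
  shows False
proof -
  have prob: "prob_space N" and sets: "sets N = sets Rsp"
    and inv': "distr (N \<Otimes>\<^sub>M gaussE d) Rsp (\<lambda>(y, z). ula_step d s g y z) = N"
    using inv by (auto simp: invariant_ula_def)
  interpret N: prob_space N by (rule prob)
  interpret Z: prob_space "gaussE d" by (rule prob_space_gaussE)
  interpret NZ: pair_prob_space N "gaussE d" ..
  have spN: "space N = UNIV" using sets_eq_imp_space_eq[OF sets] by simp
  define T where "T = (\<lambda>p i. (fst p i + s * g (emb d (fst p)) i) + sqrt (2 * s) * snd p i)"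
  have T_eq: "(\<lambda>(y, z). ula_step d s g y z) = T" by (auto simp: T_def ula_step_def fun_eq_iff)
  have T: "T \<in> measurable (N \<Otimes>\<^sub>M gaussE d) Rsp"
  proof -
    have "T \<in> measurable (Rsp \<Otimes>\<^sub>M Rsp) Rsp"
      unfolding T_def
    proof (rule measurable_into_Rsp)
      fix i
      have gf: "(\<lambda>p. g (emb d (fst p)) i) \<in> borel_measurable (Rsp \<Otimes>\<^sub>M Rsp)"
        by (rule measurable_compose[OF measurable_fst measurable_g_emb])
      show "(\<lambda>p. (fst p i + s * g (emb d (fst p)) i) + sqrt (2 * s) * snd p i) \<in> borel_measurable (Rsp \<Otimes>\<^sub>M Rsp)"
        by (intro borel_measurable_add borel_measurable_times borel_measurable_const gf measurable_Rsp_component_fst measurable_Rsp_component_snd)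
    qed
    moreover have "sets (N \<Otimes>\<^sub>M gaussE d) = sets (Rsp \<Otimes>\<^sub>M Rsp)" using sets by (intro sets_pair_measure_cong) auto
    ultimately show ?thesis using measurable_cong_sets by blast
  qed
  have Tinv: "distr (N \<Otimes>\<^sub>M gaussE d) Rsp T = N" using inv' by (simp only: T_eq)
  have tailR: "{x. vnorm d x > r} \<in> sets Rsp" for r
  proof -
    have "(\<lambda>x. vnorm d x) \<in> borel_measurable Rsp" by (rule measurable_vnorm) (rule measurable_Rsp_component)
    from borel_measurable_less[OF borel_measurable_const this, of r] show ?thesis by simp
  qed
  define \<Phi> where "\<Phi> = (\<lambda>r. measure N {x. vnorm d x > r})"
  have spP: "space (N \<Otimes>\<^sub>M gaussE d) = UNIV" by (simp add: space_pair_measure spN)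
  have \<Phi>T: "emeasure N {x. vnorm d x > r} = emeasure (N \<Otimes>\<^sub>M gaussE d) (T -` {x. vnorm d x > r} \<inter> space (N \<Otimes>\<^sub>M gaussE d))" for r
  proof -
    have "emeasure N {x. vnorm d x > r} = emeasure (distr (N \<Otimes>\<^sub>M gaussE d) Rsp T) {x. vnorm d x > r}" by (simp only: Tinv)
    then show ?thesis using emeasure_distr[OF T tailR[of r]] by simp
  qed
  have TS: "T -` {x. vnorm d x > r} \<inter> space (N \<Otimes>\<^sub>M gaussE d) \<in> sets (N \<Otimes>\<^sub>M gaussE d)" for r
    by (rule measurable_sets[OF T tailR])
  obtain R0 where R0: "R0 > 0" "\<And>v. v \<in> Esp d \<Longrightarrow> vnorm d v \<ge> R0 \<Longrightarrow> 4 * vnorm d v \<le> s * vnorm d (g v)"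
    using drift_dominates[OF t s] by blast
  show False
  proof (rule doubling_tail_contradiction)
    \<comment> \<open>From any point one step passes any radius with positive probability, so a
      stationary law charges every tail.\<close>
    show "\<Phi> r > 0" for r
    proof -
      have "emeasure N {x. vnorm d x > r} = (\<integral>\<^sup>+y. emeasure (gaussE d) (Pair y -` (T -` {x. vnorm d x > r} \<inter> space (N \<Otimes>\<^sub>M gaussE d))) \<partial>N)"
        unfolding \<Phi>T by (rule Z.emeasure_pair_measure_alt[OF TS])
      moreover have "\<dots> \<noteq> 0"
      proof
        assume "(\<integral>\<^sup>+y. emeasure (gaussE d) (Pair y -` (T -` {x. vnorm d x > r} \<inter> space (N \<Otimes>\<^sub>M gaussE d))) \<partial>N) = 0"
        then have "AE y in N. emeasure (gaussE d) (Pair y -` (T -` {x. vnorm d x > r} \<inter> space (N \<Otimes>\<^sub>M gaussE d))) = 0"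
          by (subst (asm) nn_integral_0_iff_AE[OF Z.measurable_emeasure_Pair[OF TS]])
        then have "AE y in N. False"
        proof (rule AE_mp, intro AE_I2 impI)
          fix y assume "emeasure (gaussE d) (Pair y -` (T -` {x. vnorm d x > r} \<inter> space (N \<Otimes>\<^sub>M gaussE d))) = 0"
          moreover have "Pair y -` (T -` {x. vnorm d x > r} \<inter> space (N \<Otimes>\<^sub>M gaussE d))
              = {z. vnorm d (\<lambda>i. (y i + s * g (emb d y) i) + sqrt (2 * s) * z i) > r}"
            by (auto simp: spP T_def)
          moreover have "sqrt (2 * s) > 0" using s by simp
          from gaussE_escape_pos[OF d this, of r "\<lambda>i. y i + s * g (emb d y) i"]
          have "emeasure (gaussE d) {z. vnorm d (\<lambda>i. (y i + s * g (emb d y) i) + sqrt (2 * s) * z i) > r} \<noteq> 0" by simp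
          ultimately show False by simp
        qed
        then show False using N.AE_False by simp
      qed
      ultimately have "emeasure N {x. vnorm d x > r} \<noteq> 0" by simp
      then show ?thesis by (simp add: \<Phi>_def N.emeasure_eq_measure zero_less_measure_iff)
    qed
    show "\<Phi> (2 * r) \<ge> \<Phi> r * (1 - (2 * s * real d) / r\<^sup>2)" if r: "r \<ge> R0" for r
    proof -
      have rp: "r > 0" using r R0 by simp
      let ?A = "{x. vnorm d x > r}"
      define S where "S = {z. 2 * s * (vnorm d z)\<^sup>2 \<ge> r\<^sup>2}"
      have mS: "(\<lambda>z. 2 * s * (vnorm d z)\<^sup>2) \<in> borel_measurable Rsp"
        by (intro borel_measurable_times borel_measurable_const borel_measurable_power measurable_vnorm measurable_Rsp_component)
      have SS: "S \<in> sets (gaussE d)"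
        using borel_measurable_le[OF borel_measurable_const mS, of "r\<^sup>2"] by (simp add: S_def)
      \<comment> \<open>Markov's inequality for the second moment: a loss of order 1 / r^2, summable
        along doubled radii.\<close>
      have "measure (gaussE d) {z \<in> space (gaussE d). 2 * s * (vnorm d z)\<^sup>2 \<ge> r\<^sup>2} \<le> (\<integral>z. 2 * s * (vnorm d z)\<^sup>2 \<partial>gaussE d) / r\<^sup>2"
        by (rule integral_Markov_inequality_measure[where A="{}"]) (use s rp gaussE_vnorm2(1)[of d] in auto)
      then have S1: "measure (gaussE d) S \<le> (2 * s * real d) / r\<^sup>2"
        using gaussE_vnorm2[of d] by (simp add: S_def)
      have S2: "measure (gaussE d) (- S) = 1 - measure (gaussE d) S"
        using Z.prob_compl[OF SS] by (simp add: Compl_eq_Diff_UNIV)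
      have Sc: "- S \<in> sets (gaussE d)" using sets.compl_sets[OF SS] by (simp add: Compl_eq_Diff_UNIV)
      have AN: "?A \<in> sets N" using tailR sets by simp
      have sub: "?A \<times> (- S) \<subseteq> T -` {x. vnorm d x > 2 * r} \<inter> space (N \<Otimes>\<^sub>M gaussE d)"
      proof
        fix p assume p: "p \<in> ?A \<times> (- S)"
        define y where "y = fst p"
        define z where "z = snd p"
        have y: "vnorm d y > r" and z: "2 * s * (vnorm d z)\<^sup>2 < r\<^sup>2" using p by (auto simp: y_def z_def S_def)
        have "(sqrt (2 * s) * vnorm d z)\<^sup>2 < r\<^sup>2" using z s by (simp add: power_mult_distrib)
        then have z1: "sqrt (2 * s) * vnorm d z < r" using rp by (rule power_less_imp_less_base[OF _ less_imp_le])
        \<comment> \<open>Of four multiples of the norm one is lost to the position and less than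
          \<open>r\<close> to the noise, leaving more than \<open>2 * r\<close>.\<close>
        have "4 * vnorm d y \<le> s * vnorm d (g (emb d y))" using R0(2)[OF emb_Esp, of y] y r by simp
        also have "\<dots> = vnorm d (\<lambda>i. s * g (emb d y) i)" using s by (simp add: vnorm_scale)
        also have "\<dots> \<le> vnorm d (\<lambda>i. y i + s * g (emb d y) i) + vnorm d y"
          using vnorm_tri_diff[of d "\<lambda>i. y i + s * g (emb d y) i" y] by simp
        also have "vnorm d (\<lambda>i. y i + s * g (emb d y) i) \<le> vnorm d (T p) + vnorm d (\<lambda>i. sqrt (2 * s) * z i)"
          using vnorm_tri_diff[of d "T p" "\<lambda>i. sqrt (2 * s) * z i"] by (simp add: T_def y_def z_def)
        also have "vnorm d (\<lambda>i. sqrt (2 * s) * z i) = sqrt (2 * s) * vnorm d z" using s by (simp add: vnorm_scale)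
        finally have "vnorm d (T p) > 2 * r" using y z1 by linarith
        then show "p \<in> T -` {x. vnorm d x > 2 * r} \<inter> space (N \<Otimes>\<^sub>M gaussE d)" by (simp add: spP)
      qed
      have "ennreal (\<Phi> r * measure (gaussE d) (- S)) = emeasure N ?A * emeasure (gaussE d) (- S)"
        by (simp add: \<Phi>_def N.emeasure_eq_measure Z.emeasure_eq_measure ennreal_mult)
      also have "\<dots> = emeasure (N \<Otimes>\<^sub>M gaussE d) (?A \<times> (- S))"
        by (rule Z.emeasure_pair_measure_Times[OF AN Sc, symmetric])
      also have "\<dots> \<le> emeasure N {x. vnorm d x > 2 * r}"
        unfolding \<Phi>T by (rule emeasure_mono[OF sub TS])
      also have "\<dots> = ennreal (\<Phi> (2 * r))" by (simp add: \<Phi>_def N.emeasure_eq_measure)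
      finally have "\<Phi> r * measure (gaussE d) (- S) \<le> \<Phi> (2 * r)" by (simp add: \<Phi>_def)
      moreover have "\<Phi> r * (1 - (2 * s * real d) / r\<^sup>2) \<le> \<Phi> r * measure (gaussE d) (- S)"
        using S1 by (intro mult_left_mono) (auto simp: S2 \<Phi>_def)
      ultimately show ?thesis by linarith
    qed
    show "(\<lambda>k. \<Phi> (2 ^ k * r)) \<longlonglongrightarrow> 0" if r: "r > 0" for r
    proof -
      define A where "A = (\<lambda>k::nat. {x. vnorm d x > 2 ^ k * r})"
      have "range A \<subseteq> N.events" using tailR sets by (auto simp: A_def)
      moreover have "decseq A"
      proof (rule decseq_SucI, rule subsetI)
        fix k x assume "x \<in> A (Suc k)"
        then have "2 * (2 ^ k * r) < vnorm d x" by (simp add: A_def)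
        moreover have "2 ^ k * r \<ge> 0" using r by simp
        ultimately show "x \<in> A k" by (simp add: A_def)
      qed
      ultimately have "(\<lambda>k. measure N (A k)) \<longlonglongrightarrow> measure N (\<Inter>k. A k)" by (rule N.finite_Lim_measure_decseq)
      moreover have "(\<Inter>k. A k) = {}"
      proof (rule equals0I)
        fix x assume x: "x \<in> (\<Inter>k. A k)"
        obtain k where "vnorm d x / r < 2 ^ k" using real_arch_pow[of 2 "vnorm d x / r"] by auto
        then have "vnorm d x < 2 ^ k * r" using r by (simp add: pos_divide_less_eq)
        moreover have "x \<in> A k" using x by blast
        ultimately show False by (simp add: A_def)
      qed
      ultimately show ?thesis by (simp add: A_def \<Phi>_def)
    qed
  qed
qed

end

subsection \<open>The Wasserstein bound\<close>

text \<open>As a convex function of r^2, r^3 lies above its tangent 3/2 r^2 - 1/2 at r = 1. The mean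
  of that tangent is 3/2 d - 1/2, at least d when d >= 1. Thus the dimension can be charged to the
  third Gaussian moment.\<close>

lemma gaussE_third_moment: 
  assumes d: "d \<ge> 1"
  shows "ennreal (real d) \<le> (\<integral>\<^sup>+z. ennreal (vnorm d z ^ 3) \<partial>gaussE d)"
proof -
  interpret prob_space "gaussE d" by (rule prob_space_gaussE)
  have m: "(\<lambda>z. vnorm d z ^ 3) \<in> borel_measurable Rsp"
    by (intro borel_measurable_power measurable_vnorm measurable_Rsp_component)
  have i3: "integrable (gaussE d) (\<lambda>z. vnorm d z ^ 3)"
  proof (rule Bochner_Integration.integrable_bound)
    show "integrable (gaussE d) (\<lambda>z. (vnorm d z)\<^sup>2 + vnorm d z ^ 4)"
      using gaussE_vnorm2(1) gaussE_vnorm4(1) by simp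
    show "AE z in gaussE d. norm (vnorm d z ^ 3) \<le> norm ((vnorm d z)\<^sup>2 + vnorm d z ^ 4)"
    proof (rule AE_I2)
      fix z
      define r where "r = vnorm d z"
      have "r ^ 3 = r * r\<^sup>2" by (simp add: power3_eq_cube power2_eq_square)
      moreover have "2 * (r * r\<^sup>2) \<le> r\<^sup>2 + (r\<^sup>2)\<^sup>2" using sum_squares_bound[of r "r\<^sup>2"] by simp
      moreover have "(r\<^sup>2)\<^sup>2 = r ^ 4" by simp
      moreover have "r * r\<^sup>2 \<ge> 0" by (simp add: r_def)
      ultimately have "r ^ 3 \<le> r\<^sup>2 + r ^ 4" by linarith
      then show "norm (vnorm d z ^ 3) \<le> norm ((vnorm d z)\<^sup>2 + vnorm d z ^ 4)" by (simp add: r_def)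
    qed
  qed (use m in simp)
  have "real d \<le> 3 / 2 * real d - 1 / 2" using d by simp
  also have "\<dots> = (\<integral>z. 3 / 2 * (vnorm d z)\<^sup>2 - 1 / 2 \<partial>gaussE d)"
    using gaussE_vnorm2[of d] prob_space by simp
  also have "\<dots> \<le> (\<integral>z. vnorm d z ^ 3 \<partial>gaussE d)"
  proof (rule integral_mono[OF _ i3])
    show "integrable (gaussE d) (\<lambda>z. 3 / 2 * (vnorm d z)\<^sup>2 - 1 / 2)" using gaussE_vnorm2(1)[of d] by simp
    fix z
    define r where "r = vnorm d z"
    have "0 \<le> (r - 1)\<^sup>2 * (2 * r + 1)" by (simp add: r_def)
    also have "\<dots> = 2 * (r ^ 3 - (3 / 2 * r\<^sup>2 - 1 / 2))" by (simp add: power2_eq_square power3_eq_cube algebra_simps)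
    finally show "3 / 2 * (vnorm d z)\<^sup>2 - 1 / 2 \<le> vnorm d z ^ 3" by (simp add: r_def)
  qed
  finally have "ennreal (real d) \<le> ennreal (\<integral>z. vnorm d z ^ 3 \<partial>gaussE d)" by (rule ennreal_leI)
  also have "\<dots> = (\<integral>\<^sup>+z. ennreal (vnorm d z ^ 3) \<partial>gaussE d)"
    by (rule nn_integral_eq_integral[OF i3, symmetric]) simp
  finally show ?thesis .
qed

text \<open>The constant of \<open>lip_discrepancy\<close> at a = 3 \<theta>4 + \<theta>3, b =
  \<theta>3 and \<tau> = \<theta>4.\<close>

definition wconst :: "real \<Rightarrow> real \<Rightarrow> real \<Rightarrow> real" where
  "wconst t0 t3 t4 = (1 + t0) / t0 * (8 * (3 * t4 + t3) + 18 * t3 + 4 * t3 * (t4\<^sup>2 / t0\<^sup>2 + 3 / t0))"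

text \<open>Composition with \<open>emb\<close> extends drift and potential to all sequences; the
  estimates survive because norms and inner products see only the first \<open>d\<close>
  coordinates.\<close>

lemma (in assumption_A) langevin_emb:
  assumes deg: "\<theta>1 = 0 \<or> \<theta>2 = 0" and \<theta>4: "\<theta>4 > 0"
    and gb: "\<And>x. x \<in> Esp d \<Longrightarrow> vnorm d (g x) \<le> \<theta>4 * (1 + vnorm d x powr (1 + \<theta>2))"
    and U: "\<And>x i. x \<in> Esp d \<Longrightarrow> i < d \<Longrightarrow> ((\<lambda>t. U (\<lambda>k. x k + t * unitv i k)) has_real_derivative (- g x i)) (at 0)"
  shows "langevin d (\<lambda>x. g (emb d x)) (\<lambda>x. U (emb d x)) \<theta>0 (3 * \<theta>4 + \<theta>3) \<theta>3"
proof
  have e: "vnorm d (\<lambda>i. emb d y i - emb d x i) = vnorm d (\<lambda>i. y i - x i)" for x y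
    by (rule vnorm_cong) (simp add: emb_def)
  have ev: "vinner d z (\<lambda>i. emb d y i - emb d x i) = vinner d z (\<lambda>i. y i - x i)" for x y z
    by (rule vinner_cong) (simp_all add: emb_def)
  show "\<theta>0 > 0" "3 * \<theta>4 + \<theta>3 \<ge> 0" "\<theta>3 \<ge> 0" using pos \<theta>4 by auto
  fix x y
  show "g (emb d x) \<in> Esp d" by (rule g_in_Esp) simp
  show "g (emb d (emb d x)) = g (emb d x)" "U (emb d (emb d x)) = U (emb d x)" by simp_all
  show "U (emb d y) \<ge> U (emb d x) - vinner d (g (emb d x)) (\<lambda>i. y i - x i) + \<theta>0 / 2 * (vnorm d (\<lambda>i. y i - x i))\<^sup>2"
    using potential_convex[of U "emb d x" "emb d y", OF U] by (simp add: e ev)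
  show "vnorm d (\<lambda>i. g (emb d y) i - g (emb d x) i) \<le> vnorm d (\<lambda>i. y i - x i) * (3 * \<theta>4 + \<theta>3 + \<theta>3 * vnorm d x)
      + \<theta>3 * (vnorm d (\<lambda>i. y i - x i))\<^sup>2"
    using drift_growth[OF deg \<theta>4 gb emb_Esp[of d x] emb_Esp[of d y]] by (simp add: e)
qed

lemma (in assumption_A) wdist_bound:
  assumes d: "d \<ge> 1" and deg: "\<theta>1 = 0 \<or> \<theta>2 = 0" and \<theta>4: "\<theta>4 > 0"
    and gb: "\<And>x. x \<in> Esp d \<Longrightarrow> vnorm d (g x) \<le> \<theta>4 * (1 + vnorm d x powr (1 + \<theta>2))"
    and U: "\<And>x i. x \<in> Esp d \<Longrightarrow> i < d \<Longrightarrow> ((\<lambda>t. U (\<lambda>k. x k + t * unitv i k)) has_real_derivative (- g x i)) (at 0)"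
    and K: "K > 0" and \<mu>: "\<mu> = density (lebE d) (\<lambda>x. ennreal (K * exp (- U (emb d x))))" and P: "prob_space \<mu>"
    and s01: "0 < s" "s \<le> 1" and inv: "invariant_ula d s g N"
    and fin: "(\<integral>\<^sup>+w. ennreal (vnorm d (g w) ^ 2) \<partial>N) < \<infinity>"
  shows "wdist d N \<mu> \<le> ennreal (wconst \<theta>0 \<theta>3 \<theta>4) * (ennreal (sqrt s * real d) + ennreal s * (\<integral>\<^sup>+w. ennreal (vnorm d (g w) ^ 2) \<partial>N))"
proof -
  interpret langevin d "\<lambda>x. g (emb d x)" "\<lambda>x. U (emb d x)" \<theta>0 "3 * \<theta>4 + \<theta>3" \<theta>3
    by (rule langevin_emb[OF deg \<theta>4 gb U])
  have prob: "prob_space N" and sets: "sets N = sets Rsp" and AEN: "AE y in N. y \<in> Esp d"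
    and inv': "distr (N \<Otimes>\<^sub>M gaussE d) Rsp (\<lambda>(y, z). ula_step d s g y z) = N"
    using inv by (auto simp: invariant_ula_def)
  have step: "(\<lambda>(y, z). ula_step d s g y z) = (\<lambda>p i. (fst p i + s * g (emb d (fst p)) i) + sqrt (2 * s) * snd p i)"
    by (auto simp: ula_step_def fun_eq_iff)
  have mN: "f \<in> borel_measurable N" if "f \<in> borel_measurable Rsp" for f :: "_ \<Rightarrow> real"
    using that measurable_cong_sets[OF sets refl] by blast
  have mg2: "(\<lambda>x. (vnorm d (g (emb d x)))\<^sup>2) \<in> borel_measurable N"
    by (rule mN) (intro borel_measurable_power measurable_vnorm measurable_g)
  have nn: "(\<integral>\<^sup>+w. ennreal (vnorm d (g w) ^ 2) \<partial>N) = (\<integral>\<^sup>+w. ennreal ((vnorm d (g (emb d w)))\<^sup>2) \<partial>N)"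
  proof (rule nn_integral_cong_AE)
    show "AE w in N. ennreal (vnorm d (g w) ^ 2) = ennreal ((vnorm d (g (emb d w)))\<^sup>2)"
      using AEN by eventually_elim simp
  qed
  have i2: "integrable N (\<lambda>x. (vnorm d (g (emb d x)))\<^sup>2)"
    by (rule integrableI_nonneg[OF mg2]) (use fin nn in auto)
  interpret langevin_chain d "\<lambda>x. g (emb d x)" "\<lambda>x. U (emb d x)" \<theta>0 "3 * \<theta>4 + \<theta>3" \<theta>3 s N
    by (rule langevin_chain.intro[OF langevin_axioms], unfold langevin_chain_axioms_def,
        intro conjI s01(1) prob sets i2) (use inv' in \<open>simp only: step\<close>)
  have I2: "(\<integral>\<^sup>+w. ennreal (vnorm d (g w) ^ 2) \<partial>N) = ennreal G2"
    unfolding nn by (rule nn_integral_eq_integral[OF i2]) simp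
  have z: "(\<lambda>_. 0) \<in> Esp d" by (simp add: Esp_def)
  \<comment> \<open>At the origin the power in the growth bound is 0, which leaves
    \<theta>4.\<close>
  have g0: "g0 \<le> \<theta>4" using gb[OF z] z by simp
  have c: "wconst \<theta>0 \<theta>3 \<theta>4 \<ge> 0" using pos \<theta>4 by (simp add: wconst_def)
  have G2: "G2 \<ge> 0" by simp
  have "ennreal \<bar>(\<integral>x. h x \<partial>N) - (\<integral>x. h x \<partial>\<mu>)\<bar> \<le> ennreal (wconst \<theta>0 \<theta>3 \<theta>4 * (sqrt s * real d + s * G2))"
    if hm: "h \<in> borel_measurable Rsp" and h: "lip1 d h" for h
  proof -
    \<comment> \<open>A \<open>lip1\<close> function is controlled only on \<open>Esp d\<close>.
      Composition with \<open>emb\<close> makes it Lipschitz everywhere and changes neither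
      integral, since both laws are carried by \<open>Esp d\<close>.\<close>
    define k where "k = (\<lambda>x. h (emb d x))"
    have km: "k \<in> borel_measurable Rsp" unfolding k_def by (rule measurable_compose[OF measurable_emb hm])
    have k: "lip d k"
      unfolding lip_def
    proof (intro allI)
      fix x y
      have "vnorm d (\<lambda>i. emb d x i - emb d y i) = vnorm d (\<lambda>i. x i - y i)"
        by (rule vnorm_cong) (simp add: emb_def)
      then show "\<bar>k x - k y\<bar> \<le> vnorm d (\<lambda>i. x i - y i)"
        using h[unfolded lip1_def, rule_format, OF emb_Esp emb_Esp, of x y] by (simp add: k_def)
    qed
    have "(\<integral>x. h x \<partial>N) = (\<integral>x. k x \<partial>N)"
    proof (rule integral_cong_AE[OF mN[OF hm] mN[OF km]])
      show "AE x in N. h x = k x" using AEN by eventually_elim (simp add: k_def)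
    qed
    moreover have "(\<integral>x. h x \<partial>\<mu>) = (\<integral>x. k x \<partial>\<mu>)"
    proof (rule integral_cong_AE)
      have "(\<lambda>x. ennreal (K * exp (- U (emb d x)))) \<in> borel_measurable (lebE d)"
        using measurable_U by simp
      then show "AE x in \<mu>. h x = k x"
        unfolding \<mu>
      proof (subst AE_density)
        show "AE x in lebE d. 0 < ennreal (K * exp (- U (emb d x))) \<longrightarrow> h x = k x"
          using AE_lebE_Esp[of d] by eventually_elim (simp add: k_def)
      qed
    qed (use hm km in \<open>simp_all add: \<mu>\<close>)
    moreover have "\<bar>(\<integral>x. k x \<partial>N) - (\<integral>x. k x \<partial>\<mu>)\<bar> \<le> wconst \<theta>0 \<theta>3 \<theta>4 * (sqrt s * real d + s * G2)"
      unfolding wconst_def by (rule lip_discrepancy[OF s01(2) d K \<mu> P k g0])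
    ultimately show ?thesis by (simp only: ennreal_leI)
  qed
  then have "wdist d N \<mu> \<le> ennreal (wconst \<theta>0 \<theta>3 \<theta>4 * (sqrt s * real d + s * G2))"
    unfolding wdist_def by (intro SUP_least) auto
  also have "\<dots> = ennreal (wconst \<theta>0 \<theta>3 \<theta>4) * (ennreal (sqrt s * real d) + ennreal s * ennreal G2)"
  proof -
    have "ennreal (sqrt s * real d) + ennreal s * ennreal G2 = ennreal (sqrt s * real d + s * G2)"
      using s01 G2 by (simp add: ennreal_mult)
    then show ?thesis using c s01 G2 by (simp add: ennreal_mult)
  qed
  finally show ?thesis by (simp only: I2)
qed

theorem theorem4p1:
  "\<exists>C :: real \<Rightarrow> real \<Rightarrow> real \<Rightarrow> real \<Rightarrow> real \<Rightarrow> real.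
     (\<forall>a0 a1 a2 a3 a4. C a0 a1 a2 a3 a4 > 0) \<and>
     (\<forall>(d::nat) (g :: (nat \<Rightarrow> real) \<Rightarrow> (nat \<Rightarrow> real)) (U :: (nat \<Rightarrow> real) \<Rightarrow> real)
        (K::real) (\<mu> :: (nat \<Rightarrow> real) measure) (\<mu>s :: (nat \<Rightarrow> real) measure) (s::real)
        \<theta>0 \<theta>1 \<theta>2 \<theta>3 \<theta>4.
       d \<ge> 1 \<longrightarrow>
       assumptionA d g \<theta>0 \<theta>1 \<theta>2 \<theta>3 \<longrightarrow>
       \<theta>4 > 0 \<longrightarrow>
       (\<forall>x\<in>Esp d. vnorm d (g x) \<le> \<theta>4 * (1 + vnorm d x powr (1 + \<theta>2))) \<longrightarrow>
       (\<forall>x\<in>Esp d. \<forall>i<d. ((\<lambda>t. U (\<lambda>k. x k + t * unitv i k)) has_real_derivative (- g x i)) (at 0)) \<longrightarrow>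
       K > 0 \<longrightarrow>
       \<mu> = density (lebE d) (\<lambda>x. ennreal (K * exp (- U (emb d x)))) \<longrightarrow>
       prob_space \<mu> \<longrightarrow>
       0 < s \<longrightarrow> s < 1 / exp 1 \<longrightarrow>
       invariant_ula d s g \<mu>s \<longrightarrow>
       wdist d \<mu>s \<mu> \<le>
         ennreal (C \<theta>0 \<theta>1 \<theta>2 \<theta>3 \<theta>4 * sqrt s) *
         ( ennreal \<bar>ln s\<bar> * (\<integral>\<^sup>+ z. ennreal (vnorm d z ^ 3) \<partial>gaussE d)
         + ennreal (s powr (3/2) * \<bar>ln s\<bar>) * (\<integral>\<^sup>+ w. ennreal (vnorm d (g w) ^ 3) \<partial>\<mu>s)
         + ennreal (sqrt s) * (\<integral>\<^sup>+ w. ennreal (vnorm d (g w) ^ 2) \<partial>\<mu>s)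
         + (\<integral>\<^sup>+ wz. ennreal (
               (vnorm d (\<lambda>i. sqrt s * g (fst wz) i + sqrt 2 * snd wz i)) ^ 3 *
               \<bar>ln (vnorm d (\<lambda>i. sqrt s * g (fst wz) i + sqrt 2 * snd wz i))\<bar>)
             \<partial>(\<mu>s \<Otimes>\<^sub>M gaussE d)) ))"
proof (intro exI[of _ "\<lambda>t0 t1 t2 t3 t4. 1 + \<bar>wconst t0 t3 t4\<bar>"] conjI allI impI, goal_cases)
  case 1
  then show ?case by simp
next
  case (2 d g U K \<mu> \<mu>s s \<theta>0 \<theta>1 \<theta>2 \<theta>3 \<theta>4)
  note d = 2(1) and \<theta>4 = 2(3) and K = 2(6) and \<mu> = 2(7) and P = 2(8) and s = 2(9,10) and inv = 2(11)
  interpret assumption_A d g \<theta>0 \<theta>1 \<theta>2 \<theta>3 by standard (rule 2(2))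
  have gb: "\<And>x. x \<in> Esp d \<Longrightarrow> vnorm d (g x) \<le> \<theta>4 * (1 + vnorm d x powr (1 + \<theta>2))" using 2(4) by blast
  have U: "\<And>x i. x \<in> Esp d \<Longrightarrow> i < d \<Longrightarrow> ((\<lambda>t. U (\<lambda>k. x k + t * unitv i k)) has_real_derivative (- g x i)) (at 0)"
    using 2(5) by blast
  \<comment> \<open>s < 1 / e makes the logarithm at least 1 in absolute value, so the dimension
    term, which carries no logarithm, fits under the first summand.\<close>
  have s1: "s \<le> 1" and ln_s: "\<bar>ln s\<bar> \<ge> 1"
  proof -
    have "s < exp (-1)" using s(2) by (simp add: exp_minus divide_inverse)
    then have "ln s < ln (exp (-1))" using s(1) by (subst ln_less_cancel_iff) auto
    then show "\<bar>ln s\<bar> \<ge> 1" by simp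
    have "exp (-1 :: real) \<le> 1" by simp
    then show "s \<le> 1" using \<open>s < exp (-1)\<close> by linarith
  qed
  \<comment> \<open>Positivity is claimed at all real arguments, also where \<open>wconst\<close> is
    negative: hence the absolute value and the summand 1.\<close>
  define C where "C = 1 + \<bar>wconst \<theta>0 \<theta>3 \<theta>4\<bar>"
  have C: "C > 0" "wconst \<theta>0 \<theta>3 \<theta>4 \<le> C" by (auto simp: C_def)
  let ?I2 = "\<integral>\<^sup>+ w. ennreal (vnorm d (g w) ^ 2) \<partial>\<mu>s"
  let ?I3 = "\<integral>\<^sup>+ z. ennreal (vnorm d z ^ 3) \<partial>gaussE d"
  have main: "wdist d \<mu>s \<mu> \<le> ennreal (C * sqrt s) * (ennreal \<bar>ln s\<bar> * ?I3 + ennreal (sqrt s) * ?I2)"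
  \<comment> \<open>If the second moment of the drift is infinite, the right side is infinite.
    Otherwise the chain estimates apply, once superlinear drifts have been excluded.\<close>
  proof (cases "?I2 < \<infinity>")
    case False
    then have "?I2 = \<infinity>" by (simp add: less_top[symmetric])
    then have "ennreal (C * sqrt s) * (ennreal \<bar>ln s\<bar> * ?I3 + ennreal (sqrt s) * ?I2) = \<infinity>"
      using C s(1) by (simp add: ennreal_mult_top ennreal_mult_eq_top_iff)
    then show ?thesis by simp
  next
    case True
    have deg: "\<theta>1 = 0 \<or> \<theta>2 = 0"
    proof (rule ccontr)
      assume "\<not> (\<theta>1 = 0 \<or> \<theta>2 = 0)"
      then have "\<theta>1 > 0" "\<theta>2 > 0" using pos by auto
      from superlinear_no_invariant[OF d this s(1) inv] show False .
    qed
    have "wdist d \<mu>s \<mu> \<le> ennreal (wconst \<theta>0 \<theta>3 \<theta>4) * (ennreal (sqrt s * real d) + ennreal s * ?I2)"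
      by (rule wdist_bound[OF d deg \<theta>4 gb U K \<mu> P s(1) s1 inv True])
    also have "\<dots> \<le> ennreal C * (ennreal (sqrt s * real d) + ennreal s * ?I2)"
      using C by (intro mult_right_mono ennreal_leI) auto
    also have "ennreal (sqrt s * real d) + ennreal s * ?I2 = ennreal (sqrt s) * (ennreal (real d) + ennreal (sqrt s) * ?I2)"
    proof -
      have "ennreal s = ennreal (sqrt s) * ennreal (sqrt s)" using s(1) by (simp flip: ennreal_mult)
      then show ?thesis using s(1) by (simp add: ennreal_mult distrib_left mult.assoc)
    qed
    also have "ennreal (real d) + ennreal (sqrt s) * ?I2 \<le> ennreal \<bar>ln s\<bar> * ?I3 + ennreal (sqrt s) * ?I2"
    proof (rule add_right_mono)
      have "ennreal (real d) \<le> 1 * ?I3" using gaussE_third_moment[OF d] by simp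
      also have "\<dots> \<le> ennreal \<bar>ln s\<bar> * ?I3" using ln_s by (intro mult_right_mono) auto
      finally show "ennreal (real d) \<le> ennreal \<bar>ln s\<bar> * ?I3" .
    qed
    finally show ?thesis using C s(1) by (simp add: ennreal_mult mult.assoc mult_left_mono)
  qed
  \<comment> \<open>The other two summands are nonnegative and only enlarge the bound.\<close>
  show ?case
    unfolding C_def[symmetric]
    by (rule order_trans[OF main], intro mult_left_mono) (auto intro!: add_mono simp: add_increasing2)
qed

end
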